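(* Consider the multistage stochastic program with a random number of stages $$ (P)\qquad \inf\ \mathbb{E}_{\xi_2,\ldots,\xi_{T_{\max}},D_2,\ldots,D_{T_{\max}}}\Big[\sum_{t=1}^{T_{\max}} D_{t-1} f_t(x_t,x_{t-1},\xi_t)\Big]\quad\text{s.t.}\quad x_t\in X_t(x_{t-1},\xi_t)\ \text{a.s.},\ x_t\ \overline{\mathcal F}_t\text{-measurable},\ t=1,\ldots,T_{\max}, $$ where $\overline{\mathcal F}_t=\sigma(\xi_j,D_j, j\le t)$, $x_0$ is given, $D_0=1$ and $D_t=\mathbf 1_{T>t}$ for $t\ge 1$. Assume that the number of stages $T$ is a discrete random variable with support $\{2,\ldots,T_{\max}\}$, that for every $t$ the variable $\xi_t$ does not depend on $(\xi_1,\ldots,\xi_{t-1},D_t)$ and $D_t$ only depends on $D_{t-1}$, and that $\xi_t$ has a discrete distribution with finite support $\{\xi_{t1},\ldots,\xi_{tM_t}\}$, $p_{tj}=\mathbb P(\xi_t=\xi_{tj})>0$ ($\xi_1$ being deterministic). Assume moreover that one of the following holds: (L) (linear problems) $f_t(x_t,x_{t-1},\xi_t)=c_t^Tx_t$ and $X_t(x_{t-1},\xi_t)=\{x_t\in\mathbb R^n: A_tx_t+B_tx_{t-1}=b_t,\ x_t\ge 0\}$, where $\xi_t$ is the concatenation of the elements of $A_t,B_t,b_t,c_t$; the set $X_1(x_0,\xi_1)$ is nonempty and bounded, and for every $x_1\in X_1(x_0,\xi_1)$, every $t=2,\ldots,T_{\max}$, every realization $\tilde\xi_2,\ldots,\tilde\xi_t$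 of $\xi_2,\ldots,\xi_t$, and every $x_\tau\in X_\tau(x_{\tau-1},\tilde\xi_\tau)$, $\tau=2,\ldots,t-1$, the set $X_t(x_{t-1},\tilde\xi_t)$ is nonempty and bounded; (NL) (nonlinear problems) $X_t(x_{t-1},\xi_t)=\{x_t\in\mathbb R^n: x_t\in\mathcal X_t,\ g_t(x_t,x_{t-1},\xi_t)\le 0,\ A_tx_t+B_tx_{t-1}=b_t\}$, where $\xi_t$ contains in particular the random elements of $A_t,B_t,b_t$, and for each $t=1,\ldots,T_{\max}$ there is $\varepsilon_t>0$ such that, with $\mathcal X_{t-1}^{\varepsilon_t}=\mathcal X_{t-1}+\{x\in\mathbb R^n:\|x\|_2\le\varepsilon_t\}$ and $\mathcal X_0=\{x_0\}$: (a) $\mathcal X_t$ is nonempty, convex and compact; (b) for every $j=1,\ldots,M_t$, $f_t(\cdot,\cdot,\xi_{tj})$ is convex, lower semicontinuous and finite on $\mathcal X_t\times\mathcal X_{t-1}^{\varepsilon_t}$; (c) for every $j=1,\ldots,M_t$, each component $g_{t,i}(\cdot,\cdot,\xi_{tj})$, $i=1,\ldots,p$, of $g_t(\cdot,\cdot,\xi_{tj})$ is convex, lower semicontinuous and finite on $\mathcal X_t\times\mathcal X_{t-1}^{\varepsilon_t}$; (d) for every $j=1,\ldots,M_t$ and every $x_{t-1}\in\mathcal X_{t-1}^{\varepsilon_t}$, the set $X_t(x_{t-1},\xi_{tj})$ is nonempty; (e) if $t\ge 2$, for every $j=1,\ldots,M_t$ there exists $\bar x_{t,j}=(\bar x_{t,j,t},\bar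 x_{t,j,t-1})\in \mathrm{ri}(\mathcal X_t)\times\mathcal X_{t-1}\,\cap\,\mathrm{ri}(\{g_t(\cdot,\cdot,\xi_{tj})\le 0\})$ such that $\bar x_{t,j,t}\in X_t(\bar x_{t,j,t-1},\xi_{tj})$. Let $(x_t^k)_{k\ge1}$, $t=1,\ldots,T_{\max}$, $(\mathcal Q_t^k(\cdot,1))_{k\ge 0}$, $t=2,\ldots,T_{\max}$, and $\underline L_k$, $k\ge 1$, be generated by the algorithm SDDP-TSto described in the context. Assume that samples in the forward passes are independent: the sample $((\tilde\xi_1^k,\tilde D_1^k),\ldots,(\tilde\xi_{T_{\max}}^k,\tilde D_{T_{\max}}^k))$ used in the forward pass of iteration $k$ is a realization of a random vector $\gamma^k=((\xi_1^k,D_1^k),\ldots,(\xi_{T_{\max}}^k,D_{T_{\max}}^k))$ that has the distribution of $((\xi_1,D_1),\ldots,(\xi_{T_{\max}},D_{T_{\max}}))$, and $\gamma^1,\gamma^2,\ldots$ are independent. Then, with $\mathcal Q_t(\cdot,1)$ the cost-to-go functions defined in the context: (i) for $t=2,\ldots,T_{\max}+1$ and all $k\ge 0$, $\mathcal Q_t^k(\cdot,1)$ is a lower bounding function for $\mathcal Q_t(\cdot,1)$: for all $x_{t-1}$ we have $\mathcal Q_t(x_{t-1},1)\ge\mathcal Q_t^k(x_{t-1},1)$ almost surely; (ii) $\underline L_k$ is a lower bound on the optimal value of $(P)$; (iii) almost surely, the limit of the sequence $\big(f_1(x_1^k,x_0,\xi_1)+\mathcal Q_2^k(x_1^k,1)\big)_{k\ge1}$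 is the optimal value of $(P)$.
   Context: **Probabilistic setting.** $T_{\max}\ge 2$ is a fixed integer. $T$ is a random variable with support $\{2,\ldots,T_{\max}\}$; $D_0=1$ and $D_t=\mathbf 1_{T>t}$ for $t=1,\ldots,T_{\max}$ (so $D_1=1$ and $D_{T_{\max}}=0$ almost surely). The dependence assumptions mean: $\xi_1$ is deterministic (so $M_1=1$, $\xi_{11}=\xi_1$), $\xi_2,\ldots,\xi_{T_{\max}}$ are mutually independent, the process $(\xi_t)$ is independent of the process $(D_t)$, and $(D_t)$ is a two-state inhomogeneous Markov chain with absorbing state $0$ and $q_t:=\mathbb P(D_t=0\mid D_{t-1}=1)$. With $p_t=\mathbb P(T=t)$, these transition probabilities are given by $q_2=p_2$ and $q_t=p_t/\prod_{k=2}^{t-1}(1-q_k)$ for $t=3,\ldots,T_{\max}$; in particular $q_{T_{\max}}=1$. Infima over empty sets equal $+\infty$; $\mathrm{ri}$ denotes relative interior. The decisions $x_t$ are in $\mathbb R^n$. **Cost-to-go functions (dynamic programming equations).** $\mathcal Q_{T_{\max}+1}(\cdot,0)=\mathcal Q_{T_{\max}+1}(\cdot,1)\equiv 0$, and for $t=2,\ldots,T_{\max}$: $\mathcal Q_t(\cdot,0)\equiv0$ and $$\mathcal Q_t(x_{t-1},1)=(1-q_t)\sum_{j=1}^{M_t}p_{tj}\,\mathfrak Q_t(x_{t-1},1,\xi_{tj},1)+q_t\sum_{j=1}^{M_t}p_{tj}\,\mathfrak Q_t(x_{t-1},1,\xi_{tj},0),$$ $$\mathfrak Q_t(x_{t-1},1,\xi_{tj},1)=\inf\{f_t(x_t,x_{t-1},\xi_{tj})+\mathcal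 Q_{t+1}(x_t,1): x_t\in X_t(x_{t-1},\xi_{tj})\},$$ $$\mathfrak Q_t(x_{t-1},1,\xi_{tj},0)=\inf\{f_t(x_t,x_{t-1},\xi_{tj}): x_t\in X_t(x_{t-1},\xi_{tj})\}.$$ **Algorithm SDDP-TSto** (run for iterations $k=1,2,\ldots$ without stopping). All quantities at iteration $k$ are computed from the samples of iterations $1,\ldots,k$. *Initialization.* For $t=2,\ldots,T_{\max}$, $\mathcal Q_t^0(\cdot,1)=\theta_t^0+\langle\beta_t^0,\cdot\rangle$ is a known affine function which is a lower bound for $\mathcal Q_t(\cdot,1)$. For all $k\ge 0$, $\mathcal Q_{T_{\max}+1}^k(\cdot,1)\equiv0$. *Forward pass of iteration $k$.* Generate a sample $((\tilde\xi_1^k,\tilde D_1^k),\ldots,(\tilde\xi_{T_{\max}}^k,\tilde D_{T_{\max}}^k))$ of $((\xi_1,D_1),\ldots,(\xi_{T_{\max}},D_{T_{\max}}))$ (with $\tilde\xi_1^k=\xi_1$, $\tilde D_1^k=1$), and set $x_0^k=x_0$. Successively for $t=1,2,\ldots$: - as long as $\tilde D_t^k=1$, $x_t^k$ is an optimal solution of $\inf\{f_t(x_t,x_{t-1}^k,\tilde\xi_t^k)+\mathcal Q_{t+1}^{k-1}(x_t,1): x_t\in X_t(x_{t-1}^k,\tilde\xi_t^k)\}$; - for the first $t$ with $\tilde D_t^k=0$, $x_t^k$ is an optimal solution of $\inf\{f_t(x_t,x_{t-1}^k,\tilde\xi_t^k): x_t\in X_t(x_{t-1}^k,\tilde\xi_t^k)\}$;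 - for the subsequent $t\le T_{\max}-1$, $x_t^k$ is any point of $X_t(x_{t-1}^k,\tilde\xi_t^k)$. *Backward pass of iteration $k$.* For $t=T_{\max}$ down to $t=2$: let $$\underline{\mathfrak Q}_t^k(x_{t-1},1,\xi_{tj},1)=\inf\{f_t(x_t,x_{t-1},\xi_{tj})+\mathcal Q_{t+1}^k(x_t,1): x_t\in X_t(x_{t-1},\xi_{tj})\}.$$ For each $j=1,\ldots,M_t$ compute a subgradient $\beta_{tj}^k$ of $\underline{\mathfrak Q}_t^k(\cdot,1,\xi_{tj},1)$ at $x_{t-1}^k$ and a subgradient $\gamma_{tj}^k$ of $\mathfrak Q_t(\cdot,1,\xi_{tj},0)$ at $x_{t-1}^k$. Set $$\theta_t^k=(1-q_t)\sum_{j=1}^{M_t}p_{tj}\big(\underline{\mathfrak Q}_t^k(x_{t-1}^k,1,\xi_{tj},1)-\langle\beta_{tj}^k,x_{t-1}^k\rangle\big)+q_t\sum_{j=1}^{M_t}p_{tj}\big(\mathfrak Q_t(x_{t-1}^k,1,\xi_{tj},0)-\langle\gamma_{tj}^k,x_{t-1}^k\rangle\big),$$ $$\beta_t^k=(1-q_t)\sum_{j=1}^{M_t}p_{tj}\beta_{tj}^k+q_t\sum_{j=1}^{M_t}p_{tj}\gamma_{tj}^k,$$ and $\mathcal Q_t^k(x_{t-1},1)=\max_{0\le j\le k}\ \theta_t^j+\langle\beta_t^j,x_{t-1}\rangle$. *Lower bound.* $\underline L_k=\inf\{f_1(x_1,x_0,\xi_1)+\mathcal Q_2^k(x_1,1):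 x_1\in X_1(x_0,\xi_1)\}$.
   Formalization: In the forward pass, x_t^k may depend only on the samples of earlier iterations and on stages 1,…,t of the sample of iteration k; if ties between optimal solutions could be broken by looking at later stages of the sample, (iii) would fail. *)

theory Defs
  imports "HOL-Probability.Probability"
begin

section \<open>Extended-real-valued functions\<close>

definition lsc_on :: "'a::topological_space set \<Rightarrow> ('a \<Rightarrow> ereal) \<Rightarrow> bool" where
  "lsc_on S h \<longleftrightarrow> (\<forall>z\<in>S. h z \<le> Liminf (at z within S) h)"

definition convex_lsc_finite_on :: "'a::real_normed_vector set \<Rightarrow> ('a \<Rightarrow> ereal) \<Rightarrow> bool" where
  "convex_lsc_finite_on S h \<longleftrightarrow>
     (\<forall>z\<in>S. \<bar>h z\<bar> \<noteq> \<infinity>) \<and> convex_on S (\<lambda>z. real_of_ereal (h z)) \<and> lsc_on S h"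

definition is_subgradient :: "('a::real_inner \<Rightarrow> ereal) \<Rightarrow> 'a \<Rightarrow> 'a \<Rightarrow> bool" where
  "is_subgradient h x v \<longleftrightarrow> \<bar>h x\<bar> \<noteq> \<infinity> \<and> (\<forall>y. h x + ereal (v \<bullet> (y - x)) \<le> h y)"

definition enlarge :: "real \<Rightarrow> 'a::real_normed_vector set \<Rightarrow> 'a set" where
  "enlarge e S = {x + d | x d. x \<in> S \<and> norm d \<le> e}"

text \<open>Positive part minus negative part; since \<open>\<infinity> - \<infinity> = \<infinity>\<close> in \<^typ>\<open>ereal\<close>, a policy whose
  expected cost is undefined counts as infinitely expensive.\<close>

definition ereal_expectation :: "'w measure \<Rightarrow> ('w \<Rightarrow> ereal) \<Rightarrow> ereal" where
  "ereal_expectation M h =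
     enn2ereal (\<integral>\<^sup>+\<omega>. e2ennreal (h \<omega>) \<partial>M) - enn2ereal (\<integral>\<^sup>+\<omega>. e2ennreal (- h \<omega>) \<partial>M)"

definition sigma_gen_by :: "'w measure \<Rightarrow> 'i set \<Rightarrow> ('i \<Rightarrow> 'w \<Rightarrow> 'b::topological_space) \<Rightarrow> 'w measure" where
  "sigma_gen_by M I Z = vimage_algebra (space M) (\<lambda>\<omega>. \<lambda>i\<in>I. Z i \<omega>) (\<Pi>\<^sub>M i\<in>I. borel)"

section \<open>The multistage stochastic program with a random number of stages\<close>

text \<open>\<open>noise_supp P t\<close> is the support \<open>{\<xi>\<^sub>t\<^sub>1, \<dots>, \<xi>\<^sub>t\<^sub>M}\<close> of the noise \<open>noise P t\<close>; realizations are
  indexed by themselves, so sums over \<open>j\<close> become sums over \<open>z \<in> noise_supp P t\<close>.  In \<open>cost P t x y z\<close> and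
  \<open>feas P t y z\<close>, \<open>x\<close> is the decision at stage \<open>t\<close>, \<open>y\<close> the one at stage \<open>t - 1\<close> and \<open>z\<close> the
  realization of the noise.\<close>

record ('w, 's, 'v) stoch_prog =
  PS :: "'w measure"
  Tmax :: nat
  n_stages :: "'w \<Rightarrow> nat"
  noise :: "nat \<Rightarrow> 'w \<Rightarrow> 's"
  noise_supp :: "nat \<Rightarrow> 's set"
  noise1 :: 's
  cost :: "nat \<Rightarrow> 'v \<Rightarrow> 'v \<Rightarrow> 's \<Rightarrow> ereal"
  feas :: "nat \<Rightarrow> 'v \<Rightarrow> 's \<Rightarrow> 'v set"
  x_init :: 'v

definition alive :: "('w, 's, 'v) stoch_prog \<Rightarrow> nat \<Rightarrow> 'w \<Rightarrow> real" where
  "alive P t \<omega> = (if t = 0 \<or> t < n_stages P \<omega> then 1 else 0)"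

definition noise_prob :: "('w, 's, 'v) stoch_prog \<Rightarrow> nat \<Rightarrow> 's \<Rightarrow> real" where
  "noise_prob P t z = \<P>(\<omega> in PS P. noise P t \<omega> = z)"

definition stop_prob :: "('w, 's, 'v) stoch_prog \<Rightarrow> nat \<Rightarrow> real" where
  "stop_prob P t = \<P>(\<omega> in PS P. alive P t \<omega> = 0 \<bar> alive P (t - 1) \<omega> = 1)"

text \<open>The Markov property of \<open>alive P\<close>, with absorbing state 0, is not listed below: it holds for every
  process of the form \<open>D\<^sub>t = 1\<^sub>T\<^sub>>\<^sub>t\<close>.\<close>

definition probabilistic_setting :: "('w, 's::euclidean_space, 'v) stoch_prog \<Rightarrow> bool" where
  "probabilistic_setting P \<longleftrightarrow>
     prob_space (PS P) \<and>
     2 \<le> Tmax P \<and>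
     n_stages P \<in> PS P \<rightarrow>\<^sub>M count_space UNIV \<and>
     (AE \<omega> in PS P. n_stages P \<omega> \<in> {2..Tmax P}) \<and>
     (\<forall>t\<in>{2..Tmax P}. \<P>(\<omega> in PS P. n_stages P \<omega> = t) > 0) \<and>
     (\<forall>t\<in>{1..Tmax P}. noise P t \<in> PS P \<rightarrow>\<^sub>M borel \<and> finite (noise_supp P t) \<and>
        (AE \<omega> in PS P. noise P t \<omega> \<in> noise_supp P t) \<and> (\<forall>z\<in>noise_supp P t. noise_prob P t z > 0)) \<and>
     noise_supp P 1 = {noise1 P} \<and>
     prob_space.indep_vars (PS P) (\<lambda>_. borel) (noise P) {2..Tmax P} \<and>
     prob_space.indep_set (PS P)
       (sets (sigma_gen_by (PS P) {1..Tmax P} (noise P))) (sets (sigma_gen_by (PS P) {1..Tmax P} (alive P)))"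

definition filtr :: "('w, 's::euclidean_space, 'v) stoch_prog \<Rightarrow> nat \<Rightarrow> 'w measure" where
  "filtr P t = sigma_gen_by (PS P) {1..t} (\<lambda>j \<omega>. (noise P j \<omega>, alive P j \<omega>))"

definition policies :: "('w, 's::euclidean_space, 'v::euclidean_space) stoch_prog \<Rightarrow> (nat \<Rightarrow> 'w \<Rightarrow> 'v) set" where
  "policies P = {x. (\<forall>\<omega>. x 0 \<omega> = x_init P) \<and>
     (\<forall>t\<in>{1..Tmax P}. x t \<in> filtr P t \<rightarrow>\<^sub>M borel \<and>
        (AE \<omega> in PS P. x t \<omega> \<in> feas P t (x (t - 1) \<omega>) (noise P t \<omega>)))}"

definition optimal_value :: "('w, 's::euclidean_space, 'v::euclidean_space) stoch_prog \<Rightarrow> ereal" where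
  "optimal_value P = (INF x\<in>policies P. ereal_expectation (PS P)
     (\<lambda>\<omega>. \<Sum>t=1..Tmax P. ereal (alive P (t - 1) \<omega>) * cost P t (x t \<omega>) (x (t - 1) \<omega>) (noise P t \<omega>)))"

section \<open>Assumptions on the stage problems\<close>

text \<open>The number of constraint rows is the same at all stages; zero rows can be added to the systems
  of the stages that have fewer constraints.\<close>

definition linear_problems ::
  "('w, 's, real^'n) stoch_prog \<Rightarrow> (nat \<Rightarrow> 's \<Rightarrow> real^'n^'m) \<Rightarrow> (nat \<Rightarrow> 's \<Rightarrow> real^'n^'m) \<Rightarrow>
   (nat \<Rightarrow> 's \<Rightarrow> real^'m) \<Rightarrow> (nat \<Rightarrow> 's \<Rightarrow> real^'n) \<Rightarrow> bool" where
  "linear_problems P A B b c \<longleftrightarrow>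
     (\<forall>t\<in>{1..Tmax P}. \<forall>z\<in>noise_supp P t. \<forall>y.
        (\<forall>x. cost P t x y z = ereal (c t z \<bullet> x)) \<and>
        feas P t y z = {x. A t z *v x + B t z *v y = b t z \<and> (\<forall>i. 0 \<le> x $ i)}) \<and>
     feas P 1 (x_init P) (noise1 P) \<noteq> {} \<and> bounded (feas P 1 (x_init P) (noise1 P)) \<and>
     (\<forall>t\<in>{2..Tmax P}. \<forall>z x.
        (\<forall>\<tau>\<in>{2..t}. z \<tau> \<in> noise_supp P \<tau>) \<and>
        x 1 \<in> feas P 1 (x_init P) (noise1 P) \<and>
        (\<forall>\<tau>\<in>{2..t - 1}. x \<tau> \<in> feas P \<tau> (x (\<tau> - 1)) (z \<tau>)) \<longrightarrow>
        feas P t (x (t - 1)) (z t) \<noteq> {} \<and> bounded (feas P t (x (t - 1)) (z t)))"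

text \<open>\<open>g t i x y z\<close> is the \<open>i\<close>-th component of \<open>g\<^sub>t(x, y, z)\<close>; the components are numbered
  \<open>1, \<dots>, m\<close>.\<close>

definition nonlinear_problems ::
  "('w, 's, real^'n) stoch_prog \<Rightarrow> (nat \<Rightarrow> (real^'n) set) \<Rightarrow> nat \<Rightarrow>
   (nat \<Rightarrow> nat \<Rightarrow> real^'n \<Rightarrow> real^'n \<Rightarrow> 's \<Rightarrow> ereal) \<Rightarrow>
   (nat \<Rightarrow> 's \<Rightarrow> real^'n^'m) \<Rightarrow> (nat \<Rightarrow> 's \<Rightarrow> real^'n^'m) \<Rightarrow> (nat \<Rightarrow> 's \<Rightarrow> real^'m) \<Rightarrow> bool" where
  "nonlinear_problems P \<X> m g A B b \<longleftrightarrow>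
     (\<forall>t\<in>{1..Tmax P}. \<forall>z\<in>noise_supp P t. \<forall>y. feas P t y z =
        {x. x \<in> \<X> t \<and> (\<forall>i\<in>{1..m}. g t i x y z \<le> 0) \<and> A t z *v x + B t z *v y = b t z}) \<and>
     \<X> 0 = {x_init P} \<and>
     (\<forall>t\<in>{1..Tmax P}. \<exists>\<epsilon>>0.
        (\<X> t \<noteq> {} \<and> convex (\<X> t) \<and> compact (\<X> t)) \<and>
        (\<forall>z\<in>noise_supp P t. convex_lsc_finite_on (\<X> t \<times> enlarge \<epsilon> (\<X> (t - 1))) (\<lambda>(x, y). cost P t x y z)) \<and>
        (\<forall>z\<in>noise_supp P t. \<forall>i\<in>{1..m}.
           convex_lsc_finite_on (\<X> t \<times> enlarge \<epsilon> (\<X> (t - 1))) (\<lambda>(x, y). g t i x y z)) \<and>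
        (\<forall>z\<in>noise_supp P t. \<forall>y\<in>enlarge \<epsilon> (\<X> (t - 1)). feas P t y z \<noteq> {}) \<and>
        (2 \<le> t \<longrightarrow> (\<forall>z\<in>noise_supp P t. \<exists>x y.
           (x, y) \<in> (rel_interior (\<X> t) \<times> \<X> (t - 1))
                    \<inter> rel_interior {(x, y). \<forall>i\<in>{1..m}. g t i x y z \<le> 0} \<and>
           x \<in> feas P t y z)))"

section \<open>Cost-to-go functions\<close>

text \<open>With \<open>V = \<Q>\<^sub>t\<^sub>+\<^sub>1(\<cdot>, 1)\<close> this is \<open>\<QQ>\<^sub>t(y, 1, z, 1)\<close>; with \<open>V = 0\<close> it is \<open>\<QQ>\<^sub>t(y, 1, z, 0)\<close>.\<close>

definition stage_value ::
  "('w, 's, 'v) stoch_prog \<Rightarrow> nat \<Rightarrow> ('v \<Rightarrow> ereal) \<Rightarrow> 'v \<Rightarrow> 's \<Rightarrow> ereal" where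
  "stage_value P t V y z = (INF x\<in>feas P t y z. cost P t x y z + V x)"

text \<open>\<open>cost_to_go P t\<close> is \<open>\<Q>\<^sub>t(\<cdot>, 1)\<close>.\<close>

function cost_to_go :: "('w, 's, 'v) stoch_prog \<Rightarrow> nat \<Rightarrow> 'v \<Rightarrow> ereal" where
  "cost_to_go P t =
     (if Tmax P < t then (\<lambda>y. 0)
      else (\<lambda>y.
        ereal (1 - stop_prob P t) * (\<Sum>z\<in>noise_supp P t. ereal (noise_prob P t z) * stage_value P t (cost_to_go P (t + 1)) y z)
        + ereal (stop_prob P t) * (\<Sum>z\<in>noise_supp P t. ereal (noise_prob P t z) * stage_value P t (\<lambda>_. 0) y z)))"
  by pat_completeness auto
termination
  by (relation "Wellfounded.measure (\<lambda>(P, t). Suc (Tmax P) - t)") auto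

declare cost_to_go.simps [simp del]

section \<open>The algorithm SDDP-TSto\<close>

text \<open>\<open>approx P \<theta> \<beta> k t\<close> is \<open>\<Q>\<^sub>t\<^sup>k(\<cdot>, 1)\<close>, where \<open>\<theta> k t\<close> and \<open>\<beta> k t\<close> are the intercept and the slope
  of the cut added for stage \<open>t\<close> at iteration \<open>k\<close>.\<close>

definition approx ::
  "('w, 's, 'v::real_inner) stoch_prog \<Rightarrow> (nat \<Rightarrow> nat \<Rightarrow> real) \<Rightarrow> (nat \<Rightarrow> nat \<Rightarrow> 'v) \<Rightarrow>
   nat \<Rightarrow> nat \<Rightarrow> 'v \<Rightarrow> real" where
  "approx P \<theta> \<beta> k t x = (if Tmax P < t then 0 else MAX j\<in>{0..k}. \<theta> j t + \<beta> j t \<bullet> x)"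

definition lower_bound ::
  "('w, 's, 'v::real_inner) stoch_prog \<Rightarrow> (nat \<Rightarrow> nat \<Rightarrow> real) \<Rightarrow> (nat \<Rightarrow> nat \<Rightarrow> 'v) \<Rightarrow> nat \<Rightarrow> ereal" where
  "lower_bound P \<theta> \<beta> k =
     (INF x\<in>feas P 1 (x_init P) (noise1 P). cost P 1 x (x_init P) (noise1 P) + ereal (approx P \<theta> \<beta> k 2 x))"

text \<open>One trajectory of the algorithm: \<open>s k t\<close> and \<open>d k t\<close> are the sampled values of \<open>\<xi>\<^sub>t\<close> and \<open>D\<^sub>t\<close>
  at iteration \<open>k\<close>.  No condition is put on the last decision \<open>x k (Tmax P)\<close> if the sampled process
  stops before \<open>Tmax P\<close>, since the algorithm does not compute it.\<close>

definition forward_pass ::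
  "('w, 's, 'v::real_inner) stoch_prog \<Rightarrow> (nat \<Rightarrow> nat \<Rightarrow> 's) \<Rightarrow> (nat \<Rightarrow> nat \<Rightarrow> real) \<Rightarrow>
   (nat \<Rightarrow> nat \<Rightarrow> real) \<Rightarrow> (nat \<Rightarrow> nat \<Rightarrow> 'v) \<Rightarrow> (nat \<Rightarrow> nat \<Rightarrow> 'v) \<Rightarrow> nat \<Rightarrow> bool" where
  "forward_pass P s d \<theta> \<beta> x k \<longleftrightarrow>
     x k 0 = x_init P \<and>
     (\<forall>t\<in>{1..Tmax P}.
        ((\<forall>\<tau>\<in>{1..t}. d k \<tau> = 1) \<longrightarrow>
           is_arg_min (\<lambda>u. cost P t u (x k (t - 1)) (s k t) + ereal (approx P \<theta> \<beta> (k - 1) (t + 1) u))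
             (\<lambda>u. u \<in> feas P t (x k (t - 1)) (s k t)) (x k t)) \<and>
        ((\<forall>\<tau>\<in>{1..<t}. d k \<tau> = 1) \<and> d k t = 0 \<longrightarrow>
           is_arg_min (\<lambda>u. cost P t u (x k (t - 1)) (s k t))
             (\<lambda>u. u \<in> feas P t (x k (t - 1)) (s k t)) (x k t)) \<and>
        ((\<exists>\<tau>\<in>{1..<t}. d k \<tau> = 0) \<and> t \<le> Tmax P - 1 \<longrightarrow>
           x k t \<in> feas P t (x k (t - 1)) (s k t)))"

definition backward_pass ::
  "('w, 's, 'v::real_inner) stoch_prog \<Rightarrow> (nat \<Rightarrow> nat \<Rightarrow> real) \<Rightarrow> (nat \<Rightarrow> nat \<Rightarrow> 'v) \<Rightarrow>
   (nat \<Rightarrow> nat \<Rightarrow> 's \<Rightarrow> 'v) \<Rightarrow> (nat \<Rightarrow> nat \<Rightarrow> 's \<Rightarrow> 'v) \<Rightarrow> (nat \<Rightarrow> nat \<Rightarrow> 'v) \<Rightarrow> nat \<Rightarrow> bool" where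
  "backward_pass P \<theta> \<beta> \<beta>' \<gamma>' x k \<longleftrightarrow>
     (\<forall>t\<in>{2..Tmax P}. let y = x k (t - 1);
                          V1 = stage_value P t (\<lambda>u. ereal (approx P \<theta> \<beta> k (t + 1) u));
                          V0 = stage_value P t (\<lambda>_. 0) in
        (\<forall>z\<in>noise_supp P t. is_subgradient (\<lambda>v. V1 v z) y (\<beta>' k t z) \<and>
                    is_subgradient (\<lambda>v. V0 v z) y (\<gamma>' k t z)) \<and>
        \<theta> k t = (1 - stop_prob P t) * (\<Sum>z\<in>noise_supp P t. noise_prob P t z * (real_of_ereal (V1 y z) - \<beta>' k t z \<bullet> y))
               + stop_prob P t * (\<Sum>z\<in>noise_supp P t. noise_prob P t z * (real_of_ereal (V0 y z) - \<gamma>' k t z \<bullet> y)) \<and>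
        \<beta> k t = (1 - stop_prob P t) *\<^sub>R (\<Sum>z\<in>noise_supp P t. noise_prob P t z *\<^sub>R \<beta>' k t z)
               + stop_prob P t *\<^sub>R (\<Sum>z\<in>noise_supp P t. noise_prob P t z *\<^sub>R \<gamma>' k t z))"

definition sddp_tsto_run ::
  "('w, 's, 'v::real_inner) stoch_prog \<Rightarrow> (nat \<Rightarrow> real) \<Rightarrow> (nat \<Rightarrow> 'v) \<Rightarrow>
   (nat \<Rightarrow> nat \<Rightarrow> 's) \<Rightarrow> (nat \<Rightarrow> nat \<Rightarrow> real) \<Rightarrow> (nat \<Rightarrow> nat \<Rightarrow> real) \<Rightarrow> (nat \<Rightarrow> nat \<Rightarrow> 'v) \<Rightarrow>
   (nat \<Rightarrow> nat \<Rightarrow> 's \<Rightarrow> 'v) \<Rightarrow> (nat \<Rightarrow> nat \<Rightarrow> 's \<Rightarrow> 'v) \<Rightarrow> (nat \<Rightarrow> nat \<Rightarrow> 'v) \<Rightarrow> bool" where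
  "sddp_tsto_run P \<theta>0 \<beta>0 s d \<theta> \<beta> \<beta>' \<gamma>' x \<longleftrightarrow>
     (\<forall>t\<in>{2..Tmax P}. \<theta> 0 t = \<theta>0 t \<and> \<beta> 0 t = \<beta>0 t) \<and>
     (\<forall>k\<ge>1. forward_pass P s d \<theta> \<beta> x k \<and> backward_pass P \<theta> \<beta> \<beta>' \<gamma>' x k)"

definition independent_samples ::
  "('w, 's::euclidean_space, 'v) stoch_prog \<Rightarrow> 'a measure \<Rightarrow> (nat \<Rightarrow> nat \<Rightarrow> 'a \<Rightarrow> 's) \<Rightarrow>
   (nat \<Rightarrow> nat \<Rightarrow> 'a \<Rightarrow> real) \<Rightarrow> bool" where
  "independent_samples P N s d \<longleftrightarrow>
     (let E = (\<Pi>\<^sub>M t\<in>{1..Tmax P}. borel) :: (nat \<Rightarrow> 's \<times> real) measure;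
          sample = (\<lambda>k \<omega>. \<lambda>t\<in>{1..Tmax P}. (s k t \<omega>, d k t \<omega>)) in
      prob_space N \<and>
      prob_space.indep_vars N (\<lambda>_. E) sample {1..} \<and>
      (\<forall>k\<ge>1. distr N E (sample k) = distr (PS P) E (\<lambda>\<omega>. \<lambda>t\<in>{1..Tmax P}. (noise P t \<omega>, alive P t \<omega>))))"

text \<open>The quantities of iteration \<open>k\<close> are computed from the samples of iterations \<open>1, \<dots>, k\<close>.  As the
  forward pass computes the decisions successively, the choice of \<open>x k t\<close> among the admissible points
  may not look ahead at the sample of iteration \<open>k\<close> beyond stage \<open>t\<close>.  (With look-ahead among several
  optimal solutions, parts of the scenario tree could be missed forever.)\<close>

definition nonanticipative ::
  "('w, 's::euclidean_space, 'v::euclidean_space) stoch_prog \<Rightarrow> 'a measure \<Rightarrow>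
   (nat \<Rightarrow> nat \<Rightarrow> 'a \<Rightarrow> 's) \<Rightarrow> (nat \<Rightarrow> nat \<Rightarrow> 'a \<Rightarrow> real) \<Rightarrow>
   (nat \<Rightarrow> nat \<Rightarrow> 's \<Rightarrow> 'a \<Rightarrow> 'v) \<Rightarrow> (nat \<Rightarrow> nat \<Rightarrow> 's \<Rightarrow> 'a \<Rightarrow> 'v) \<Rightarrow> (nat \<Rightarrow> nat \<Rightarrow> 'a \<Rightarrow> 'v) \<Rightarrow> bool" where
  "nonanticipative P N s d \<beta>' \<gamma>' x \<longleftrightarrow>
     (let hist = (\<lambda>I. sigma_gen_by N I (\<lambda>(i, j) \<omega>. (s i j \<omega>, d i j \<omega>))) in
      (\<forall>k\<ge>1. \<forall>t\<in>{1..Tmax P}.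
         x k t \<in> hist ({1..k - 1} \<times> {1..Tmax P} \<union> {k} \<times> {1..t}) \<rightarrow>\<^sub>M borel) \<and>
      (\<forall>k\<ge>1. \<forall>t\<in>{2..Tmax P}. \<forall>z\<in>noise_supp P t.
         \<beta>' k t z \<in> hist ({1..k} \<times> {1..Tmax P}) \<rightarrow>\<^sub>M borel \<and>
         \<gamma>' k t z \<in> hist ({1..k} \<times> {1..Tmax P}) \<rightarrow>\<^sub>M borel))"

end

theory Submission
  imports Defs
begin

text \<open>Since the noises and the number of stages take finitely many values, a policy is a finite family of
  decisions indexed by the nodes of a scenario tree, and telescoping the dynamic programming equations along
  the tree identifies the optimal value with \<open>inf f\<^sub>1 + \<Q>\<^sub>2\<close>. A backward induction over the stages shows that
  all cuts are valid.

  For the convergence, one shows backwards in \<open>t\<close> that at each node \<open>w\<close> the gap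
  \<open>\<Q>\<^sub>t - \<Q>\<^sub>t\<^sup>k\<^sup>-\<^sup>1\<close> at the trial point tends to 0 along the iterations that visit \<open>w\<close> before the process stops.
  The subgradients need not be bounded for linear problems, so equi-Lipschitz continuity is not available.
  Instead, let the trial points converge to \<open>l\<close> along a subsequence; the segment from \<open>l\<close> through a nearby trial
  point can be prolonged by a fixed length within a set where \<open>\<Q>\<^sub>t\<close> is bounded above (a polytope of reachable
  points, or a neighbourhood of the compact set \<open>\<X>\<^sub>t\<^sub>-\<^sub>1\<close>), so a cut, being a lower bound there, cannot drop by much
  between that trial point and \<open>l\<close>. Hence the values of the old cuts at \<open>l\<close>, and so at the later trial points,
  come close to the limit of \<open>\<Q>\<^sub>t\<close> at the trial points.

  The cuts are tight in the limit if the approximate stage values are accurate for every realization of the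
  next noise, whereas the induction hypothesis only covers the sampled one. Whether an inaccuracy occurs at a
  node depends on the past samples alone; if it occurred infinitely often, then almost surely infinitely
  often together with the offending realization being sampled, contradicting the induction hypothesis.\<close>

section \<open>Scenario tree and law of the data\<close>

text \<open>The two classes of problems are treated together: the locale
  \<open>stage_structure\<close> isolates what the argument uses of a feasible set, and everything
  up to \<open>convergence\<close> takes place there.

  One obstacle is measurability. The cuts \<open>\<theta>\<close>, \<open>\<beta>\<close> come
  without any, events such as "the iteration lags at this node" are not visibly measurable, and
  near-optimal decisions are arbitrary choices. Finiteness resolves this: almost surely a sample
  takes values in a finite set, so every set of sample histories is measurable, and measurability
  with respect to a generated sigma-algebra is used through constancy on the fibres of the
  generators. The analysis of a trajectory is then deterministic, and probability is left with a
  single task, a conditional form of the second Borel-Cantelli lemma.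

  The other obstacle is infinite values. Off the decision sets a cost-to-go function may be
  infinite, so the cuts are shown valid in \<open>ereal\<close> at every point, while real
  arithmetic is confined to sets where finiteness has been proved.\<close>

primrec trail :: "(nat \<Rightarrow> 's) \<Rightarrow> nat \<Rightarrow> 's list" where
  "trail f 0 = []"
| "trail f (Suc t) = f (Suc t) # trail f t"

text \<open>A node of stage \<open>t\<close> is the list of the realizations of stages \<open>t, \<dots>, 1\<close>, the latest one first.\<close>

primrec nodes :: "(nat \<Rightarrow> 's set) \<Rightarrow> nat \<Rightarrow> 's list set" where
  "nodes S 0 = {[]}"
| "nodes S (Suc t) = (\<lambda>(z, w). z # w) ` (S (Suc t) \<times> nodes S t)"

primrec node_prob :: "(nat \<Rightarrow> 's \<Rightarrow> real) \<Rightarrow> 's list \<Rightarrow> real" where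
  "node_prob p [] = 1"
| "node_prob p (z # w) = p (Suc (length w)) z * node_prob p w"

lemma length_trail [simp]: "length (trail f t) = t"
  by (induction t) auto

lemma trail_eq_iff: "trail f t = trail g t \<longleftrightarrow> (\<forall>j\<in>{1..t}. f j = g j)"
  by (induction t) (auto simp: atLeastAtMostSuc_conv)

lemma trail_in_nodes: "(\<And>j. j \<in> {1..t} \<Longrightarrow> f j \<in> S j) \<Longrightarrow> trail f t \<in> nodes S t"
  by (induction t) auto

lemma nodes_length: "w \<in> nodes S t \<Longrightarrow> length w = t"
  by (induction t arbitrary: w) auto

lemma nodes_obtain_trail:
  assumes "w \<in> nodes S t"
  obtains a where "w = trail a t" "\<And>j. j \<in> {1..t} \<Longrightarrow> a j \<in> S j"
  using assms
proof (induction t arbitrary: w thesis)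
  case 0
  then show ?case by simp
next
  case (Suc t)
  from Suc.prems(2) obtain z v where w: "w = z # v" "z \<in> S (Suc t)" "v \<in> nodes S t" by auto
  from Suc.IH[OF _ w(3)] obtain a where a: "v = trail a t" "\<And>j. j \<in> {1..t} \<Longrightarrow> a j \<in> S j"
    by blast
  define a' where "a' = a(Suc t := z)"
  have "trail a' t = trail a t"
    by (subst trail_eq_iff) (auto simp: a'_def)
  then have "w = trail a' (Suc t)" by (simp add: w a a'_def)
  moreover have "\<And>j. j \<in> {1..Suc t} \<Longrightarrow> a' j \<in> S j"
    using a(2) w(2) by (auto simp: a'_def le_Suc_eq)
  ultimately show ?case using Suc.prems(1) by blast
qed

lemma finite_nodes: "(\<And>j. j \<in> {1..t} \<Longrightarrow> finite (S j)) \<Longrightarrow> finite (nodes S t)"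
  by (induction t) auto

lemma sum_nodes_Suc:
  assumes "\<And>j. j \<in> {1..Suc t} \<Longrightarrow> finite (S j)"
  shows "(\<Sum>w\<in>nodes S (Suc t). h w) = (\<Sum>w\<in>nodes S t. \<Sum>z\<in>S (Suc t). h (z # w))"
proof -
  have inj: "inj_on (\<lambda>(z, w). z # w) (S (Suc t) \<times> nodes S t)"
    by (auto simp: inj_on_def)
  have "(\<Sum>w\<in>nodes S (Suc t). h w) = (\<Sum>(z, w)\<in>S (Suc t) \<times> nodes S t. h (z # w))"
    unfolding nodes.simps by (subst sum.reindex[OF inj]) (simp add: case_prod_unfold)
  also have "\<dots> = (\<Sum>z\<in>S (Suc t). \<Sum>w\<in>nodes S t. h (z # w))"
    by (simp add: sum.cartesian_product)
  finally show ?thesis by (simp add: sum.swap[of _ "S (Suc t)"])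
qed

lemma node_prob_trail: "node_prob p (trail a t) = (\<Prod>j\<in>{1..t}. p j (a j))"
  by (induction t) (auto simp: atLeastAtMostSuc_conv mult.commute)

section \<open>Law of the nodes and of the number of stages\<close>

locale random_horizon =
  fixes P :: "('w, 's::euclidean_space, 'v::euclidean_space) stoch_prog"
  assumes setting: "probabilistic_setting P"
begin

abbreviation "S \<equiv> noise_supp P"
abbreviation "\<mu> \<equiv> node_prob (noise_prob P)"
abbreviation "q \<equiv> stop_prob P"

text \<open>Survival function of the number of stages. Together with \<open>\<tau>\<close> it
  replaces the conditional probabilities \<open>q\<close> by absolute ones, the form in which the
  dynamic programming equations telescope.\<close>

definition \<rho> :: "nat \<Rightarrow> real" where
  "\<rho> t = \<P>(\<omega> in PS P. t < n_stages P \<omega>)"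

definition \<tau> :: "nat \<Rightarrow> real" where
  "\<tau> t = \<P>(\<omega> in PS P. n_stages P \<omega> = t)"

lemma prob_space_P: "prob_space (PS P)"
  using setting by (simp add: probabilistic_setting_def)

sublocale prob_space "PS P"
  by (rule prob_space_P)

lemma Tmax_ge2: "2 \<le> Tmax P"
  using setting by (simp add: probabilistic_setting_def)

lemma n_stages_measurable [measurable]: "n_stages P \<in> PS P \<rightarrow>\<^sub>M count_space UNIV"
  using setting by (simp add: probabilistic_setting_def)

lemma n_stages_AE: "AE \<omega> in PS P. 2 \<le> n_stages P \<omega> \<and> n_stages P \<omega> \<le> Tmax P"
  using setting by (simp add: probabilistic_setting_def)

lemma \<tau>_pos: "t \<in> {2..Tmax P} \<Longrightarrow> 0 < \<tau> t"
  using setting by (simp add: probabilistic_setting_def \<tau>_def)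

lemma noise_measurable [measurable]: "t \<in> {1..Tmax P} \<Longrightarrow> noise P t \<in> borel_measurable (PS P)"
  using setting by (simp add: probabilistic_setting_def)

lemma finite_S: "t \<in> {1..Tmax P} \<Longrightarrow> finite (S t)"
  using setting by (simp add: probabilistic_setting_def)

lemma noise_AE: "AE \<omega> in PS P. \<forall>t\<in>{1..Tmax P}. noise P t \<omega> \<in> S t"
  using setting by (subst AE_finite_all) (auto simp: probabilistic_setting_def)

lemma noise_prob_pos: "t \<in> {1..Tmax P} \<Longrightarrow> z \<in> S t \<Longrightarrow> 0 < noise_prob P t z"
  using setting by (simp add: probabilistic_setting_def)

lemma noise_prob_nonneg: "0 \<le> noise_prob P t z"
  by (simp add: noise_prob_def)

lemma S_1: "S 1 = {noise1 P}"
  using setting by (simp add: probabilistic_setting_def)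

lemma noise_indep: "indep_vars (\<lambda>_. borel) (noise P) {2..Tmax P}"
  using setting by (simp add: probabilistic_setting_def)

lemma noise_alive_indep:
  "indep_set (sets (sigma_gen_by (PS P) {1..Tmax P} (noise P))) (sets (sigma_gen_by (PS P) {1..Tmax P} (alive P)))"
  using setting by (simp add: probabilistic_setting_def)

lemma finite_nodes_S: "t \<le> Tmax P \<Longrightarrow> finite (nodes S t)"
  by (rule finite_nodes) (auto intro: finite_S)

lemma node_prob_pos: "t \<le> Tmax P \<Longrightarrow> w \<in> nodes S t \<Longrightarrow> 0 < \<mu> w"
  by (induction t arbitrary: w) (auto simp: nodes_length intro!: mult_pos_pos noise_prob_pos)

lemma sum_noise_prob: 
  assumes t: "t \<in> {1..Tmax P}"
  shows "(\<Sum>z\<in>S t. noise_prob P t z) = 1"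
proof -
  note [measurable] = noise_measurable[OF t]
  have "(\<Sum>z\<in>S t. noise_prob P t z) = prob (\<Union>z\<in>S t. {\<omega>\<in>space (PS P). noise P t \<omega> = z})"
    unfolding noise_prob_def
    by (rule finite_measure_finite_Union[symmetric]) (use finite_S[OF t] in \<open>auto simp: disjoint_family_on_def\<close>)
  also have "\<dots> = 1"
    by (rule prob_eq_1[THEN iffD2]) (use finite_S[OF t] noise_AE t in \<open>auto elim!: AE_mp\<close>)
  finally show ?thesis .
qed

lemma noise_prob_1: "noise_prob P 1 (noise1 P) = 1"
  using sum_noise_prob[of 1] Tmax_ge2 S_1 by simp

lemma noise_1_AE: "AE \<omega> in PS P. noise P 1 \<omega> = noise1 P"
  using noise_AE by eventually_elim (use S_1 Tmax_ge2 in auto)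

lemma prob_trail:
  assumes t: "t \<le> Tmax P" and w: "w \<in> nodes S t"
  shows "\<P>(\<omega> in PS P. trail (\<lambda>j. noise P j \<omega>) t = w) = \<mu> w"
proof -
  obtain a where a: "w = trail a t" "\<And>j. j \<in> {1..t} \<Longrightarrow> a j \<in> S j"
    using w by (rule nodes_obtain_trail) blast
  have m: "j \<in> {1..t} \<Longrightarrow> noise P j \<in> borel_measurable (PS P)" for j
    using t by (intro noise_measurable) auto
  have sets: "j \<in> {1..t} \<Longrightarrow> {\<omega>\<in>space (PS P). noise P j \<omega> = a j} \<in> events" for j
    using m[of j] by measurable
  have ev: "{\<omega>\<in>space (PS P). \<forall>j\<in>J. noise P j \<omega> = a j} \<in> events" if "J \<subseteq> {1..t}" for J
    using sets that finite_subset[OF that] by (intro sets.sets_Collect_finite_All) auto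
  show ?thesis
  proof (cases "t = 0")
    case True
    then show ?thesis using a by (simp add: prob_space)
  next
    case False
    have "\<P>(\<omega> in PS P. trail (\<lambda>j. noise P j \<omega>) t = w) = \<P>(\<omega> in PS P. \<forall>j\<in>{1..t}. noise P j \<omega> = a j)"
      by (simp add: a(1) trail_eq_iff)
    \<comment> \<open>Independence of the noises is given from stage 2 on; the first noise is almost
      surely constant and is split off here.\<close>
    also have "\<dots> = \<P>(\<omega> in PS P. \<forall>j\<in>{2..t}. noise P j \<omega> = a j)"
    proof (rule finite_measure_eq_AE)
      have a1: "a 1 = noise1 P" using a(2)[of 1] False S_1 by auto
      show "AE x in PS P. (x \<in> {\<omega> \<in> space (PS P). \<forall>j\<in>{1..t}. noise P j \<omega> = a j}) =
              (x \<in> {\<omega> \<in> space (PS P). \<forall>j\<in>{2..t}. noise P j \<omega> = a j})"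
        using noise_1_AE
      proof eventually_elim
        case (elim x)
        have "{1..t} = insert 1 {2..t}" using False by auto
        then show ?case using elim a1 by simp
      qed
    qed (auto intro!: ev)
    also have "\<dots> = (\<Prod>j\<in>{2..t}. noise_prob P j (a j))"
    proof (cases "2 \<le> t")
      case True
      have "prob (\<Inter>j\<in>{2..t}. noise P j -` {a j} \<inter> space (PS P)) = (\<Prod>j\<in>{2..t}. prob (noise P j -` {a j} \<inter> space (PS P)))"
        by (rule indep_varsD[OF noise_indep]) (use t True in auto)
      also have "(\<Inter>j\<in>{2..t}. noise P j -` {a j} \<inter> space (PS P)) = {\<omega>\<in>space (PS P). \<forall>j\<in>{2..t}. noise P j \<omega> = a j}"
        using True by auto
      finally show ?thesis
        by (simp add: noise_prob_def vimage_def Int_def conj_commute)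
    qed (use False in \<open>auto simp: prob_space\<close>)
    also have "\<dots> = (\<Prod>j\<in>{1..t}. noise_prob P j (a j))"
    proof -
      have "{1..t} = insert 1 {2..t}" using False by auto
      moreover have "a 1 = noise1 P" using a(2)[of 1] False S_1 by auto
      ultimately show ?thesis using noise_prob_1 by simp
    qed
    finally show ?thesis by (simp add: a(1) node_prob_trail)
  qed
qed

lemma \<rho>_1: "\<rho> 1 = 1"
  unfolding \<rho>_def
  by (subst prob_eq_1) (use n_stages_AE in \<open>auto elim!: AE_mp\<close>)

lemma \<rho>_Tmax: "\<rho> (Tmax P) = 0"
  unfolding \<rho>_def
  by (subst prob_eq_0) (use n_stages_AE in \<open>auto elim!: AE_mp\<close>)

lemma \<tau>_1: "\<tau> 1 = 0"
  unfolding \<tau>_def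
  by (subst prob_eq_0) (use n_stages_AE in \<open>auto elim!: AE_mp\<close>)

lemma \<rho>_split: "\<rho> t = \<tau> (Suc t) + \<rho> (Suc t)"
proof -
  have "\<rho> t = prob ({\<omega> \<in> space (PS P). n_stages P \<omega> = Suc t} \<union> {\<omega> \<in> space (PS P). Suc t < n_stages P \<omega>})"
    unfolding \<rho>_def by (rule arg_cong[where f = prob]) auto
  also have "\<dots> = \<tau> (Suc t) + \<rho> (Suc t)"
    unfolding \<rho>_def \<tau>_def by (rule finite_measure_Union) auto
  finally show ?thesis .
qed

lemma \<rho>_nonneg: "0 \<le> \<rho> t" and \<tau>_nonneg: "0 \<le> \<tau> t"
  by (simp_all add: \<rho>_def \<tau>_def)

lemma \<rho>_pos:
  assumes "t < Tmax P"
  shows "0 < \<rho> t"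
proof -
  have "0 < \<tau> (Tmax P)" using Tmax_ge2 by (intro \<tau>_pos) auto
  also have "\<dots> \<le> \<rho> t"
    unfolding \<rho>_def \<tau>_def by (rule finite_measure_mono) (use assms in auto)
  finally show ?thesis .
qed

lemma stop_prob_eq:
  assumes "t \<in> {2..Tmax P}"
  shows "q t = \<tau> t / \<rho> (t - 1)"
proof -
  have "\<P>(\<omega> in PS P. alive P t \<omega> = 0 \<and> alive P (t - 1) \<omega> = 1) = \<tau> t"
    unfolding \<tau>_def by (rule arg_cong[where f = prob]) (use assms in \<open>auto simp: alive_def\<close>)
  moreover have "\<P>(\<omega> in PS P. alive P (t - 1) \<omega> = 1) = \<rho> (t - 1)"
    unfolding \<rho>_def by (rule arg_cong[where f = prob]) (use assms in \<open>auto simp: alive_def\<close>)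
  ultimately show ?thesis by (simp add: stop_prob_def cond_prob_def)
qed

text \<open>Full support of the number of stages makes \<open>\<rho> (t - 1)\<close> and
  \<open>\<tau> t\<close> positive. The strict bound before the last stage serves in
  \<open>V_finite\<close>, where both weights \<open>q\<close> and \<open>1 - q\<close> must be
  positive.\<close>

lemma stop_prob:
  assumes "t \<in> {2..Tmax P}"
  shows "\<rho> (t - 1) * q t = \<tau> t" "\<rho> (t - 1) * (1 - q t) = \<rho> t" "0 < q t" "q t \<le> 1"
    "t < Tmax P \<Longrightarrow> q t < 1"
proof -
  have pos: "0 < \<rho> (t - 1)" using assms by (intro \<rho>_pos) auto
  have split: "\<rho> (t - 1) = \<tau> t + \<rho> t" using \<rho>_split[of "t - 1"] assms by (simp del: One_nat_def)
  show "\<rho> (t - 1) * q t = \<tau> t" "\<rho> (t - 1) * (1 - q t) = \<rho> t"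
    using pos split by (simp_all add: stop_prob_eq[OF assms] field_simps)
  show "0 < q t" "q t \<le> 1" "t < Tmax P \<Longrightarrow> q t < 1"
    using pos split \<tau>_pos[OF assms] \<rho>_nonneg[of t] \<rho>_pos[of t]
    by (simp_all add: stop_prob_eq[OF assms] field_simps)
qed

lemma stop_prob_Tmax: "q (Tmax P) = 1"
  using stop_prob(2)[of "Tmax P"] \<rho>_pos[of "Tmax P - 1"] Tmax_ge2 \<rho>_Tmax by auto

text \<open>Noises and survival are independent as generated sigma-algebras, so an event must be
  located in the right algebra before the product rule applies.\<close>

lemma noise_alg_event:
  assumes "t \<le> Tmax P"
  shows "{\<omega>\<in>space (PS P). trail (\<lambda>j. noise P j \<omega>) t = w} \<in> sets (sigma_gen_by (PS P) {1..Tmax P} (noise P))"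
proof (cases "length w = t")
  case False
  then have "{\<omega>\<in>space (PS P). trail (\<lambda>j. noise P j \<omega>) t = w} = {}" by auto
  then show ?thesis by (metis sets.empty_sets)
next
  case True
  let ?A = "sigma_gen_by (PS P) {1..Tmax P} (noise P)"
  have m: "(\<lambda>\<omega>. \<lambda>i\<in>{1..Tmax P}. noise P i \<omega>) \<in> ?A \<rightarrow>\<^sub>M (\<Pi>\<^sub>M i\<in>{1..Tmax P}. borel)"
    unfolding sigma_gen_by_def by (rule measurable_vimage_algebra1) (auto simp: space_PiM)
  have mj: "noise P j \<in> borel_measurable ?A" if "j \<in> {1..Tmax P}" for j
    using measurable_compose[OF m measurable_component_singleton[OF that]] that by simp
  \<comment> \<open>Any list of length \<open>t\<close> is a trail, which turns the event into
    finitely many conditions on single noises.\<close>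
  have "\<exists>a. w = trail a t"
    using True
  proof (induction t arbitrary: w)
    case (Suc t)
    then obtain z v where w: "w = z # v" "length v = t" by (cases w) auto
    obtain a where a: "v = trail a t" using Suc.IH[OF w(2)] by blast
    have "trail (a(Suc t := z)) t = trail a t" by (subst trail_eq_iff) auto
    then have "w = trail (a(Suc t := z)) (Suc t)" by (simp add: w a)
    then show ?case by blast
  qed auto
  then obtain a where a: "w = trail a t" by blast
  have "{\<omega>\<in>space ?A. \<forall>j\<in>{1..t}. noise P j \<omega> = a j} \<in> sets ?A"
  proof (rule sets.sets_Collect_finite_All)
    fix j assume "j \<in> {1..t}"
    then have [measurable]: "noise P j \<in> borel_measurable ?A" using assms mj by auto
    show "{\<omega>\<in>space ?A. noise P j \<omega> = a j} \<in> sets ?A" by measurable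
  qed auto
  then show ?thesis by (simp add: a trail_eq_iff sigma_gen_by_def)
qed

lemma alive_alg_event:
  assumes "t \<in> {1..Tmax P}"
  shows "{\<omega>\<in>space (PS P). alive P t \<omega> = c} \<in> sets (sigma_gen_by (PS P) {1..Tmax P} (alive P))"
proof -
  let ?A = "sigma_gen_by (PS P) {1..Tmax P} (alive P)"
  have m: "(\<lambda>\<omega>. \<lambda>i\<in>{1..Tmax P}. alive P i \<omega>) \<in> ?A \<rightarrow>\<^sub>M (\<Pi>\<^sub>M i\<in>{1..Tmax P}. borel)"
    unfolding sigma_gen_by_def by (rule measurable_vimage_algebra1) (auto simp: space_PiM)
  have [measurable]: "alive P t \<in> borel_measurable ?A"
    using measurable_compose[OF m measurable_component_singleton[OF assms]] assms by simp
  have "{\<omega>\<in>space ?A. alive P t \<omega> = c} \<in> sets ?A" by measurable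
  then show ?thesis by (simp add: sigma_gen_by_def)
qed

lemma prob_trail_alive:
  assumes t: "t \<le> Tmax P" and w: "w \<in> nodes S t"
  shows "\<P>(\<omega> in PS P. trail (\<lambda>j. noise P j \<omega>) t = w \<and> t < n_stages P \<omega>) = \<mu> w * \<rho> t"
proof (cases "t = 0")
  case True
  have "\<P>(\<omega> in PS P. 0 < n_stages P \<omega>) = 1"
    by (subst prob_eq_1) (use n_stages_AE in \<open>auto elim!: AE_mp\<close>)
  with True w show ?thesis by (simp add: \<rho>_def)
next
  case False
  then have t': "t \<in> {1..Tmax P}" using t by auto
  have "{\<omega>\<in>space (PS P). trail (\<lambda>j. noise P j \<omega>) t = w \<and> t < n_stages P \<omega>} =
      {\<omega>\<in>space (PS P). trail (\<lambda>j. noise P j \<omega>) t = w} \<inter> {\<omega>\<in>space (PS P). alive P t \<omega> = 1}"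
    using False by (auto simp: alive_def)
  moreover have "{\<omega>\<in>space (PS P). alive P t \<omega> = 1} = {\<omega>\<in>space (PS P). t < n_stages P \<omega>}"
    using False by (auto simp: alive_def)
  ultimately show ?thesis
    using indep_setD[OF noise_alive_indep noise_alg_event[OF t] alive_alg_event[OF t', of 1], of w]
    by (simp add: prob_trail[OF t w] \<rho>_def)
qed

lemma prob_trail_stop:
  assumes t: "t \<in> {1..Tmax P}" and w: "w \<in> nodes S t"
  shows "\<P>(\<omega> in PS P. trail (\<lambda>j. noise P j \<omega>) t = w \<and> n_stages P \<omega> = t) = \<mu> w * \<tau> t"
proof -
  let ?B = "{\<omega>\<in>space (PS P). alive P (t - 1) \<omega> = 1} \<inter> {\<omega>\<in>space (PS P). alive P t \<omega> = 0}"
  have tr_ev: "{\<omega>\<in>space (PS P). trail (\<lambda>j. noise P j \<omega>) t = w} \<in> events"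
    using noise_alg_event[of t w] indep_setD_ev1[OF noise_alive_indep] t by auto
  show ?thesis
  \<comment> \<open>Stopping at \<open>t\<close> is written as surviving \<open>t - 1\<close> but
    not \<open>t\<close>, to place it in the algebra of \<open>alive\<close>. That algebra starts at
    index 1, so \<open>t = 1\<close> is separate; there both sides vanish because at least two
    stages occur.\<close>
  proof (cases "t = 1")
    case True
    have "\<P>(\<omega> in PS P. trail (\<lambda>j. noise P j \<omega>) t = w \<and> n_stages P \<omega> = t) \<le> \<tau> t"
      unfolding \<tau>_def by (rule finite_measure_mono) auto
    then show ?thesis using True \<tau>_1 by (simp add: measure_le_0_iff)
  next
    case False
    then have t1: "t - 1 \<in> {1..Tmax P}" using t by auto
    have B: "?B \<in> sets (sigma_gen_by (PS P) {1..Tmax P} (alive P))"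
      by (intro sets.Int alive_alg_event t t1)
    have eqB: "?B = {\<omega>\<in>space (PS P). n_stages P \<omega> = t}"
      using t False by (auto simp: alive_def)
    have "{\<omega>\<in>space (PS P). trail (\<lambda>j. noise P j \<omega>) t = w \<and> n_stages P \<omega> = t} =
        {\<omega>\<in>space (PS P). trail (\<lambda>j. noise P j \<omega>) t = w} \<inter> ?B"
      unfolding eqB by auto
    then show ?thesis
      using indep_setD[OF noise_alive_indep noise_alg_event[of t w] B[unfolded eqB]] t
      unfolding eqB by (simp add: prob_trail[OF _ w] \<tau>_def)
  qed
qed

end

section \<open>Cost-to-go functions on the decision sets\<close>

text \<open>By contradiction, with an infinite set \<open>J\<close> of indices at which all earlier
  cuts are off by \<open>e\<close>. Compactness is used twice: the points converge to
  \<open>l\<close> and the values of \<open>Q\<close> at them to some \<open>A\<close>. Since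
  \<open>Q\<close> is not assumed continuous, \<open>A\<close> need not be \<open>Q l\<close>. In
  place of a Lipschitz bound, only the growth of a cut from \<open>l\<close> to the trial point is
  limited: by affinity this growth would continue up to the prolonged point, where the cut is at
  most \<open>M\<close>.\<close>

lemma cuts_become_tight:
  fixes Q :: "'v::euclidean_space \<Rightarrow> real" and y b :: "nat \<Rightarrow> 'v" and a :: "nat \<Rightarrow> real"
  assumes K: "compact K" "K \<subseteq> D" and y: "\<And>k. k \<in> I \<Longrightarrow> y k \<in> K"
    and upper: "\<And>v. v \<in> D \<Longrightarrow> Q v \<le> M" and lower: "\<And>v. v \<in> K \<Longrightarrow> m \<le> Q v"
    and ray: "\<And>l. l \<in> K \<Longrightarrow> \<exists>r>0. \<forall>v\<in>K. v \<noteq> l \<longrightarrow> l + (r / norm (v - l)) *\<^sub>R (v - l) \<in> D"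
    and cut: "\<And>k v. k \<in> I \<Longrightarrow> v \<in> D \<Longrightarrow> a k + b k \<bullet> v \<le> Q v"
    and tight: "\<And>e. e > 0 \<Longrightarrow> \<forall>\<^sub>F k in sequentially. k \<in> I \<longrightarrow> Q (y k) - (a k + b k \<bullet> y k) < e"
    and e: "e > 0"
  shows "\<forall>\<^sub>F k in sequentially. k \<in> I \<longrightarrow> (\<exists>j\<in>I. j < k \<and> Q (y k) - (a j + b j \<bullet> y k) < e)"
proof (rule ccontr)
  define J where "J = {k\<in>I. \<forall>j\<in>I. j < k \<longrightarrow> e \<le> Q (y k) - (a j + b j \<bullet> y k)}"
  assume "\<not> ?thesis"
  then have "\<exists>\<^sub>F k in sequentially. k \<in> J"
    unfolding not_eventually by (rule frequently_elim1) (auto simp: J_def not_less)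
  then have J: "infinite J"
    by (simp add: cofinite_eq_sequentially[symmetric] INFM_iff_infinite)
  define r0 where "r0 = enumerate J"
  have r0: "strict_mono r0" "\<And>n. r0 n \<in> J"
    using J by (auto simp: r0_def enumerate_in_set strict_mono_enumerate)
  have JI: "k \<in> J \<Longrightarrow> k \<in> I" for k by (simp add: J_def)
  have "\<forall>n. (y \<circ> r0) n \<in> K" using y r0 JI by auto
  then obtain l r1 where l: "l \<in> K" and r1: "strict_mono r1" "(y \<circ> r0 \<circ> r1) \<longlonglongrightarrow> l"
    using K(1) unfolding compact_def by metis
  have "\<forall>n. (Q \<circ> y \<circ> r0 \<circ> r1) n \<in> {m..M}"
  proof
    fix n
    have "y (r0 (r1 n)) \<in> K" using y r0 JI by blast
    then show "(Q \<circ> y \<circ> r0 \<circ> r1) n \<in> {m..M}" using lower upper K(2) by auto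
  qed
  then obtain A r2 where r2: "strict_mono r2" "(Q \<circ> y \<circ> r0 \<circ> r1 \<circ> r2) \<longlonglongrightarrow> A" and AM: "A \<le> M"
    using compact_Icc[of m M] unfolding compact_def by (metis atLeastAtMost_iff)
  define r where "r = r0 \<circ> r1 \<circ> r2"
  have r: "strict_mono r" "\<And>n. r n \<in> J"
    using r0 r1 r2 by (auto simp: r_def intro!: strict_mono_o)
  have yl: "(\<lambda>n. y (r n)) \<longlonglongrightarrow> l"
    using LIMSEQ_subseq_LIMSEQ[OF r1(2) r2(1)] by (simp add: r_def o_def)
  have QA: "(\<lambda>n. Q (y (r n))) \<longlonglongrightarrow> A"
    using r2(2) by (simp add: r_def o_def)
  define C where "C = (\<lambda>n. a (r n) + b (r n) \<bullet> y (r n))"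
  obtain R where R: "R > 0" "\<And>v. v \<in> K \<Longrightarrow> v \<noteq> l \<Longrightarrow> l + (R / norm (v - l)) *\<^sub>R (v - l) \<in> D"
    using ray[OF l] by blast
  define \<delta> where "\<delta> = (\<lambda>n. norm (y (r n) - l))"
  have \<delta>0: "\<delta> \<longlonglongrightarrow> 0"
    unfolding \<delta>_def using yl by (simp add: LIM_zero tendsto_norm_zero)
  \<comment> \<open>The most a cut can rise between the trial point, where it will exceed
    \<open>A - e / 4\<close>, and a point of \<open>D\<close>, where it is at most
    \<open>M\<close>.\<close>
  define B where "B = M - A + e / 4"
  have B: "B > 0" using AM e by (simp add: B_def)
  have "(\<lambda>n. B * \<delta> n / (R - \<delta> n)) \<longlonglongrightarrow> B * 0 / (R - 0)"
    by (intro tendsto_intros \<delta>0) (use R in auto)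
  then have ev1: "\<forall>\<^sub>F n in sequentially. B * \<delta> n / (R - \<delta> n) < e / 4"
    using e by (intro order_tendstoD(2)) auto
  have ev2: "\<forall>\<^sub>F n in sequentially. \<delta> n < R"
    using \<delta>0 R by (intro order_tendstoD(2)) auto
  have ev3: "\<forall>\<^sub>F n in sequentially. A - e / 8 < Q (y (r n))"
    using QA e by (intro order_tendstoD(1)) auto
  have ev4: "\<forall>\<^sub>F n in sequentially. r n \<in> I \<longrightarrow> Q (y (r n)) - C n < e / 8"
    using eventually_subseq[OF r(1) tight[of "e / 8"]] e by (simp add: C_def)
  obtain n where n: "B * \<delta> n / (R - \<delta> n) < e / 4" "\<delta> n < R" "A - e / 4 < C n"
  proof -
    have "\<forall>\<^sub>F n in sequentially. B * \<delta> n / (R - \<delta> n) < e / 4 \<and> \<delta> n < R \<and> A - e / 4 < C n"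
      using ev1 ev2 ev3 ev4 by eventually_elim (use r(2) JI in \<open>auto simp: field_simps\<close>)
    then show thesis using that eventually_happens'[OF sequentially_bot] by blast
  qed
  \<comment> \<open>The prolonged point has distance \<open>R\<close> from \<open>l\<close>, hence
    \<open>R - \<delta> n\<close> from the trial point. The rise per unit length is therefore at
    most \<open>B / (R - \<delta> n)\<close>, and it acts over the length
    \<open>\<delta> n\<close>.\<close>
  have "b (r n) \<bullet> (y (r n) - l) \<le> B * \<delta> n / (R - \<delta> n)"
  proof (cases "y (r n) = l")
    case True
    then show ?thesis by (simp add: \<delta>_def)
  next
    case False
    then have \<delta>pos: "\<delta> n > 0" by (simp add: \<delta>_def)
    define p where "p = l + (R / \<delta> n) *\<^sub>R (y (r n) - l)"
    have p: "p \<in> D"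
      unfolding p_def \<delta>_def by (rule R(2)) (use y r(2) JI False in auto)
    have "a (r n) + b (r n) \<bullet> p \<le> M"
      using cut[OF JI[OF r(2)] p] upper[OF p] by (rule order_trans)
    moreover have "a (r n) + b (r n) \<bullet> p = C n + (R / \<delta> n - 1) * (b (r n) \<bullet> (y (r n) - l))"
      by (simp add: p_def C_def inner_add_right inner_diff_right algebra_simps)
    ultimately have "(R / \<delta> n - 1) * (b (r n) \<bullet> (y (r n) - l)) \<le> B"
      using n(3) by (simp add: B_def)
    moreover have "R / \<delta> n - 1 = (R - \<delta> n) / \<delta> n" using \<delta>pos by (simp add: field_simps)
    ultimately show ?thesis using \<delta>pos n(2) by (simp add: field_simps)
  qed
  then have l_cut: "A - e / 2 < a (r n) + b (r n) \<bullet> l"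
    using n(1,3) unfolding C_def inner_diff_right by linarith
  have "(\<lambda>j. a (r n) + b (r n) \<bullet> y (r j)) \<longlonglongrightarrow> a (r n) + b (r n) \<bullet> l"
    by (intro tendsto_intros yl)
  then have "\<forall>\<^sub>F j in sequentially. A - e / 2 < a (r n) + b (r n) \<bullet> y (r j)"
    using l_cut by (rule order_tendstoD(1))
  moreover have "\<forall>\<^sub>F j in sequentially. Q (y (r j)) < A + e / 2"
    using QA e by (intro order_tendstoD(2)) auto
  \<comment> \<open>One fixed cut \<open>r n\<close> serves all large \<open>j\<close>: at
    \<open>y (r j)\<close> it exceeds \<open>A - e / 2\<close> while \<open>Q\<close> stays below
    \<open>A + e / 2\<close>, contrary to \<open>r j\<close> being in \<open>J\<close>.\<close>
  ultimately have "\<forall>\<^sub>F j in sequentially. False"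
    using eventually_gt_at_top[of n]
  proof eventually_elim
    case (elim j)
    have "r n < r j" using r(1) elim(3) by (simp add: strict_mono_def)
    then have "e \<le> Q (y (r j)) - (a (r n) + b (r n) \<bullet> y (r j))"
      using r(2)[of j] r(2)[of n] by (auto simp: J_def)
    then show False using elim by linarith
  qed
  then show False by simp
qed

text \<open>Common interface of linear and nonlinear problems. For a node of stage \<open>t\<close>,
  \<open>K w\<close> holds decisions of stage \<open>t\<close>, which are the arguments of the
  cost-to-go function of stage \<open>Suc t\<close>. \<open>D_bound\<close> asks, even at points of
  \<open>D w\<close> that no decision reaches, for a decision of bounded cost that is back in
  \<open>K (z # w)\<close>; this closes the backward induction for upper bounds. In
  \<open>ray\<close> the length \<open>r\<close> may depend on \<open>l\<close> but not on
  \<open>v\<close>, so that points \<open>v\<close> close to \<open>l\<close> can be passed by a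
  fixed distance.\<close>

locale stage_structure = random_horizon P
  for P :: "('w, 's::euclidean_space, 'v::euclidean_space) stoch_prog" +
  fixes K D :: "'s list \<Rightarrow> 'v set" and \<theta>0 :: "nat \<Rightarrow> real" and \<beta>0 :: "nat \<Rightarrow> 'v"
  assumes K_Nil: "K [] = {x_init P}"
    and K_compact: "\<And>t w. t < Tmax P \<Longrightarrow> w \<in> nodes S t \<Longrightarrow> compact (K w)"
    and K_sub_D: "\<And>t w. t < Tmax P \<Longrightarrow> w \<in> nodes S t \<Longrightarrow> K w \<subseteq> D w"
    and feas_nonempty: "\<And>t w z y. t < Tmax P \<Longrightarrow> w \<in> nodes S t \<Longrightarrow> z \<in> S (Suc t) \<Longrightarrow> y \<in> K w \<Longrightarrow>
        feas P (Suc t) y z \<noteq> {}"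
    and feas_sub_K: "\<And>t w z y. t < Tmax P \<Longrightarrow> w \<in> nodes S t \<Longrightarrow> z \<in> S (Suc t) \<Longrightarrow> y \<in> K w \<Longrightarrow>
        feas P (Suc t) y z \<subseteq> K (z # w)"
    and cost_finite: "\<And>t w z y x. t < Tmax P \<Longrightarrow> w \<in> nodes S t \<Longrightarrow> z \<in> S (Suc t) \<Longrightarrow> y \<in> K w \<Longrightarrow>
        x \<in> feas P (Suc t) y z \<Longrightarrow> \<bar>cost P (Suc t) x y z\<bar> \<noteq> \<infinity>"
    and D_bound: "\<And>t w z. t < Tmax P \<Longrightarrow> w \<in> nodes S t \<Longrightarrow> z \<in> S (Suc t) \<Longrightarrow>
        \<exists>M. \<forall>y\<in>D w. \<exists>x\<in>feas P (Suc t) y z. x \<in> K (z # w) \<and> cost P (Suc t) x y z \<le> ereal M"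
    and ray: "\<And>t w l. t < Tmax P \<Longrightarrow> w \<in> nodes S t \<Longrightarrow> l \<in> K w \<Longrightarrow>
        \<exists>r>0. \<forall>v\<in>K w. v \<noteq> l \<longrightarrow> l + (r / norm (v - l)) *\<^sub>R (v - l) \<in> D w"
    and affine_lower: "\<And>t y. t \<in> {2..Tmax P} \<Longrightarrow> ereal (\<theta>0 t + \<beta>0 t \<bullet> y) \<le> cost_to_go P t y"
begin

abbreviation "Q \<equiv> cost_to_go P"
abbreviation "V1 t \<equiv> stage_value P t (cost_to_go P (Suc t))"
abbreviation "V0 t \<equiv> stage_value P t (\<lambda>_. 0)"
abbreviation "p \<equiv> noise_prob P"

text \<open>Since \<open>real_of_ereal\<close> sends infinite values to 0, these real versions are
  faithful only where finiteness is known: \<open>Q_finite_D\<close> for \<open>Qr\<close>,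
  \<open>V_finite\<close> for \<open>v1\<close> and \<open>v0\<close>.\<close>

definition Qr :: "nat \<Rightarrow> 'v \<Rightarrow> real" where "Qr t y = real_of_ereal (Q t y)"
definition v1 :: "nat \<Rightarrow> 'v \<Rightarrow> 's \<Rightarrow> real" where "v1 t y z = real_of_ereal (V1 t y z)"
definition v0 :: "nat \<Rightarrow> 'v \<Rightarrow> 's \<Rightarrow> real" where "v0 t y z = real_of_ereal (V0 t y z)"

section \<open>Bounds and finiteness of the cost-to-go functions\<close>

lemma Q_eq:
  "t \<le> Tmax P \<Longrightarrow> Q t y = ereal (1 - q t) * (\<Sum>z\<in>S t. ereal (p t z) * V1 t y z)
     + ereal (q t) * (\<Sum>z\<in>S t. ereal (p t z) * V0 t y z)"
  by (subst cost_to_go.simps) simp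

lemma Q_end: "Q (Suc (Tmax P)) = (\<lambda>y. 0)"
  by (subst cost_to_go.simps) simp

lemma weighted_sum_mono:
  assumes "0 \<le> c" "c \<le> 1" "\<And>z. z \<in> S t \<Longrightarrow> f z \<le> f' z" "\<And>z. z \<in> S t \<Longrightarrow> g z \<le> g' z"
  shows "ereal (1 - c) * (\<Sum>z\<in>S t. ereal (p t z) * f z) + ereal c * (\<Sum>z\<in>S t. ereal (p t z) * g z)
    \<le> ereal (1 - c) * (\<Sum>z\<in>S t. ereal (p t z) * f' z) + ereal c * (\<Sum>z\<in>S t. ereal (p t z) * g' z)"
  by (intro add_mono ereal_mult_left_mono sum_mono) (use assms noise_prob_nonneg in auto)

lemma stage_upper:
  assumes t: "t < Tmax P" and w: "w \<in> nodes S t" and z: "z \<in> S (Suc t)"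
    and upper: "\<And>y. y \<in> K (z # w) \<Longrightarrow> Q (Suc (Suc t)) y \<le> ereal M'"
  shows "\<exists>M. \<forall>y\<in>D w. V1 (Suc t) y z \<le> ereal M \<and> V0 (Suc t) y z \<le> ereal M"
proof -
  obtain M where M: "\<And>y. y \<in> D w \<Longrightarrow> \<exists>x\<in>feas P (Suc t) y z. x \<in> K (z # w) \<and> cost P (Suc t) x y z \<le> ereal M"
    using D_bound[OF t w z] by blast
  have "V1 (Suc t) y z \<le> ereal (max (M + M') M) \<and> V0 (Suc t) y z \<le> ereal (max (M + M') M)" if y: "y \<in> D w" for y
  proof -
    obtain x where x: "x \<in> feas P (Suc t) y z" "x \<in> K (z # w)" "cost P (Suc t) x y z \<le> ereal M"
      using M[OF y] by blast
    have "V1 (Suc t) y z \<le> cost P (Suc t) x y z + Q (Suc (Suc t)) x"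
      unfolding stage_value_def by (rule INF_lower) (use x in simp)
    also have "\<dots> \<le> ereal M + ereal M'" by (intro add_mono x upper)
    also have "\<dots> \<le> ereal (max (M + M') M)" by simp
    finally have 1: "V1 (Suc t) y z \<le> ereal (max (M + M') M)" .
    have "V0 (Suc t) y z \<le> cost P (Suc t) x y z + 0"
      unfolding stage_value_def by (rule INF_lower) (use x in simp)
    also have "\<dots> \<le> ereal M" using x by simp
    also have "\<dots> \<le> ereal (max (M + M') M)" by simp
    finally show ?thesis using 1 by simp
  qed
  then show ?thesis by blast
qed

lemma Q_upper_aux:
  assumes t: "t < Tmax P" "1 \<le> t" and w: "w \<in> nodes S t"
    and b: "\<And>z. z \<in> S (Suc t) \<Longrightarrow> \<exists>M. \<forall>y\<in>D w. V1 (Suc t) y z \<le> ereal M \<and> V0 (Suc t) y z \<le> ereal M"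
  shows "\<exists>M. \<forall>y\<in>D w. Q (Suc t) y \<le> ereal M"
proof -
  obtain M where M: "\<And>z y. z \<in> S (Suc t) \<Longrightarrow> y \<in> D w \<Longrightarrow> V1 (Suc t) y z \<le> ereal (M z) \<and> V0 (Suc t) y z \<le> ereal (M z)"
    using b by metis
  have "Q (Suc t) y \<le> ereal ((1 - q (Suc t)) * (\<Sum>z\<in>S (Suc t). p (Suc t) z * M z)
      + q (Suc t) * (\<Sum>z\<in>S (Suc t). p (Suc t) z * M z))" if y: "y \<in> D w" for y
  proof -
    have "Q (Suc t) y \<le> ereal (1 - q (Suc t)) * (\<Sum>z\<in>S (Suc t). ereal (p (Suc t) z) * ereal (M z))
      + ereal (q (Suc t)) * (\<Sum>z\<in>S (Suc t). ereal (p (Suc t) z) * ereal (M z))" (is "_ \<le> ?R")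
    proof (subst Q_eq)
      show "Suc t \<le> Tmax P" using t by simp
      have tt: "Suc t \<in> {2..Tmax P}" using t by auto
      show "ereal (1 - q (Suc t)) * (\<Sum>z\<in>S (Suc t). ereal (p (Suc t) z) * V1 (Suc t) y z) +
          ereal (q (Suc t)) * (\<Sum>z\<in>S (Suc t). ereal (p (Suc t) z) * V0 (Suc t) y z) \<le> ?R"
        by (rule weighted_sum_mono) (use stop_prob[OF tt] M[OF _ y] in auto)
    qed
    then show ?thesis by simp
  qed
  then show ?thesis by blast
qed

text \<open>The inductive step consults the next stage only on \<open>K (z # w)\<close>, because
  \<open>D_bound\<close> leads back there. The bound is nevertheless carried on all of
  \<open>D w\<close>, where the cuts will be compared with \<open>Q\<close> at prolonged
  points.\<close>

lemma Q_upper: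
  assumes "1 \<le> t" "t \<le> Tmax P" "w \<in> nodes S t"
  shows "\<exists>M. \<forall>y\<in>D w. Q (Suc t) y \<le> ereal M"
  using assms(2,1,3)
proof (induction t arbitrary: w rule: inc_induct)
  case base
  then show ?case by (auto simp: Q_end zero_ereal_def intro!: exI[of _ 0])
next
  case (step t)
  show ?case
  proof (rule Q_upper_aux)
    fix z assume z: "z \<in> S (Suc t)"
    have zw: "z # w \<in> nodes S (Suc t)" using step.prems z by auto
    obtain M where M: "\<And>y. y \<in> D (z # w) \<Longrightarrow> Q (Suc (Suc t)) y \<le> ereal M"
      using step.IH[OF _ zw] step.prems by auto
    have "\<exists>M. \<forall>y\<in>K (z # w). Q (Suc (Suc t)) y \<le> ereal M"
    proof (cases "Suc t = Tmax P")
      case True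
      then show ?thesis by (auto simp: Q_end zero_ereal_def intro!: exI[of _ 0])
    next
      case False
      then have "K (z # w) \<subseteq> D (z # w)" using step zw by (intro K_sub_D[of "Suc t"]) auto
      then show ?thesis using M by blast
    qed
    then obtain M' where "\<And>y. y \<in> K (z # w) \<Longrightarrow> Q (Suc (Suc t)) y \<le> ereal M'" by blast
    then show "\<exists>M. \<forall>y\<in>D w. V1 (Suc t) y z \<le> ereal M \<and> V0 (Suc t) y z \<le> ereal M"
      using step z by (intro stage_upper) auto
  qed (use step in auto)
qed

lemma Q_finite_D:
  assumes "1 \<le> t" "t \<le> Tmax P" "w \<in> nodes S t" "y \<in> D w"
  shows "\<bar>Q (Suc t) y\<bar> \<noteq> \<infinity>"
proof (cases "t = Tmax P")
  case True
  then show ?thesis by (simp add: Q_end)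
next
  case False
  have "ereal (\<theta>0 (Suc t) + \<beta>0 (Suc t) \<bullet> y) \<le> Q (Suc t) y"
    by (rule affine_lower) (use assms False in auto)
  moreover obtain M where "Q (Suc t) y \<le> ereal M"
    using Q_upper[OF assms(1-3)] assms(4) by blast
  ultimately show ?thesis by (cases "Q (Suc t) y") auto
qed

lemma Q_finite:
  assumes "1 \<le> t" "t \<le> Tmax P" "w \<in> nodes S t" "y \<in> K w"
  shows "\<bar>Q (Suc t) y\<bar> \<noteq> \<infinity>"
proof (cases "t = Tmax P")
  case True
  then show ?thesis by (simp add: Q_end)
next
  case False
  then show ?thesis using assms K_sub_D[of t w] by (intro Q_finite_D) auto
qed

lemma Q_ereal: "1 \<le> t \<Longrightarrow> t \<le> Tmax P \<Longrightarrow> w \<in> nodes S t \<Longrightarrow> y \<in> K w \<Longrightarrow> Q (Suc t) y = ereal (Qr (Suc t) y)"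
  using Q_finite[of t w y] by (simp add: Qr_def ereal_real)

text \<open>A single stage value has no evident lower bound; it is obtained from the sum. The
  weighted sum \<open>Q\<close> is finite thanks to the affine minorant, no summand is
  \<open>\<infinity>\<close> by \<open>stage_upper\<close>, and positive weights then exclude
  \<open>-\<infinity>\<close> as well.\<close>

lemma V_finite:
  assumes t: "1 \<le> t" "t < Tmax P" and w: "w \<in> nodes S t" and z: "z \<in> S (Suc t)" and y: "y \<in> K w"
  shows "\<bar>V1 (Suc t) y z\<bar> \<noteq> \<infinity>" "\<bar>V0 (Suc t) y z\<bar> \<noteq> \<infinity>"
proof -
  have yD: "y \<in> D w" using K_sub_D[OF t(2) w] y by blast
  have up: "V1 (Suc t) y z' \<noteq> \<infinity> \<and> V0 (Suc t) y z' \<noteq> \<infinity>" if z': "z' \<in> S (Suc t)" for z'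
  proof -
    have zw: "z' # w \<in> nodes S (Suc t)" using w z' by auto
    have "\<exists>M. \<forall>y\<in>K (z' # w). Q (Suc (Suc t)) y \<le> ereal M"
    proof (cases "Suc t = Tmax P")
      case True
      then show ?thesis by (auto simp: Q_end zero_ereal_def intro!: exI[of _ 0])
    next
      case False
      then show ?thesis using K_sub_D[OF _ zw] Q_upper[OF _ _ zw] t by fastforce
    qed
    then obtain M' where "\<And>y. y \<in> K (z' # w) \<Longrightarrow> Q (Suc (Suc t)) y \<le> ereal M'" by blast
    from stage_upper[OF t(2) w z' this] yD show ?thesis by fastforce
  qed
  define A1 where "A1 = (\<Sum>z\<in>S (Suc t). ereal (p (Suc t) z) * V1 (Suc t) y z)"
  define A0 where "A0 = (\<Sum>z\<in>S (Suc t). ereal (p (Suc t) z) * V0 (Suc t) y z)"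
  have fin: "finite (S (Suc t))" using t by (intro finite_S) auto
  have ppos: "z' \<in> S (Suc t) \<Longrightarrow> 0 < p (Suc t) z'" for z'
    using t by (intro noise_prob_pos) auto
  have A: "A1 \<noteq> \<infinity>" "A0 \<noteq> \<infinity>"
    unfolding A1_def A0_def sum_Pinfty using up ppos by (auto simp: ereal_mult_eq_PInfty less_imp_not_less)
  have Q: "\<bar>ereal (1 - q (Suc t)) * A1 + ereal (q (Suc t)) * A0\<bar> \<noteq> \<infinity>"
    using Q_finite[OF t(1) less_imp_le[OF t(2)] w y] t unfolding A1_def A0_def by (subst (asm) Q_eq) auto
  have q: "0 < q (Suc t)" "q (Suc t) \<le> 1" using t by (auto intro!: stop_prob)
  have A0: "\<bar>A0\<bar> \<noteq> \<infinity>"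
    using A Q q by (cases A0; cases A1) (auto split: if_splits)
  have fin0: "\<bar>V0 (Suc t) y z\<bar> \<noteq> \<infinity>"
    using A0 z ppos[OF z] fin unfolding A0_def sum_Inf by (auto simp: abs_mult)
  then show "\<bar>V0 (Suc t) y z\<bar> \<noteq> \<infinity>" .
  show "\<bar>V1 (Suc t) y z\<bar> \<noteq> \<infinity>"
  \<comment> \<open>At the last stage the weight of \<open>A1\<close> is 0 and finiteness of the sum
    says nothing about it; but there \<open>V1\<close> and \<open>V0\<close> coincide.\<close>
  proof (cases "Suc t = Tmax P")
    case True
    then show ?thesis using fin0 by (simp add: Q_end)
  next
    case False
    then have "q (Suc t) < 1" using t by (intro stop_prob) auto
    then have "\<bar>A1\<bar> \<noteq> \<infinity>"
      using A Q q by (cases A0; cases A1) (auto split: if_splits)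
    then show ?thesis
      using z ppos[OF z] fin unfolding A1_def sum_Inf by (auto simp: abs_mult)
  qed
qed

lemma V_ereal:
  assumes "1 \<le> t" "t < Tmax P" "w \<in> nodes S t" "z \<in> S (Suc t)" "y \<in> K w"
  shows "V1 (Suc t) y z = ereal (v1 (Suc t) y z)" "V0 (Suc t) y z = ereal (v0 (Suc t) y z)"
  using V_finite[OF assms] by (simp_all add: v1_def v0_def ereal_real)

lemma Qr_eq:
  assumes t: "1 \<le> t" "t < Tmax P" and w: "w \<in> nodes S t" and y: "y \<in> K w"
  shows "Qr (Suc t) y = (1 - q (Suc t)) * (\<Sum>z\<in>S (Suc t). p (Suc t) z * v1 (Suc t) y z)
      + q (Suc t) * (\<Sum>z\<in>S (Suc t). p (Suc t) z * v0 (Suc t) y z)"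
proof -
  have "Q (Suc t) y = ereal ((1 - q (Suc t)) * (\<Sum>z\<in>S (Suc t). p (Suc t) z * v1 (Suc t) y z)
      + q (Suc t) * (\<Sum>z\<in>S (Suc t). p (Suc t) z * v0 (Suc t) y z))"
    using t by (subst Q_eq) (simp_all add: V_ereal[OF t w _ y])
  then show ?thesis by (simp add: Qr_def)
qed

end

section \<open>The optimal value\<close>

text \<open>The level set of \<open>f\<close> through \<open>\<omega>\<close> is the preimage of a
  closed singleton, hence a preimage under the generating map, and so it contains all points with
  the same generator values. The statement is pointwise, without null sets; it turns policies into
  functions of nodes and iterates into functions of samples.\<close>

lemma sigma_gen_by_constant_on_fibres:
  fixes Z :: "'i \<Rightarrow> 'w \<Rightarrow> 'b::topological_space" and f :: "'w \<Rightarrow> 'c::t1_space"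
  assumes f: "f \<in> borel_measurable (sigma_gen_by M I Z)"
    and \<omega>: "\<omega> \<in> space M" "\<omega>' \<in> space M" and eq: "\<And>i. i \<in> I \<Longrightarrow> Z i \<omega> = Z i \<omega>'"
  shows "f \<omega> = f \<omega>'"
proof -
  have "f -` {f \<omega>} \<inter> space (sigma_gen_by M I Z) \<in> sets (sigma_gen_by M I Z)"
    by (rule measurable_sets[OF f]) simp
  then obtain A where A: "f -` {f \<omega>} \<inter> space M = (\<lambda>\<omega>. \<lambda>i\<in>I. Z i \<omega>) -` A \<inter> space M"
    unfolding sigma_gen_by_def by (subst (asm) sets_vimage_algebra2) (auto simp: space_PiM)
  have "\<omega> \<in> f -` {f \<omega>} \<inter> space M" using \<omega> by simp
  then have "(\<lambda>i\<in>I. Z i \<omega>) \<in> A" unfolding A by simp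
  moreover have "(\<lambda>i\<in>I. Z i \<omega>) = (\<lambda>i\<in>I. Z i \<omega>')" using eq by auto
  ultimately have "\<omega>' \<in> f -` {f \<omega>} \<inter> space M" unfolding A using \<omega> by simp
  then show ?thesis by simp
qed

lemma sigma_gen_by_component:
  assumes "i \<in> I"
  shows "Z i \<in> borel_measurable (sigma_gen_by M I Z)"
proof -
  have "(\<lambda>\<omega>. \<lambda>i\<in>I. Z i \<omega>) \<in> sigma_gen_by M I Z \<rightarrow>\<^sub>M (\<Pi>\<^sub>M i\<in>I. borel)"
    unfolding sigma_gen_by_def by (rule measurable_vimage_algebra1) (auto simp: space_PiM)
  from measurable_compose[OF this measurable_component_singleton[OF assms]] assms show ?thesis by simp
qed

lemma sets_sigma_gen_by_mono:
  assumes "I \<subseteq> J"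
  shows "sets (sigma_gen_by M I Z) \<subseteq> sets (sigma_gen_by M J Z)"
proof -
  have "(\<lambda>\<omega>. \<lambda>i\<in>I. Z i \<omega>) \<in> sigma_gen_by M J Z \<rightarrow>\<^sub>M (\<Pi>\<^sub>M i\<in>I. borel)"
    using assms by (intro measurable_restrict sigma_gen_by_component) auto
  then show ?thesis
    unfolding sigma_gen_by_def[of M I]
    by (intro sets_image_in_sets) (simp_all add: sigma_gen_by_def)
qed

text \<open>Positive and negative part both have finite integral, so the undefined difference of
  infinities does not arise. For \<open>h\<close> itself, agreement with \<open>g\<close> almost
  everywhere is enough.\<close>

lemma (in prob_space) ereal_expectation_real:
  assumes g: "integrable M g" and eq: "AE \<omega> in M. h \<omega> = ereal (g \<omega>)"
  shows "ereal_expectation M h = ereal (\<integral>\<omega>. g \<omega> \<partial>M)"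
proof -
  have "(\<integral>\<^sup>+\<omega>. e2ennreal (h \<omega>) \<partial>M) = (\<integral>\<^sup>+\<omega>. ennreal (g \<omega>) \<partial>M)"
    by (rule nn_integral_cong_AE) (use eq in eventually_elim, simp)
  moreover have "(\<integral>\<^sup>+\<omega>. e2ennreal (- h \<omega>) \<partial>M) = (\<integral>\<^sup>+\<omega>. ennreal (- g \<omega>) \<partial>M)"
    by (rule nn_integral_cong_AE) (use eq in eventually_elim, simp)
  moreover have "(\<integral>\<^sup>+\<omega>. ennreal (g \<omega>) \<partial>M) < \<infinity>" "(\<integral>\<^sup>+\<omega>. ennreal (- g \<omega>) \<partial>M) < \<infinity>"
    using g by (auto simp: real_integrable_def less_top)
  ultimately show ?thesis
    unfolding ereal_expectation_def real_lebesgue_integral_def[OF g]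
    by (cases "\<integral>\<^sup>+\<omega>. ennreal (g \<omega>) \<partial>M"; cases "\<integral>\<^sup>+\<omega>. ennreal (- g \<omega>) \<partial>M") auto
qed

section \<open>Policies as decisions on the scenario tree\<close>

context stage_structure
begin

definition fr :: "nat \<Rightarrow> 'v \<Rightarrow> 'v \<Rightarrow> 's \<Rightarrow> real" where
  "fr t x y z = real_of_ereal (cost P t x y z)"

text \<open>Expected cost of stage \<open>t\<close>. A node carries two decisions:
  \<open>Y w\<close> if the process survives its stage and \<open>Y0 w\<close> if it stops there.
  The predecessor is always \<open>Y (tl w)\<close>, as a cost at stage \<open>t\<close> is incurred
  only after surviving \<open>t - 1\<close>.\<close>

definition tree_cost :: "('s list \<Rightarrow> 'v) \<Rightarrow> ('s list \<Rightarrow> 'v) \<Rightarrow> nat \<Rightarrow> real" where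
  "tree_cost Y Y0 t = (\<Sum>w\<in>nodes S t. \<mu> w * (\<rho> t * fr t (Y w) (Y (tl w)) (hd w) + \<tau> t * fr t (Y0 w) (Y (tl w)) (hd w)))"

text \<open>Expected cost-to-go after stage \<open>t\<close>, restricted to the event that the
  process survives \<open>t\<close>.\<close>

definition tree_value :: "('s list \<Rightarrow> 'v) \<Rightarrow> nat \<Rightarrow> real" where
  "tree_value Y t = (\<Sum>w\<in>nodes S t. \<mu> w * \<rho> t * Qr (Suc t) (Y w))"

abbreviation "tr \<omega> t \<equiv> trail (\<lambda>j. noise P j \<omega>) t"

definition admissible :: "(nat \<Rightarrow> 'w \<Rightarrow> 'v) \<Rightarrow> 'w \<Rightarrow> bool" where
  "admissible X \<omega> \<longleftrightarrow> \<omega> \<in> space (PS P) \<and> 2 \<le> n_stages P \<omega> \<and> n_stages P \<omega> \<le> Tmax P \<and>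
     (\<forall>t\<in>{1..Tmax P}. noise P t \<omega> \<in> S t \<and> X t \<omega> \<in> feas P t (X (t - 1) \<omega>) (noise P t \<omega>))"

lemma admissible_AE: "X \<in> policies P \<Longrightarrow> AE \<omega> in PS P. admissible X \<omega>"
proof -
  assume X: "X \<in> policies P"
  have "AE \<omega> in PS P. \<forall>t\<in>{1..Tmax P}. X t \<omega> \<in> feas P t (X (t - 1) \<omega>) (noise P t \<omega>)"
    using X by (subst AE_finite_all) (auto simp: policies_def)
  then show ?thesis
    using noise_AE n_stages_AE AE_space by eventually_elim (auto simp: admissible_def)
qed

lemma admissible_tr: "admissible X \<omega> \<Longrightarrow> t \<le> Tmax P \<Longrightarrow> tr \<omega> t \<in> nodes S t"
  by (rule trail_in_nodes) (auto simp: admissible_def)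

lemma admissible_Suc:
  assumes "admissible X \<omega>" "Suc t \<le> Tmax P"
  shows "noise P (Suc t) \<omega> \<in> S (Suc t)" "X (Suc t) \<omega> \<in> feas P (Suc t) (X t \<omega>) (noise P (Suc t) \<omega>)"
proof -
  have "Suc t \<in> {1..Tmax P}" using assms(2) by simp
  then show "noise P (Suc t) \<omega> \<in> S (Suc t)" "X (Suc t) \<omega> \<in> feas P (Suc t) (X t \<omega>) (noise P (Suc t) \<omega>)"
    using assms(1) unfolding admissible_def by (metis diff_Suc_1)+
qed

lemma policy_in_K:
  assumes X: "X \<in> policies P" and \<omega>: "admissible X \<omega>" and t: "t \<le> Tmax P"
  shows "X t \<omega> \<in> K (tr \<omega> t)"
  using t
proof (induction t)
  case 0
  then show ?case using X by (simp add: policies_def K_Nil)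
next
  case (Suc t)
  then show ?case
    using admissible_Suc[OF \<omega> Suc.prems] feas_sub_K[of t "tr \<omega> t" "noise P (Suc t) \<omega>" "X t \<omega>"] Suc admissible_tr[OF \<omega>, of t] by auto
qed

lemma policy_cost_finite:
  assumes X: "X \<in> policies P" and \<omega>: "admissible X \<omega>" and t: "t \<in> {1..Tmax P}"
  shows "cost P t (X t \<omega>) (X (t - 1) \<omega>) (noise P t \<omega>) = ereal (fr t (X t \<omega>) (X (t - 1) \<omega>) (noise P t \<omega>))"
proof -
  obtain t' where t': "t = Suc t'" using t by (cases t) auto
  have "\<bar>cost P (Suc t') (X t \<omega>) (X t' \<omega>) (noise P t \<omega>)\<bar> \<noteq> \<infinity>"
    by (rule cost_finite[of t' "tr \<omega> t'"])
      (use policy_in_K[OF X \<omega>, of t'] admissible_tr[OF \<omega>, of t'] admissible_Suc[OF \<omega>, of t'] t t' in auto)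
  then show ?thesis by (simp add: fr_def ereal_real t')
qed

lemma policy_constant:
  assumes X: "X \<in> policies P" and \<omega>: "\<omega> \<in> space (PS P)" "\<omega>' \<in> space (PS P)" and t: "t \<le> Tmax P"
    and tr: "tr \<omega> t = tr \<omega>' t" and alive: "\<And>j. j \<in> {1..t} \<Longrightarrow> alive P j \<omega> = alive P j \<omega>'"
  shows "X t \<omega> = X t \<omega>'"
proof (cases "t = 0")
  case True
  then show ?thesis using X by (simp add: policies_def)
next
  case False
  then have "X t \<in> borel_measurable (filtr P t)" using X t by (simp add: policies_def)
  then show ?thesis
    unfolding filtr_def
    by (rule sigma_gen_by_constant_on_fibres) (use \<omega> tr alive in \<open>auto simp: trail_eq_iff\<close>)
qed

text \<open>Any scenario through the node would do, by \<open>policy_constant\<close>. The chosen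
  one is admissible, so that almost sure properties of the policy pass to the selected
  value.\<close>

definition alive_decision :: "(nat \<Rightarrow> 'w \<Rightarrow> 'v) \<Rightarrow> 's list \<Rightarrow> 'v" where
  "alive_decision X w = X (length w) (SOME \<omega>. admissible X \<omega> \<and> tr \<omega> (length w) = w \<and> length w < n_stages P \<omega>)"

definition stop_decision :: "(nat \<Rightarrow> 'w \<Rightarrow> 'v) \<Rightarrow> 's list \<Rightarrow> 'v" where
  "stop_decision X w = X (length w) (SOME \<omega>. admissible X \<omega> \<and> tr \<omega> (length w) = w \<and> n_stages P \<omega> = length w)"

lemma alive_decision_eq:
  assumes X: "X \<in> policies P" and \<omega>: "admissible X \<omega>" and t: "t < n_stages P \<omega>"
  shows "X t \<omega> = alive_decision X (tr \<omega> t)"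
proof -
  let ?P = "\<lambda>\<omega>'. admissible X \<omega>' \<and> tr \<omega>' t = tr \<omega> t \<and> t < n_stages P \<omega>'"
  define \<omega>' where "\<omega>' = Eps ?P"
  have \<omega>': "?P \<omega>'" unfolding \<omega>'_def by (rule someI[of ?P \<omega>]) (use assms in simp)
  have "X t \<omega> = X t \<omega>'"
    by (rule policy_constant[OF X]) (use \<omega> \<omega>' t in \<open>auto simp: admissible_def alive_def\<close>)
  then show ?thesis by (simp add: alive_decision_def \<omega>'_def)
qed

lemma stop_decision_eq:
  assumes X: "X \<in> policies P" and \<omega>: "admissible X \<omega>" and t: "n_stages P \<omega> = t"
  shows "X t \<omega> = stop_decision X (tr \<omega> t)"
proof -
  let ?P = "\<lambda>\<omega>'. admissible X \<omega>' \<and> tr \<omega>' t = tr \<omega> t \<and> n_stages P \<omega>' = t"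
  define \<omega>' where "\<omega>' = Eps ?P"
  have \<omega>': "?P \<omega>'" unfolding \<omega>'_def by (rule someI[of ?P \<omega>]) (use assms in simp)
  have "X t \<omega> = X t \<omega>'"
    by (rule policy_constant[OF X]) (use \<omega> \<omega>' t in \<open>auto simp: admissible_def alive_def\<close>)
  then show ?thesis by (simp add: stop_decision_def \<omega>'_def)
qed

lemma exists_of_prob_pos:
  assumes "0 < \<P>(\<omega> in PS P. R \<omega>)" and "AE \<omega> in PS P. G \<omega>"
  shows "\<exists>\<omega>. R \<omega> \<and> G \<omega>"
proof (rule ccontr)
  assume n: "\<nexists>\<omega>. R \<omega> \<and> G \<omega>"
  \<comment> \<open>Positive measure already implies measurability, because \<open>measure\<close>
    is 0 on non-measurable sets.\<close>
  have "{\<omega>\<in>space (PS P). R \<omega>} \<in> events"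
    using assms(1) by (metis measure_notin_sets less_irrefl)
  moreover have "AE \<omega> in PS P. \<omega> \<notin> {\<omega>\<in>space (PS P). R \<omega>}"
    using assms(2) by eventually_elim (use n in auto)
  ultimately have "\<P>(\<omega> in PS P. R \<omega>) = 0" by (simp add: prob_eq_0)
  then show False using assms(1) by simp
qed

text \<open>The node \<open>z # w\<close> is reached alive with positive probability, hence by some
  admissible scenario. That one scenario realizes the decisions at \<open>w\<close> and at its
  successor simultaneously, which converts almost sure feasibility of the policy into feasibility
  along each edge of the tree.\<close>

lemma alive_node_witness:
  assumes X: "X \<in> policies P" and t: "Suc t < Tmax P" and w: "w \<in> nodes S t" and z: "z \<in> S (Suc t)"
  obtains \<omega> where "admissible X \<omega>" "tr \<omega> t = w" "noise P (Suc t) \<omega> = z" "Suc t < n_stages P \<omega>"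
    "X (Suc t) \<omega> = alive_decision X (z # w)" "X t \<omega> = alive_decision X w"
proof -
  have zw: "z # w \<in> nodes S (Suc t)" using w z by auto
  have "0 < \<P>(\<omega> in PS P. tr \<omega> (Suc t) = z # w \<and> Suc t < n_stages P \<omega>)"
    using prob_trail_alive[OF _ zw] node_prob_pos[OF _ zw] \<rho>_pos[OF t] t by simp
  from exists_of_prob_pos[OF this admissible_AE[OF X]] obtain \<omega>
    where \<omega>: "tr \<omega> (Suc t) = z # w" "Suc t < n_stages P \<omega>" "admissible X \<omega>" by blast
  show thesis
    using \<omega> alive_decision_eq[OF X \<omega>(3), of t] alive_decision_eq[OF X \<omega>(3), of "Suc t"] by (intro that) auto
qed

lemma stop_node_witness:
  assumes X: "X \<in> policies P" and t: "Suc t \<le> Tmax P" "1 \<le> t" and w: "w \<in> nodes S t" and z: "z \<in> S (Suc t)"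
  obtains \<omega> where "admissible X \<omega>" "tr \<omega> t = w" "noise P (Suc t) \<omega> = z" "n_stages P \<omega> = Suc t"
    "X (Suc t) \<omega> = stop_decision X (z # w)" "X t \<omega> = alive_decision X w"
proof -
  have zw: "z # w \<in> nodes S (Suc t)" using w z by auto
  have "0 < \<P>(\<omega> in PS P. tr \<omega> (Suc t) = z # w \<and> n_stages P \<omega> = Suc t)"
    using prob_trail_stop[OF _ zw] node_prob_pos[OF _ zw] \<tau>_pos[of "Suc t"] t by simp
  from exists_of_prob_pos[OF this admissible_AE[OF X]] obtain \<omega>
    where \<omega>: "tr \<omega> (Suc t) = z # w" "n_stages P \<omega> = Suc t" "admissible X \<omega>" by blast
  show thesis
    using \<omega> alive_decision_eq[OF X \<omega>(3), of t] stop_decision_eq[OF X \<omega>(3), of "Suc t"] by (intro that) auto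
qed

text \<open>In a given scenario only the node \<open>tr \<omega> t\<close> can contribute. Once the
  process has stopped before \<open>t\<close>, the left side is killed by the factor
  \<open>alive P (t - 1) \<omega>\<close> and both indicators vanish.\<close>

lemma policy_cost_eq_tree:
  assumes X: "X \<in> policies P" and \<omega>: "admissible X \<omega>" and t: "t \<in> {1..Tmax P}"
  defines "Y \<equiv> alive_decision X" and "Y0 \<equiv> stop_decision X"
  shows "ereal (alive P (t - 1) \<omega>) * cost P t (X t \<omega>) (X (t - 1) \<omega>) (noise P t \<omega>) =
    ereal (\<Sum>w\<in>nodes S t. 
       indicat_real {\<omega>\<in>space (PS P). tr \<omega> t = w \<and> t < n_stages P \<omega>} \<omega> * fr t (Y w) (Y (tl w)) (hd w)
       + indicat_real {\<omega>\<in>space (PS P). tr \<omega> t = w \<and> n_stages P \<omega> = t} \<omega> * fr t (Y0 w) (Y (tl w)) (hd w))"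
    (is "?L = ereal (\<Sum>w\<in>_. ?f w)")
proof -
  obtain t' where t': "t = Suc t'" using t by (cases t) auto
  have sp: "\<omega> \<in> space (PS P)" "2 \<le> n_stages P \<omega>" using \<omega> by (auto simp: admissible_def)
  have f0: "?f w = 0" if "w \<noteq> tr \<omega> t" for w using that by (auto simp: indicator_def)
  have sum: "(\<Sum>w\<in>nodes S t. ?f w) = ?f (tr \<omega> t)"
    using sum.mono_neutral_right[of "nodes S t" "{tr \<omega> t}" ?f] f0 admissible_tr[OF \<omega>, of t] t
      finite_nodes_S[of t] by auto
  consider "t < n_stages P \<omega>" | "n_stages P \<omega> = t" | "n_stages P \<omega> < t" by linarith
  then show ?thesis
  proof cases
    case 1
    then have "X t \<omega> = Y (tr \<omega> t)" "X (t - 1) \<omega> = Y (tl (tr \<omega> t))"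
      using alive_decision_eq[OF X \<omega>, of t] alive_decision_eq[OF X \<omega>, of t'] by (auto simp: Y_def t')
    then show ?thesis
      unfolding sum policy_cost_finite[OF X \<omega> t] using 1 sp by (simp add: alive_def t' del: One_nat_def)
  next
    case 2
    then have "X t \<omega> = Y0 (tr \<omega> t)" "X (t - 1) \<omega> = Y (tl (tr \<omega> t))"
      using stop_decision_eq[OF X \<omega>, of t] alive_decision_eq[OF X \<omega>, of t'] by (auto simp: Y_def Y0_def t')
    then show ?thesis
      unfolding sum policy_cost_finite[OF X \<omega> t] using 2 sp by (simp add: alive_def t' del: One_nat_def)
  next
    case 3
    then show ?thesis unfolding sum using sp by (auto simp: alive_def t' zero_ereal_def[symmetric])
  qed
qed

lemma expectation_policy:
  assumes X: "X \<in> policies P"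
  shows "ereal_expectation (PS P)
     (\<lambda>\<omega>. \<Sum>t=1..Tmax P. ereal (alive P (t - 1) \<omega>) * cost P t (X t \<omega>) (X (t - 1) \<omega>) (noise P t \<omega>)) =
     ereal (\<Sum>t=1..Tmax P. tree_cost (alive_decision X) (stop_decision X) t)"
proof -
  let ?Y = "alive_decision X" and ?Z = "stop_decision X"
  define A where "A = (\<lambda>t w. {\<omega>\<in>space (PS P). tr \<omega> t = w \<and> t < n_stages P \<omega>})"
  define B where "B = (\<lambda>t w. {\<omega>\<in>space (PS P). tr \<omega> t = w \<and> n_stages P \<omega> = t})"
  define g where "g = (\<lambda>\<omega>. \<Sum>t=1..Tmax P. \<Sum>w\<in>nodes S t. 
       indicat_real (A t w) \<omega> * fr t (?Y w) (?Y (tl w)) (hd w)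
       + indicat_real (B t w) \<omega> * fr t (?Z w) (?Y (tl w)) (hd w))"
  have trev: "{\<omega>\<in>space (PS P). tr \<omega> t = w} \<in> events" if "t \<in> {1..Tmax P}" for t w
    using noise_alg_event[of t w] indep_setD_ev1[OF noise_alive_indep] that by auto
  have ev: "A t w \<in> events" "B t w \<in> events" if "t \<in> {1..Tmax P}" for t w
    unfolding A_def B_def using trev[OF that, of w] by (auto intro!: sets.sets_Collect_conj)
  have int: "integrable (PS P) (indicat_real (A t w))" "integrable (PS P) (indicat_real (B t w))"
    if "t \<in> {1..Tmax P}" for t w
    using ev[OF that] by (auto simp: less_top[symmetric])
  have g: "integrable (PS P) g"
    unfolding g_def using int by (intro Bochner_Integration.integrable_sum Bochner_Integration.integrable_add integrable_mult_left) auto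
  have "ereal_expectation (PS P)
     (\<lambda>\<omega>. \<Sum>t=1..Tmax P. ereal (alive P (t - 1) \<omega>) * cost P t (X t \<omega>) (X (t - 1) \<omega>) (noise P t \<omega>)) =
     ereal (\<integral>\<omega>. g \<omega> \<partial>PS P)"
  proof (rule ereal_expectation_real[OF g])
    show "AE \<omega> in PS P. (\<Sum>t=1..Tmax P. ereal (alive P (t - 1) \<omega>) * cost P t (X t \<omega>) (X (t - 1) \<omega>) (noise P t \<omega>))
        = ereal (g \<omega>)"
      using admissible_AE[OF X]
    proof eventually_elim
      case (elim \<omega>)
      show ?case
        unfolding g_def A_def B_def
        by (rule trans[OF sum.cong[OF refl policy_cost_eq_tree[OF X elim]]]) simp_all
    qed
  qed
  also have "(\<integral>\<omega>. g \<omega> \<partial>PS P) = (\<Sum>t=1..Tmax P. \<Sum>w\<in>nodes S t. 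
       prob (A t w) * fr t (?Y w) (?Y (tl w)) (hd w) + prob (B t w) * fr t (?Z w) (?Y (tl w)) (hd w))"
    unfolding g_def using int ev
    by (subst Bochner_Integration.integral_sum, (auto intro!: Bochner_Integration.integrable_sum)[1],
        intro sum.cong refl, subst Bochner_Integration.integral_sum, auto intro!: sum.cong)
  also have "\<dots> = (\<Sum>t=1..Tmax P. tree_cost ?Y ?Z t)"
    unfolding tree_cost_def A_def B_def
    by (intro sum.cong refl) (simp add: prob_trail_alive prob_trail_stop algebra_simps)
  finally show ?thesis .
qed

section \<open>Telescoping along the tree\<close>

lemma tree_value_end: "tree_value Y (Tmax P) = 0"
  by (simp add: tree_value_def \<rho>_Tmax)

text \<open>The dynamic programming equation multiplied by \<open>\<rho> t\<close>: the products
  with \<open>1 - q\<close> and \<open>q\<close> are the absolute probabilities of surviving and of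
  stopping at \<open>Suc t\<close>.\<close>

lemma tree_value_Suc:
  assumes t: "1 \<le> t" "t < Tmax P" and Y: "\<And>w. w \<in> nodes S t \<Longrightarrow> Y w \<in> K w"
  shows "tree_value Y t = (\<Sum>w\<in>nodes S t. \<Sum>z\<in>S (Suc t). \<mu> w * p (Suc t) z *
      (\<rho> (Suc t) * v1 (Suc t) (Y w) z + \<tau> (Suc t) * v0 (Suc t) (Y w) z))"
  unfolding tree_value_def
proof (rule sum.cong[OF refl])
  fix w assume w: "w \<in> nodes S t"
  have q: "\<rho> t * q (Suc t) = \<tau> (Suc t)" "\<rho> t * (1 - q (Suc t)) = \<rho> (Suc t)"
    using stop_prob(1,2)[of "Suc t"] t by auto
  show "\<mu> w * \<rho> t * Qr (Suc t) (Y w) = (\<Sum>z\<in>S (Suc t). \<mu> w * p (Suc t) z *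
      (\<rho> (Suc t) * v1 (Suc t) (Y w) z + \<tau> (Suc t) * v0 (Suc t) (Y w) z))"
    unfolding Qr_eq[OF t w Y[OF w]] q[symmetric]
    by (simp add: sum_distrib_left sum.distrib[symmetric] algebra_simps)
qed

lemma tree_cost_Suc:
  assumes t: "1 \<le> t" "t < Tmax P"
  shows "tree_cost Y Y0 (Suc t) + tree_value Y (Suc t) = (\<Sum>w\<in>nodes S t. \<Sum>z\<in>S (Suc t). \<mu> w * p (Suc t) z *
      (\<rho> (Suc t) * (fr (Suc t) (Y (z # w)) (Y w) z + Qr (Suc (Suc t)) (Y (z # w)))
       + \<tau> (Suc t) * fr (Suc t) (Y0 (z # w)) (Y w) z))"
proof -
  have fin: "\<And>j. j \<in> {1..Suc t} \<Longrightarrow> finite (S j)" using t by (intro finite_S) auto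
  show ?thesis
    unfolding tree_cost_def tree_value_def sum.distrib[symmetric]
    by (subst sum_nodes_Suc, rule fin, assumption, intro sum.cong refl) (simp add: nodes_length algebra_simps)
qed

lemma tree_1:
  assumes "Y [] = x_init P"
  shows "tree_cost Y Y0 1 = fr 1 (Y [noise1 P]) (x_init P) (noise1 P)"
    "tree_value Y 1 = Qr 2 (Y [noise1 P])"
  using assms S_1 noise_prob_1 \<rho>_1 \<tau>_1 by (simp_all add: tree_cost_def tree_value_def numeral_2_eq_2)

lemma nodes_1: "nodes S (Suc 0) = {[noise1 P]}"
  using S_1 by simp

text \<open>Stage values are infima, so any feasible decisions give \<open>tree_value\<close> at
  \<open>t\<close> at most \<open>tree_cost\<close> plus \<open>tree_value\<close> at
  \<open>Suc t\<close>; summation leaves no remainder because \<open>tree_value\<close> vanishes at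
  the horizon.\<close>

lemma tree_telescope_lower:
  assumes Y: "\<And>t w. 1 \<le> t \<Longrightarrow> t < Tmax P \<Longrightarrow> w \<in> nodes S t \<Longrightarrow> Y w \<in> K w"
    and feas: "\<And>t w z. 1 \<le> t \<Longrightarrow> Suc t < Tmax P \<Longrightarrow> w \<in> nodes S t \<Longrightarrow> z \<in> S (Suc t) \<Longrightarrow> Y (z # w) \<in> feas P (Suc t) (Y w) z"
    and feas0: "\<And>t w z. 1 \<le> t \<Longrightarrow> Suc t \<le> Tmax P \<Longrightarrow> w \<in> nodes S t \<Longrightarrow> z \<in> S (Suc t) \<Longrightarrow> Y0 (z # w) \<in> feas P (Suc t) (Y w) z"
    and t: "1 \<le> t" "t \<le> Tmax P"
  shows "tree_value Y t \<le> (\<Sum>j\<in>{t<..Tmax P}. tree_cost Y Y0 j)"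
  using t(2,1)
proof (induction t rule: inc_induct)
  case base
  then show ?case by (simp add: tree_value_end)
next
  case (step t)
  have eq: "tree_value Y t = (\<Sum>w\<in>nodes S t. \<Sum>z\<in>S (Suc t). \<mu> w * p (Suc t) z *
      (\<rho> (Suc t) * v1 (Suc t) (Y w) z + \<tau> (Suc t) * v0 (Suc t) (Y w) z))"
    by (rule tree_value_Suc) (use step Y in auto)
  have "tree_value Y t \<le> tree_cost Y Y0 (Suc t) + tree_value Y (Suc t)"
    unfolding tree_cost_Suc[OF step.prems step.hyps(2)] eq
  proof (rule sum_mono, rule sum_mono, rule mult_left_mono, rule add_mono)
    fix w z assume w: "w \<in> nodes S t" and z: "z \<in> S (Suc t)"
    note YK = Y[OF step.prems step.hyps(2) w]
    note V = V_ereal[OF step.prems step.hyps(2) w z YK]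
    have zw: "z # w \<in> nodes S (Suc t)" using w z by auto
    show "0 \<le> \<mu> w * p (Suc t) z"
      using node_prob_pos[of t w] w step.hyps noise_prob_nonneg by (auto intro!: mult_nonneg_nonneg less_imp_le)
    show "\<rho> (Suc t) * v1 (Suc t) (Y w) z
        \<le> \<rho> (Suc t) * (fr (Suc t) (Y (z # w)) (Y w) z + Qr (Suc (Suc t)) (Y (z # w)))"
    proof (cases "Suc t = Tmax P")
      case True
      then show ?thesis by (simp add: \<rho>_Tmax)
    next
      case False
      then have f: "Y (z # w) \<in> feas P (Suc t) (Y w) z" using step w z by (intro feas) auto
      have "V1 (Suc t) (Y w) z \<le> cost P (Suc t) (Y (z # w)) (Y w) z + Q (Suc (Suc t)) (Y (z # w))"
        unfolding stage_value_def by (rule INF_lower) (use f in simp)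
      moreover have "cost P (Suc t) (Y (z # w)) (Y w) z = ereal (fr (Suc t) (Y (z # w)) (Y w) z)"
        using cost_finite[OF step.hyps(2) w z YK f] by (simp add: fr_def ereal_real)
      moreover have "Q (Suc (Suc t)) (Y (z # w)) = ereal (Qr (Suc (Suc t)) (Y (z # w)))"
        using zw Y[OF _ _ zw] step False by (intro Q_ereal[of "Suc t" "z # w"]) auto
      ultimately have "v1 (Suc t) (Y w) z \<le> fr (Suc t) (Y (z # w)) (Y w) z + Qr (Suc (Suc t)) (Y (z # w))"
        by (simp add: V)
      then show ?thesis by (intro mult_left_mono \<rho>_nonneg)
    qed
    have f: "Y0 (z # w) \<in> feas P (Suc t) (Y w) z" using step w z by (intro feas0) auto
    have "V0 (Suc t) (Y w) z \<le> cost P (Suc t) (Y0 (z # w)) (Y w) z + 0"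
      unfolding stage_value_def by (rule INF_lower) (use f in simp)
    moreover have "cost P (Suc t) (Y0 (z # w)) (Y w) z = ereal (fr (Suc t) (Y0 (z # w)) (Y w) z)"
      using cost_finite[OF step.hyps(2) w z YK f] by (simp add: fr_def ereal_real)
    ultimately have "v0 (Suc t) (Y w) z \<le> fr (Suc t) (Y0 (z # w)) (Y w) z"
      by (simp add: V)
    then show "\<tau> (Suc t) * v0 (Suc t) (Y w) z \<le> \<tau> (Suc t) * fr (Suc t) (Y0 (z # w)) (Y w) z"
      by (intro mult_left_mono \<tau>_nonneg)
  qed
  also have "\<dots> \<le> tree_cost Y Y0 (Suc t) + (\<Sum>j\<in>{Suc t<..Tmax P}. tree_cost Y Y0 j)"
    using step by simp
  also have "\<dots> = (\<Sum>j\<in>{t<..Tmax P}. tree_cost Y Y0 j)"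
  proof -
    have "{t<..Tmax P} = insert (Suc t) {Suc t<..Tmax P}" using step.hyps by auto
    then show ?thesis by simp
  qed
  finally show ?case .
qed

lemma alive_decision_in_K:
  assumes X: "X \<in> policies P" and t: "1 \<le> t" "t < Tmax P" and w: "w \<in> nodes S t"
  shows "alive_decision X w \<in> K w"
proof -
  obtain t' where t': "t = Suc t'" using t by (cases t) auto
  then obtain z v where zv: "w = z # v" "z \<in> S (Suc t')" "v \<in> nodes S t'" using w by auto
  obtain \<omega> where \<omega>: "admissible X \<omega>" "tr \<omega> t' = v" "noise P (Suc t') \<omega> = z" "Suc t' < n_stages P \<omega>"
    "X (Suc t') \<omega> = alive_decision X (z # v)"
    using alive_node_witness[OF X _ zv(3,2)] t t' by blast
  then show ?thesis using policy_in_K[OF X \<omega>(1), of t] t t' zv by auto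
qed

lemma alive_decision_Nil: "X \<in> policies P \<Longrightarrow> alive_decision X [] = x_init P"
  by (simp add: alive_decision_def policies_def)

lemma alive_decision_feas_1:
  assumes X: "X \<in> policies P"
  shows "alive_decision X [noise1 P] \<in> feas P 1 (x_init P) (noise1 P)"
proof -
  obtain \<omega> where \<omega>: "admissible X \<omega>" "noise P (Suc 0) \<omega> = noise1 P"
    "X (Suc 0) \<omega> = alive_decision X [noise1 P]" "X 0 \<omega> = alive_decision X []"
    using alive_node_witness[OF X, of 0 "[]" "noise1 P"] Tmax_ge2 S_1 by auto
  then show ?thesis
    using admissible_Suc[OF \<omega>(1), of 0] Tmax_ge2 alive_decision_Nil[OF X] by auto
qed

lemma first_stage_finite:
  assumes u: "u \<in> feas P 1 (x_init P) (noise1 P)"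
  shows "u \<in> K [noise1 P]"
    "cost P 1 u (x_init P) (noise1 P) = ereal (fr 1 u (x_init P) (noise1 P))" "Q 2 u = ereal (Qr 2 u)"
proof -
  show uK: "u \<in> K [noise1 P]"
    using feas_sub_K[of 0 "[]" "noise1 P" "x_init P"] u Tmax_ge2 S_1 K_Nil by auto
  have "\<bar>cost P (Suc 0) u (x_init P) (noise1 P)\<bar> \<noteq> \<infinity>"
    by (rule cost_finite[of 0 "[]"]) (use u Tmax_ge2 S_1 K_Nil in auto)
  then show "cost P 1 u (x_init P) (noise1 P) = ereal (fr 1 u (x_init P) (noise1 P))"
    by (simp add: fr_def ereal_real)
  show "Q 2 u = ereal (Qr 2 u)"
    using Q_ereal[of 1 "[noise1 P]" u] uK nodes_1 Tmax_ge2 by (simp add: numeral_2_eq_2)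
qed

lemma optimal_value_ge:
  "(INF u\<in>feas P 1 (x_init P) (noise1 P). cost P 1 u (x_init P) (noise1 P) + Q 2 u) \<le> optimal_value P"
  unfolding optimal_value_def
proof (rule INF_greatest)
  fix X assume X: "X \<in> policies P"
  let ?Y = "alive_decision X" and ?Z = "stop_decision X"
  note u = alive_decision_feas_1[OF X]
  have "tree_value ?Y 1 \<le> (\<Sum>j\<in>{1<..Tmax P}. tree_cost ?Y ?Z j)"
  proof (rule tree_telescope_lower)
    fix t w z assume *: "1 \<le> t" "w \<in> nodes S t" "z \<in> S (Suc t)"
    {
      assume t: "Suc t < Tmax P"
      show "?Y (z # w) \<in> feas P (Suc t) (?Y w) z"
        using alive_node_witness[OF X t *(2,3)] admissible_Suc[of X _ t] t by (metis less_imp_le)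
    }
    assume t: "Suc t \<le> Tmax P"
    show "?Z (z # w) \<in> feas P (Suc t) (?Y w) z"
      using stop_node_witness[OF X t *] admissible_Suc[of X _ t] t by metis
  qed (use alive_decision_in_K[OF X] Tmax_ge2 in auto)
  then have "tree_cost ?Y ?Z 1 + tree_value ?Y 1 \<le> (\<Sum>t=1..Tmax P. tree_cost ?Y ?Z t)"
    using Tmax_ge2 by (subst sum.atLeast_Suc_atMost) (auto simp: atLeastSucAtMost_greaterThanAtMost)
  then have "ereal (fr 1 (?Y [noise1 P]) (x_init P) (noise1 P) + Qr 2 (?Y [noise1 P])) \<le>
      ereal (\<Sum>t=1..Tmax P. tree_cost ?Y ?Z t)"
    using tree_1(1)[of ?Y ?Z] tree_1(2)[of ?Y] alive_decision_Nil[OF X] by (simp only: ereal_less_eq)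
  moreover have "(INF u\<in>feas P 1 (x_init P) (noise1 P). cost P 1 u (x_init P) (noise1 P) + Q 2 u) \<le>
     cost P 1 (?Y [noise1 P]) (x_init P) (noise1 P) + Q 2 (?Y [noise1 P])"
    by (rule INF_lower) (rule u)
  ultimately show "(INF u\<in>feas P 1 (x_init P) (noise1 P). cost P 1 u (x_init P) (noise1 P) + Q 2 u) \<le>
     ereal_expectation (PS P)
     (\<lambda>\<omega>. \<Sum>t=1..Tmax P. ereal (alive P (t - 1) \<omega>) * cost P t (X t \<omega>) (X (t - 1) \<omega>) (noise P t \<omega>))"
    unfolding expectation_policy[OF X] first_stage_finite[OF u] plus_ereal.simps by (rule order_trans[rotated])
qed

lemma sum_node_prob: "t \<le> Tmax P \<Longrightarrow> (\<Sum>w\<in>nodes S t. \<mu> w) = 1"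
proof (induction t)
  case (Suc t)
  have fin: "\<And>j. j \<in> {1..Suc t} \<Longrightarrow> finite (S j)" using Suc.prems by (intro finite_S) auto
  have "(\<Sum>w\<in>nodes S (Suc t). \<mu> w) = (\<Sum>w\<in>nodes S t. \<Sum>z\<in>S (Suc t). p (Suc t) z * \<mu> w)"
    by (subst sum_nodes_Suc, rule fin, assumption, intro sum.cong refl) (simp add: nodes_length)
  also have "\<dots> = (\<Sum>w\<in>nodes S t. \<mu> w)"
    using sum_noise_prob[of "Suc t"] Suc.prems by (simp add: sum_distrib_right[symmetric])
  finally show ?case using Suc by simp
qed simp

text \<open>Decisions that are \<open>e\<close>-optimal at each node lose at most \<open>e\<close>
  per stage, since the nodes of a stage have total weight at most 1; this gives the factor
  \<open>Tmax P - t\<close>.\<close>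

lemma tree_telescope_upper:
  assumes Y: "\<And>t w. 1 \<le> t \<Longrightarrow> t < Tmax P \<Longrightarrow> w \<in> nodes S t \<Longrightarrow> Y w \<in> K w"
    and opt: "\<And>t w z. 1 \<le> t \<Longrightarrow> Suc t < Tmax P \<Longrightarrow> w \<in> nodes S t \<Longrightarrow> z \<in> S (Suc t) \<Longrightarrow>
        fr (Suc t) (Y (z # w)) (Y w) z + Qr (Suc (Suc t)) (Y (z # w)) \<le> v1 (Suc t) (Y w) z + e"
    and opt0: "\<And>t w z. 1 \<le> t \<Longrightarrow> Suc t \<le> Tmax P \<Longrightarrow> w \<in> nodes S t \<Longrightarrow> z \<in> S (Suc t) \<Longrightarrow>
        fr (Suc t) (Y0 (z # w)) (Y w) z \<le> v0 (Suc t) (Y w) z + e"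
    and e: "0 \<le> e" and t: "1 \<le> t" "t \<le> Tmax P"
  shows "(\<Sum>j\<in>{t<..Tmax P}. tree_cost Y Y0 j) \<le> tree_value Y t + real (Tmax P - t) * e"
  using t(2,1)
proof (induction t rule: inc_induct)
  case base
  then show ?case by (simp add: tree_value_end)
next
  case (step t)
  have eq: "tree_value Y t = (\<Sum>w\<in>nodes S t. \<Sum>z\<in>S (Suc t). \<mu> w * p (Suc t) z *
      (\<rho> (Suc t) * v1 (Suc t) (Y w) z + \<tau> (Suc t) * v0 (Suc t) (Y w) z))"
    by (rule tree_value_Suc) (use step Y in auto)
  have sum1: "\<tau> (Suc t) + \<rho> (Suc t) \<le> 1"
    using \<rho>_split[of t] prob_le_1[of "{\<omega>\<in>space (PS P). t < n_stages P \<omega>}"] unfolding \<rho>_def by linarith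
  have nn: "0 \<le> \<mu> w * p (Suc t) z" if "w \<in> nodes S t" for w z
    using node_prob_pos[of t w] that step.hyps noise_prob_nonneg by (auto intro!: mult_nonneg_nonneg less_imp_le)
  have "tree_cost Y Y0 (Suc t) + tree_value Y (Suc t) \<le> (\<Sum>w\<in>nodes S t. \<Sum>z\<in>S (Suc t). \<mu> w * p (Suc t) z *
      (\<rho> (Suc t) * (v1 (Suc t) (Y w) z + e) + \<tau> (Suc t) * (v0 (Suc t) (Y w) z + e)))"
    unfolding tree_cost_Suc[OF step.prems step.hyps(2)]
  proof (rule sum_mono, rule sum_mono, rule mult_left_mono, rule add_mono)
    fix w z assume w: "w \<in> nodes S t" and z: "z \<in> S (Suc t)"
    show "0 \<le> \<mu> w * p (Suc t) z" using nn[OF w] .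
    show "\<rho> (Suc t) * (fr (Suc t) (Y (z # w)) (Y w) z + Qr (Suc (Suc t)) (Y (z # w)))
        \<le> \<rho> (Suc t) * (v1 (Suc t) (Y w) z + e)"
    proof (cases "Suc t = Tmax P")
      case True
      then show ?thesis by (simp add: \<rho>_Tmax)
    next
      case False
      then show ?thesis using step w z by (intro mult_left_mono \<rho>_nonneg opt) auto
    qed
    show "\<tau> (Suc t) * fr (Suc t) (Y0 (z # w)) (Y w) z \<le> \<tau> (Suc t) * (v0 (Suc t) (Y w) z + e)"
      using step w z by (intro mult_left_mono \<tau>_nonneg opt0) auto
  qed
  also have "\<dots> = tree_value Y t + (\<Sum>w\<in>nodes S t. \<Sum>z\<in>S (Suc t). \<mu> w * p (Suc t) z * ((\<tau> (Suc t) + \<rho> (Suc t)) * e))"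
    unfolding eq sum.distrib[symmetric] by (intro sum.cong refl) (simp add: algebra_simps)
  also have "\<dots> \<le> tree_value Y t + (\<Sum>w\<in>nodes S t. \<Sum>z\<in>S (Suc t). \<mu> w * p (Suc t) z * e)"
  proof (rule add_left_mono, rule sum_mono, rule sum_mono, rule mult_left_mono)
    show "(\<tau> (Suc t) + \<rho> (Suc t)) * e \<le> e"
      using mult_right_mono[OF sum1 e] by simp
  qed (rule nn)
  also have "(\<Sum>w\<in>nodes S t. \<Sum>z\<in>S (Suc t). \<mu> w * p (Suc t) z * e) = (\<Sum>w\<in>nodes S t. \<mu> w * (\<Sum>z\<in>S (Suc t). p (Suc t) z) * e)"
    by (simp add: sum_distrib_left sum_distrib_right)
  also have "\<dots> = (\<Sum>w\<in>nodes S t. \<mu> w) * e"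
    using sum_noise_prob[of "Suc t"] step.hyps by (simp add: sum_distrib_right)
  also have "\<dots> = e" using sum_node_prob[of t] step.hyps by simp
  finally have one: "tree_cost Y Y0 (Suc t) + tree_value Y (Suc t) \<le> tree_value Y t + e" .
  have "{t<..Tmax P} = insert (Suc t) {Suc t<..Tmax P}" using step.hyps by auto
  then have "(\<Sum>j\<in>{t<..Tmax P}. tree_cost Y Y0 j) = tree_cost Y Y0 (Suc t) + (\<Sum>j\<in>{Suc t<..Tmax P}. tree_cost Y Y0 j)"
    by simp
  also have "\<dots> \<le> tree_cost Y Y0 (Suc t) + (tree_value Y (Suc t) + real (Tmax P - Suc t) * e)"
    using step by simp
  also have "\<dots> \<le> tree_value Y t + e + real (Tmax P - Suc t) * e" using one by simp
  also have "\<dots> = tree_value Y t + real (Tmax P - t) * e"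
    using step.hyps by (simp add: of_nat_diff algebra_simps)
  finally show ?case .
qed

section \<open>Policies that are nearly optimal at every node\<close>

definition near_opt :: "real \<Rightarrow> nat \<Rightarrow> bool \<Rightarrow> 'v \<Rightarrow> 's \<Rightarrow> 'v" where
  "near_opt e t a y z = (SOME x. x \<in> feas P t y z \<and>
     cost P t x y z + (if a then Q (Suc t) x else 0) \<le> (if a then V1 t y z else V0 t y z) + ereal e)"

text \<open>Nothing is known about \<open>near_opt\<close> as a function of \<open>y\<close>. The
  value 0 outside the finite support makes the policy finite-valued everywhere, not just almost
  everywhere, which is what its measurability rests on.\<close>

primrec near_policy :: "'v \<Rightarrow> real \<Rightarrow> nat \<Rightarrow> 'w \<Rightarrow> 'v" where
  "near_policy u e 0 \<omega> = x_init P"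
| "near_policy u e (Suc t) \<omega> = (if noise P (Suc t) \<omega> \<notin> S (Suc t) then 0 else if t = 0 then u
     else near_opt e (Suc t) (Suc t < n_stages P \<omega>) (near_policy u e t \<omega>) (noise P (Suc t) \<omega>))"

lemma near_opt:
  assumes t: "1 \<le> t" "t < Tmax P" and w: "w \<in> nodes S t" and z: "z \<in> S (Suc t)" and y: "y \<in> K w" and e: "e > 0"
  shows "near_opt e (Suc t) a y z \<in> feas P (Suc t) y z"
    "cost P (Suc t) (near_opt e (Suc t) a y z) y z + (if a then Q (Suc (Suc t)) (near_opt e (Suc t) a y z) else 0)
      \<le> (if a then V1 (Suc t) y z else V0 (Suc t) y z) + ereal e"
proof -
  have "(if a then V1 (Suc t) y z else V0 (Suc t) y z) < (if a then V1 (Suc t) y z else V0 (Suc t) y z) + ereal e"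
    using V_finite[OF t w z y] e by (cases "V1 (Suc t) y z"; cases "V0 (Suc t) y z") auto
  moreover have "(if a then V1 (Suc t) y z else V0 (Suc t) y z) =
      (INF x\<in>feas P (Suc t) y z. cost P (Suc t) x y z + (if a then Q (Suc (Suc t)) x else 0))"
    by (simp add: stage_value_def)
  ultimately have "\<exists>x\<in>feas P (Suc t) y z. cost P (Suc t) x y z + (if a then Q (Suc (Suc t)) x else 0) <
      (if a then V1 (Suc t) y z else V0 (Suc t) y z) + ereal e"
    by (simp only: INF_less_iff)
  then have "\<exists>x. x \<in> feas P (Suc t) y z \<and> cost P (Suc t) x y z + (if a then Q (Suc (Suc t)) x else 0) \<le>
      (if a then V1 (Suc t) y z else V0 (Suc t) y z) + ereal e"
    by (blast intro: less_imp_le)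
  from someI_ex[OF this]
  show "near_opt e (Suc t) a y z \<in> feas P (Suc t) y z"
    "cost P (Suc t) (near_opt e (Suc t) a y z) y z + (if a then Q (Suc (Suc t)) (near_opt e (Suc t) a y z) else 0)
      \<le> (if a then V1 (Suc t) y z else V0 (Suc t) y z) + ereal e"
    unfolding near_opt_def[symmetric] by blast+
qed

lemma near_policy_feas:
  assumes u: "u \<in> feas P 1 (x_init P) (noise1 P)" and e: "e > 0"
    and \<omega>: "\<forall>t\<in>{1..Tmax P}. noise P t \<omega> \<in> S t" and t: "t \<le> Tmax P"
  shows "near_policy u e t \<omega> \<in> K (tr \<omega> t) \<and>
    (1 \<le> t \<longrightarrow> near_policy u e t \<omega> \<in> feas P t (near_policy u e (t - 1) \<omega>) (noise P t \<omega>))"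
  using t
proof (induction t)
  case 0
  then show ?case by (simp add: K_Nil)
next
  case (Suc t)
  have node: "tr \<omega> t \<in> nodes S t" using \<omega> Suc.prems by (intro trail_in_nodes) auto
  have z: "noise P (Suc t) \<omega> \<in> S (Suc t)" using \<omega> Suc.prems by auto
  have yK: "near_policy u e t \<omega> \<in> K (tr \<omega> t)" using Suc by simp
  have f: "near_policy u e (Suc t) \<omega> \<in> feas P (Suc t) (near_policy u e t \<omega>) (noise P (Suc t) \<omega>)"
  proof (cases "t = 0")
    case True
    then show ?thesis using u z S_1 by auto
  next
    case False
    then show ?thesis using near_opt(1)[OF _ _ node z yK e] Suc.prems z by auto
  qed
  then show ?case using feas_sub_K[OF _ node z yK] Suc.prems by (auto simp del: near_policy.simps)
qed

lemma noise_filtr: "j \<in> {1..t} \<Longrightarrow> noise P j \<in> borel_measurable (filtr P t)"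
  and alive_filtr: "j \<in> {1..t} \<Longrightarrow> alive P j \<in> borel_measurable (filtr P t)"
proof -
  assume j: "j \<in> {1..t}"
  have *: "(\<lambda>\<omega>. (noise P j \<omega>, alive P j \<omega>)) \<in> borel_measurable (filtr P t)"
    unfolding filtr_def using sigma_gen_by_component[OF j, of "\<lambda>j \<omega>. (noise P j \<omega>, alive P j \<omega>)"] by simp
  have "fst \<circ> (\<lambda>\<omega>. (noise P j \<omega>, alive P j \<omega>)) \<in> borel_measurable (filtr P t)"
    by (rule measurable_comp[OF *]) (intro borel_measurable_continuous_onI continuous_intros)
  then show "noise P j \<in> borel_measurable (filtr P t)" by (simp add: o_def)
  have "snd \<circ> (\<lambda>\<omega>. (noise P j \<omega>, alive P j \<omega>)) \<in> borel_measurable (filtr P t)"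
    by (rule measurable_comp[OF *]) (intro borel_measurable_continuous_onI continuous_intros)
  then show "alive P j \<in> borel_measurable (filtr P t)" by (simp add: o_def)
qed

lemma space_filtr: "space (filtr P t) = space (PS P)"
  by (simp add: filtr_def sigma_gen_by_def)

text \<open>Mere Borel measurability would not survive composition with the arbitrary selection
  \<open>near_opt\<close>. A finite range with the discrete algebra does, since every function on it
  is measurable.\<close>

lemma near_policy_measurable:
  assumes t: "t \<le> Tmax P"
  shows "\<exists>R. finite R \<and> near_policy u e t \<in> filtr P t \<rightarrow>\<^sub>M count_space R"
  using t
proof (induction t)
  case 0
  then show ?case by (intro exI[of _ "{x_init P}"]) simp
next
  case (Suc t)
  then obtain R where R: "finite R" "near_policy u e t \<in> filtr P t \<rightarrow>\<^sub>M count_space R" by auto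
  let ?F = "filtr P (Suc t)"
  have "sets (filtr P t) \<subseteq> sets ?F" unfolding filtr_def by (rule sets_sigma_gen_by_mono) auto
  then have m1: "near_policy u e t \<in> ?F \<rightarrow>\<^sub>M count_space R"
    using R(2) unfolding measurable_def by (auto simp: space_filtr)
  \<comment> \<open>The noise with all values off the support merged into \<open>None\<close>, a
    variable of finite range.\<close>
  define zo where "zo = (\<lambda>\<omega>. if noise P (Suc t) \<omega> \<in> S (Suc t) then Some (noise P (Suc t) \<omega>) else None)"
  define SO where "SO = insert None (Some ` S (Suc t))"
  have finS: "finite (S (Suc t))" using Suc.prems by (intro finite_S) auto
  then have finSO: "finite SO" by (simp add: SO_def)
  note [measurable] = noise_filtr[of "Suc t" "Suc t", simplified] alive_filtr[of "Suc t" "Suc t", simplified]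
  have m2: "zo \<in> ?F \<rightarrow>\<^sub>M count_space SO"
  proof (subst measurable_count_space_eq2[OF finSO], intro conjI ballI)
    show "zo \<in> space ?F \<rightarrow> SO" by (auto simp: zo_def SO_def)
    fix a assume "a \<in> SO"
    then consider "a = None" | z where "z \<in> S (Suc t)" "a = Some z" by (auto simp: SO_def)
    then show "zo -` {a} \<inter> space ?F \<in> sets ?F"
    proof cases
      case 1
      have "{\<omega>\<in>space ?F. noise P (Suc t) \<omega> \<in> - S (Suc t)} \<in> sets ?F"
        using measurable_sets[OF noise_filtr[of "Suc t" "Suc t"], of "- S (Suc t)"] finS
        by (simp add: finite_imp_closed borel_open vimage_def Int_def conj_commute)
      moreover have "zo -` {a} \<inter> space ?F = {\<omega>\<in>space ?F. noise P (Suc t) \<omega> \<in> - S (Suc t)}"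
        using 1 by (auto simp: zo_def)
      ultimately show ?thesis by simp
    next
      case 2
      have "{\<omega>\<in>space ?F. noise P (Suc t) \<omega> = z} \<in> sets ?F" by measurable
      moreover have "zo -` {a} \<inter> space ?F = {\<omega>\<in>space ?F. noise P (Suc t) \<omega> = z}"
        using 2 by (auto simp: zo_def split: if_splits)
      ultimately show ?thesis by simp
    qed
  qed
  define ao where "ao = (\<lambda>\<omega>. Suc t < n_stages P \<omega>)"
  \<comment> \<open>The filtration sees \<open>alive\<close>, not \<open>n_stages\<close>; hence the
    rewriting.\<close>
  have ao: "ao = (\<lambda>\<omega>. alive P (Suc t) \<omega> = 1)" by (auto simp: ao_def alive_def fun_eq_iff)
  have m3: "ao \<in> ?F \<rightarrow>\<^sub>M count_space UNIV" unfolding ao by measurable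
  define h where "h = (\<lambda>y a z. case z of None \<Rightarrow> 0 | Some z \<Rightarrow> if t = 0 then u else near_opt e (Suc t) a y z)"
  define R' where "R' = (\<lambda>(y, a, z). h y a z) ` (R \<times> UNIV \<times> SO)"
  have h: "near_policy u e (Suc t) \<omega> = h (near_policy u e t \<omega>) (ao \<omega>) (zo \<omega>)" for \<omega>
    by (simp add: h_def ao_def zo_def)
  have "(\<lambda>\<omega>. h (near_policy u e t \<omega>) (ao \<omega>) (zo \<omega>)) \<in> ?F \<rightarrow>\<^sub>M count_space R'"
  proof (rule measurable_compose_countable'[OF _ m1])
    fix y assume y: "y \<in> R"
    show "(\<lambda>\<omega>. h y (ao \<omega>) (zo \<omega>)) \<in> ?F \<rightarrow>\<^sub>M count_space R'"
    proof (rule measurable_compose_countable'[OF _ m3])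
      fix a :: bool
      show "(\<lambda>\<omega>. h y a (zo \<omega>)) \<in> ?F \<rightarrow>\<^sub>M count_space R'"
      proof (rule measurable_compose_countable'[OF _ m2])
        fix b assume b: "b \<in> SO"
        have "h y a b \<in> R'" unfolding R'_def using y b by (intro image_eqI[of _ _ "(y, a, b)"]) auto
        then show "(\<lambda>\<omega>. h y a b) \<in> ?F \<rightarrow>\<^sub>M count_space R'" by simp
      qed (use finSO in \<open>simp add: countable_finite\<close>)
    qed simp
  qed (use R in \<open>simp add: countable_finite\<close>)
  then have "near_policy u e (Suc t) \<in> ?F \<rightarrow>\<^sub>M count_space R'"
    by (simp only: h[symmetric])
  moreover have "finite R'" using R finSO by (simp add: R'_def)
  ultimately show ?case by blast
qed

lemma near_policy_in_policies:
  assumes u: "u \<in> feas P 1 (x_init P) (noise1 P)" and e: "e > 0"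
  shows "near_policy u e \<in> policies P"
  unfolding policies_def
proof (intro CollectI conjI ballI allI)
  fix t assume t: "t \<in> {1..Tmax P}"
  obtain R where R: "finite R" "near_policy u e t \<in> filtr P t \<rightarrow>\<^sub>M count_space R"
    using near_policy_measurable[of t u e] t by auto
  have "near_policy u e t \<in> filtr P t \<rightarrow>\<^sub>M count_space UNIV"
    using measurable_compose[OF R(2), of "\<lambda>x. x" "count_space UNIV"] by simp
  from measurable_compose[OF this, of "\<lambda>x. x" borel]
  show "near_policy u e t \<in> borel_measurable (filtr P t)" by simp
  show "AE \<omega> in PS P. near_policy u e t \<omega> \<in> feas P t (near_policy u e (t - 1) \<omega>) (noise P t \<omega>)"
    using noise_AE by eventually_elim (use near_policy_feas[OF u e] t in auto)
qed simp

lemma optimal_value_le: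
  assumes u: "u \<in> feas P 1 (x_init P) (noise1 P)" and e: "e > 0"
  shows "optimal_value P \<le> cost P 1 u (x_init P) (noise1 P) + Q 2 u + ereal e"
proof -
  \<comment> \<open>The loss \<open>e'\<close> is incurred at the \<open>Tmax P - 1\<close> stages
    after the first, where the decision \<open>u\<close> is prescribed.\<close>
  define e' where "e' = e / real (Tmax P)"
  have e': "e' > 0" using e Tmax_ge2 by (simp add: e'_def)
  define X where "X = near_policy u e'"
  let ?Y = "alive_decision X" and ?Z = "stop_decision X"
  have X: "X \<in> policies P" unfolding X_def by (rule near_policy_in_policies[OF u e'])
  have Y1: "?Y [noise1 P] = u"
  proof -
    obtain \<omega> where \<omega>: "noise P (Suc 0) \<omega> = noise1 P" "X (Suc 0) \<omega> = alive_decision X [noise1 P]"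
      using alive_node_witness[OF X, of 0 "[]" "noise1 P"] Tmax_ge2 S_1 by auto
    then show ?thesis using S_1 by (simp add: X_def)
  qed
  have Xopt: "X (Suc t) \<omega> = near_opt e' (Suc t) (Suc t < n_stages P \<omega>) (X t \<omega>) (noise P (Suc t) \<omega>)"
    if "1 \<le> t" "noise P (Suc t) \<omega> \<in> S (Suc t)" for t \<omega>
    using that by (simp add: X_def)
  have "(\<Sum>j\<in>{1<..Tmax P}. tree_cost ?Y ?Z j) \<le> tree_value ?Y 1 + real (Tmax P - 1) * e'"
  proof (rule tree_telescope_upper)
    fix t w z assume t: "1 \<le> t" and w: "w \<in> nodes S t" and z: "z \<in> S (Suc t)"
    have YK: "?Y w \<in> K w" if "t < Tmax P" using alive_decision_in_K[OF X t that w] .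
    {
      assume tT: "Suc t < Tmax P"
      then have tT': "t < Tmax P" by simp
      obtain \<omega> where \<omega>: "noise P (Suc t) \<omega> = z" "Suc t < n_stages P \<omega>"
        "X (Suc t) \<omega> = ?Y (z # w)" "X t \<omega> = ?Y w"
        using alive_node_witness[OF X tT w z] by blast
      have eq: "?Y (z # w) = near_opt e' (Suc t) True (?Y w) z"
        using Xopt[OF t, of \<omega>] \<omega> z by simp
      note no = near_opt[OF t tT' w z YK[OF tT'] e', of True, folded eq]
      have c: "cost P (Suc t) (?Y (z # w)) (?Y w) z = ereal (fr (Suc t) (?Y (z # w)) (?Y w) z)"
        using cost_finite[OF tT' w z YK[OF tT'] no(1)] by (simp add: fr_def ereal_real)
      have zw: "z # w \<in> nodes S (Suc t)" using w z by auto
      have "Q (Suc (Suc t)) (?Y (z # w)) = ereal (Qr (Suc (Suc t)) (?Y (z # w)))"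
        using alive_decision_in_K[OF X _ tT zw] zw tT by (intro Q_ereal[of "Suc t" "z # w"]) auto
      then show "fr (Suc t) (?Y (z # w)) (?Y w) z + Qr (Suc (Suc t)) (?Y (z # w)) \<le> v1 (Suc t) (?Y w) z + e'"
        using no(2) by (simp add: c V_ereal[OF t tT' w z YK[OF tT']])
    }
    assume tT: "Suc t \<le> Tmax P"
    then have tT': "t < Tmax P" by simp
    obtain \<omega> where \<omega>: "noise P (Suc t) \<omega> = z" "n_stages P \<omega> = Suc t"
      "X (Suc t) \<omega> = ?Z (z # w)" "X t \<omega> = ?Y w"
      using stop_node_witness[OF X tT t w z] by blast
    have eq: "?Z (z # w) = near_opt e' (Suc t) False (?Y w) z"
      using Xopt[OF t, of \<omega>] \<omega> z by simp
    note no = near_opt[OF t tT' w z YK[OF tT'] e', of False, folded eq]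
    have c: "cost P (Suc t) (?Z (z # w)) (?Y w) z = ereal (fr (Suc t) (?Z (z # w)) (?Y w) z)"
      using cost_finite[OF tT' w z YK[OF tT'] no(1)] by (simp add: fr_def ereal_real)
    show "fr (Suc t) (?Z (z # w)) (?Y w) z \<le> v0 (Suc t) (?Y w) z + e'"
      using no(2) by (simp add: c V_ereal[OF t tT' w z YK[OF tT']])
  qed (use alive_decision_in_K[OF X] Tmax_ge2 e' in auto)
  also have "real (Tmax P - 1) * e' \<le> real (Tmax P) * e'"
    using e' by (intro mult_right_mono) auto
  also have "\<dots> = e" using Tmax_ge2 by (simp add: e'_def)
  finally have "(\<Sum>j\<in>{1<..Tmax P}. tree_cost ?Y ?Z j) \<le> tree_value ?Y 1 + e" by simp
  then have "(\<Sum>t=1..Tmax P. tree_cost ?Y ?Z t) \<le> tree_cost ?Y ?Z 1 + tree_value ?Y 1 + e"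
    using Tmax_ge2 by (subst sum.atLeast_Suc_atMost) (auto simp: atLeastSucAtMost_greaterThanAtMost)
  also have "\<dots> = fr 1 u (x_init P) (noise1 P) + Qr 2 u + e"
    unfolding tree_1(1)[of ?Y ?Z, OF alive_decision_Nil[OF X]] tree_1(2)[of ?Y, OF alive_decision_Nil[OF X]] Y1 ..
  finally have "ereal (\<Sum>t=1..Tmax P. tree_cost ?Y ?Z t) \<le> cost P 1 u (x_init P) (noise1 P) + Q 2 u + ereal e"
    unfolding first_stage_finite[OF u] by simp
  moreover have "optimal_value P \<le> ereal (\<Sum>t=1..Tmax P. tree_cost ?Y ?Z t)"
    unfolding optimal_value_def expectation_policy[OF X, symmetric] by (rule INF_lower[OF X])
  ultimately show ?thesis by (rule order_trans[rotated])
qed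

lemma optimal_value_eq:
  "optimal_value P = (INF u\<in>feas P 1 (x_init P) (noise1 P). cost P 1 u (x_init P) (noise1 P) + Q 2 u)"
proof (rule antisym)
  show "optimal_value P \<le> (INF u\<in>feas P 1 (x_init P) (noise1 P). cost P 1 u (x_init P) (noise1 P) + Q 2 u)"
  proof (rule INF_greatest, rule ereal_le_epsilon2)
    fix u :: 'v and e :: real assume "u \<in> feas P 1 (x_init P) (noise1 P)" "0 < e"
    then show "optimal_value P \<le> cost P 1 u (x_init P) (noise1 P) + Q 2 u + ereal e"
      by (rule optimal_value_le)
  qed
qed (rule optimal_value_ge)

end

section \<open>A single trajectory of the algorithm\<close>

lemma approx_end: "approx P \<theta> \<beta> k (Suc (Tmax P)) u = 0"
  by (simp add: approx_def)

lemma approx_ge_cut: "t \<le> Tmax P \<Longrightarrow> j \<le> k \<Longrightarrow> \<theta> j t + \<beta> j t \<bullet> u \<le> approx P \<theta> \<beta> k t u"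
  unfolding approx_def by (auto intro!: Max_ge)

lemma approx_mono: "j \<le> k \<Longrightarrow> approx P \<theta> \<beta> j t u \<le> approx P \<theta> \<beta> k t u"
  by (cases "Tmax P < t") (simp_all add: approx_def[of _ _ _ _ t] Max_mono image_mono)

lemma approx_cong:
  "(\<And>j. j \<le> k \<Longrightarrow> t \<le> Tmax P \<Longrightarrow> \<theta> j t = \<theta>' j t \<and> \<beta> j t = \<beta>' j t) \<Longrightarrow> approx P \<theta> \<beta> k t = approx P \<theta>' \<beta>' k t"
  unfolding approx_def by (intro ext) (auto intro!: arg_cong[where f = Max] image_cong)

lemma stage_value_mono: "(\<And>u. V u \<le> W u) \<Longrightarrow> stage_value P t V y z \<le> stage_value P t W y z"
  unfolding stage_value_def by (rule INF_mono) (auto intro: add_left_mono)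

text \<open>Intercepts and slopes are explicit in the trial points, the subgradients and the
  approximation of the next stage at the same iteration. Hence the double induction: forward over
  iterations and, within one iteration, backward over stages. It makes the cuts functions of the
  samples although they come without measurability.\<close>

lemma cuts_determined:
  assumes run: "sddp_tsto_run P \<theta>0 \<beta>0 s d \<theta> \<beta> \<beta>' \<gamma>' x"
    and run2: "sddp_tsto_run P \<theta>0 \<beta>0 s2 d2 \<theta>2 \<beta>2 \<beta>2' \<gamma>2' x2"
    and eq: "\<And>j t. 1 \<le> j \<Longrightarrow> j \<le> k \<Longrightarrow> t \<in> {1..Tmax P} \<Longrightarrow> x j t = x2 j t"
      "\<And>j t z. 1 \<le> j \<Longrightarrow> j \<le> k \<Longrightarrow> t \<in> {2..Tmax P} \<Longrightarrow> z \<in> noise_supp P t \<Longrightarrow> \<beta>' j t z = \<beta>2' j t z"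
      "\<And>j t z. 1 \<le> j \<Longrightarrow> j \<le> k \<Longrightarrow> t \<in> {2..Tmax P} \<Longrightarrow> z \<in> noise_supp P t \<Longrightarrow> \<gamma>' j t z = \<gamma>2' j t z"
    and t: "t \<in> {2..Tmax P}" and j: "j \<le> k"
  shows "\<theta> j t = \<theta>2 j t \<and> \<beta> j t = \<beta>2 j t"
  using j t
proof (induction j arbitrary: t rule: less_induct)
  case (less j)
  note IHj = less.IH
  show ?case
  proof (cases "j = 0")
    case True
    then show ?thesis using run run2 less.prems by (auto simp: sddp_tsto_run_def)
  next
    case False
    then have j: "1 \<le> j" by simp
    show ?thesis
      using less.prems(2)
    proof (induction "Tmax P - t" arbitrary: t rule: less_induct)
      case (less t)
      have ap: "approx P \<theta> \<beta> j (t + 1) = approx P \<theta>2 \<beta>2 j (t + 1)"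
      proof (rule approx_cong)
        fix i assume i: "i \<le> j" "t + 1 \<le> Tmax P"
        show "\<theta> i (t + 1) = \<theta>2 i (t + 1) \<and> \<beta> i (t + 1) = \<beta>2 i (t + 1)"
        proof (cases "i = j")
          case True
          then show ?thesis using less.hyps[of "t + 1"] less.prems i by auto
        next
          case False
          then show ?thesis using IHj[of i "t + 1"] \<open>j \<le> k\<close> less.prems i by auto
        qed
      qed
      have x: "x j (t - 1) = x2 j (t - 1)" using eq(1)[OF j \<open>j \<le> k\<close>, of "t - 1"] less.prems by (auto simp: Suc_le_eq)
      have b: "backward_pass P \<theta> \<beta> \<beta>' \<gamma>' x j" "backward_pass P \<theta>2 \<beta>2 \<beta>2' \<gamma>2' x2 j"
        using run run2 j by (auto simp: sddp_tsto_run_def)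
      show ?case
        using b[unfolded backward_pass_def Let_def, THEN bspec[OF _ less.prems]]
        unfolding ap x by (simp add: eq(2,3)[OF j \<open>j \<le> k\<close> less.prems])
    qed
  qed
qed

text \<open>Survival is asked up to and including the stage of \<open>w\<close>: only then is the
  decision there a minimizer with the approximate cost-to-go. Iteration 0 has no forward
  pass.\<close>

definition alive_visit :: "(nat \<Rightarrow> nat \<Rightarrow> 's) \<Rightarrow> (nat \<Rightarrow> nat \<Rightarrow> real) \<Rightarrow> nat \<Rightarrow> 's list \<Rightarrow> bool" where
  "alive_visit s d k w \<longleftrightarrow> 1 \<le> k \<and> trail (s k) (length w) = w \<and> (\<forall>j\<in>{1..length w}. d k j = 1)"

locale sddp_trajectory = stage_structure P K D \<theta>0 \<beta>0
  for P :: "('w, 's::euclidean_space, 'v::euclidean_space) stoch_prog" and K D \<theta>0 \<beta>0 +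
  fixes s :: "nat \<Rightarrow> nat \<Rightarrow> 's" and d :: "nat \<Rightarrow> nat \<Rightarrow> real"
    and \<theta> :: "nat \<Rightarrow> nat \<Rightarrow> real" and \<beta> :: "nat \<Rightarrow> nat \<Rightarrow> 'v" and \<beta>' \<gamma>' :: "nat \<Rightarrow> nat \<Rightarrow> 's \<Rightarrow> 'v"
    and x :: "nat \<Rightarrow> nat \<Rightarrow> 'v"
  assumes run: "sddp_tsto_run P \<theta>0 \<beta>0 s d \<theta> \<beta> \<beta>' \<gamma>' x"
begin

abbreviation "visits \<equiv> alive_visit s d"
abbreviation "QA k t \<equiv> approx P \<theta> \<beta> k t"
abbreviation "VA k t \<equiv> stage_value P t (\<lambda>u. ereal (approx P \<theta> \<beta> k (Suc t) u))"

lemma forward: "1 \<le> k \<Longrightarrow> forward_pass P s d \<theta> \<beta> x k"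
  and backward: "1 \<le> k \<Longrightarrow> backward_pass P \<theta> \<beta> \<beta>' \<gamma>' x k"
  and initial: "t \<in> {2..Tmax P} \<Longrightarrow> \<theta> 0 t = \<theta>0 t \<and> \<beta> 0 t = \<beta>0 t"
  using run by (auto simp: sddp_tsto_run_def)

lemma subgradients:
  assumes "1 \<le> k" "1 \<le> t" "t < Tmax P" "z \<in> S (Suc t)"
  shows "is_subgradient (\<lambda>v. VA k (Suc t) v z) (x k t) (\<beta>' k (Suc t) z)"
    "is_subgradient (\<lambda>v. V0 (Suc t) v z) (x k t) (\<gamma>' k (Suc t) z)"
proof -
  have "Suc t \<in> {2..Tmax P}" using assms by auto
  from backward[OF assms(1), unfolded backward_pass_def Let_def, THEN bspec, OF this] assms(4)
  show "is_subgradient (\<lambda>v. VA k (Suc t) v z) (x k t) (\<beta>' k (Suc t) z)"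
    "is_subgradient (\<lambda>v. V0 (Suc t) v z) (x k t) (\<gamma>' k (Suc t) z)"
    by simp_all
qed

lemma cut_eq:
  assumes k: "1 \<le> k" and t: "1 \<le> t" "t < Tmax P"
  shows "\<theta> k (Suc t) + \<beta> k (Suc t) \<bullet> v =
    (1 - q (Suc t)) * (\<Sum>z\<in>S (Suc t). p (Suc t) z * (real_of_ereal (VA k (Suc t) (x k t) z) + \<beta>' k (Suc t) z \<bullet> (v - x k t)))
    + q (Suc t) * (\<Sum>z\<in>S (Suc t). p (Suc t) z * (real_of_ereal (V0 (Suc t) (x k t) z) + \<gamma>' k (Suc t) z \<bullet> (v - x k t)))"
proof -
  have "Suc t \<in> {2..Tmax P}" using t by auto
  from backward[OF k, unfolded backward_pass_def Let_def, THEN bspec, OF this]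
  have \<theta>: "\<theta> k (Suc t) = (1 - q (Suc t)) * (\<Sum>z\<in>S (Suc t). p (Suc t) z * (real_of_ereal (VA k (Suc t) (x k t) z) - \<beta>' k (Suc t) z \<bullet> x k t))
     + q (Suc t) * (\<Sum>z\<in>S (Suc t). p (Suc t) z * (real_of_ereal (V0 (Suc t) (x k t) z) - \<gamma>' k (Suc t) z \<bullet> x k t))"
    and \<beta>: "\<beta> k (Suc t) = (1 - q (Suc t)) *\<^sub>R (\<Sum>z\<in>S (Suc t). p (Suc t) z *\<^sub>R \<beta>' k (Suc t) z)
     + q (Suc t) *\<^sub>R (\<Sum>z\<in>S (Suc t). p (Suc t) z *\<^sub>R \<gamma>' k (Suc t) z)"
    by simp_all
  have split: "(\<Sum>z\<in>S (Suc t). p (Suc t) z * (a z + g z \<bullet> (v - y))) =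
      (\<Sum>z\<in>S (Suc t). p (Suc t) z * (a z - g z \<bullet> y)) + (\<Sum>z\<in>S (Suc t). p (Suc t) z *\<^sub>R g z) \<bullet> v" for a g and y :: 'v
    by (simp add: inner_sum_left inner_diff_right sum.distrib[symmetric] algebra_simps)
  show ?thesis
    unfolding \<theta> \<beta> by (simp only: split inner_add_left inner_scaleR_left) (simp only: algebra_simps)
qed

text \<open>A nonnegative combination of the subgradient inequalities. These hold at every
  \<open>v\<close>, also where the right side is infinite.\<close>

lemma cut_le_stage_values:
  assumes k: "1 \<le> k" and t: "1 \<le> t" "t < Tmax P"
  shows "ereal (\<theta> k (Suc t) + \<beta> k (Suc t) \<bullet> v) \<le>
    ereal (1 - q (Suc t)) * (\<Sum>z\<in>S (Suc t). ereal (p (Suc t) z) * VA k (Suc t) v z)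
     + ereal (q (Suc t)) * (\<Sum>z\<in>S (Suc t). ereal (p (Suc t) z) * V0 (Suc t) v z)"
proof -
  have sub: "ereal (real_of_ereal (h (x k t)) + g \<bullet> (v - x k t)) \<le> h v" if "is_subgradient h (x k t) g" for h g
    using that unfolding is_subgradient_def by (cases "h (x k t)") auto
  have tt: "Suc t \<in> {2..Tmax P}" using t by auto
  have "ereal (\<theta> k (Suc t) + \<beta> k (Suc t) \<bullet> v) =
     ereal (1 - q (Suc t)) * (\<Sum>z\<in>S (Suc t). ereal (p (Suc t) z) * ereal (real_of_ereal (VA k (Suc t) (x k t) z) + \<beta>' k (Suc t) z \<bullet> (v - x k t)))
     + ereal (q (Suc t)) * (\<Sum>z\<in>S (Suc t). ereal (p (Suc t) z) * ereal (real_of_ereal (V0 (Suc t) (x k t) z) + \<gamma>' k (Suc t) z \<bullet> (v - x k t)))"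
    unfolding cut_eq[OF k t] by simp
  also have "\<dots> \<le> ereal (1 - q (Suc t)) * (\<Sum>z\<in>S (Suc t). ereal (p (Suc t) z) * VA k (Suc t) v z)
     + ereal (q (Suc t)) * (\<Sum>z\<in>S (Suc t). ereal (p (Suc t) z) * V0 (Suc t) v z)"
    by (rule weighted_sum_mono)
      (use stop_prob[OF tt] sub[OF subgradients(1)[OF k t]] sub[OF subgradients(2)[OF k t]] in auto)
  finally show ?thesis .
qed

text \<open>Iteration and point remain general in the induction over stages: a cut of any earlier
  iteration \<open>j\<close> may attain the maximum, and its stage value compares the next
  approximation with \<open>Q\<close> at all feasible decisions.\<close>

lemma approx_le_Q:
  assumes "1 \<le> t" "t \<le> Tmax P"
  shows "ereal (QA k (Suc t) v) \<le> Q (Suc t) v"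
  using assms(2,1)
proof (induction t arbitrary: k v rule: inc_induct)
  case base
  then show ?case by (simp add: approx_end Q_end)
next
  case (step t)
  have "ereal (\<theta> j (Suc t) + \<beta> j (Suc t) \<bullet> v) \<le> Q (Suc t) v" for j
  proof (cases "j = 0")
    case True
    then show ?thesis using initial[of "Suc t"] affine_lower[of "Suc t" v] step by auto
  next
    case False
    then have "ereal (\<theta> j (Suc t) + \<beta> j (Suc t) \<bullet> v) \<le>
      ereal (1 - q (Suc t)) * (\<Sum>z\<in>S (Suc t). ereal (p (Suc t) z) * VA j (Suc t) v z)
       + ereal (q (Suc t)) * (\<Sum>z\<in>S (Suc t). ereal (p (Suc t) z) * V0 (Suc t) v z)"
      using step by (intro cut_le_stage_values) auto
    also have "\<dots> \<le> Q (Suc t) v"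
    proof (subst Q_eq)
      show "Suc t \<le> Tmax P" using step by simp
      have tt: "Suc t \<in> {2..Tmax P}" using step by auto
      have VA: "VA j (Suc t) v z \<le> V1 (Suc t) v z" for z
        by (rule stage_value_mono, rule step.IH) simp
      show "ereal (1 - q (Suc t)) * (\<Sum>z\<in>S (Suc t). ereal (p (Suc t) z) * VA j (Suc t) v z)
         + ereal (q (Suc t)) * (\<Sum>z\<in>S (Suc t). ereal (p (Suc t) z) * V0 (Suc t) v z)
        \<le> ereal (1 - q (Suc t)) * (\<Sum>z\<in>S (Suc t). ereal (p (Suc t) z) * V1 (Suc t) v z)
         + ereal (q (Suc t)) * (\<Sum>z\<in>S (Suc t). ereal (p (Suc t) z) * V0 (Suc t) v z)"
        by (rule weighted_sum_mono) (use stop_prob[OF tt] VA in auto)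
    qed
    finally show ?thesis .
  qed
  moreover have "QA k (Suc t) v \<in> (\<lambda>j. \<theta> j (Suc t) + \<beta> j (Suc t) \<bullet> v) ` {0..k}"
    using step.hyps unfolding approx_def by (auto intro!: Max_in simp del: Max_in)
  ultimately show ?case by auto
qed

lemma visits_Cons: "visits k (z # w) \<Longrightarrow> visits k w \<and> s k (Suc (length w)) = z"
  by (auto simp: alive_visit_def)

lemma visits_arg_min:
  assumes "visits k (z # w)" "Suc (length w) \<le> Tmax P"
  shows "is_arg_min (\<lambda>u. cost P (Suc (length w)) u (x k (length w)) z + ereal (QA (k - 1) (Suc (Suc (length w))) u))
             (\<lambda>u. u \<in> feas P (Suc (length w)) (x k (length w)) z) (x k (Suc (length w)))"
  using forward[of k] assms by (auto simp: alive_visit_def forward_pass_def)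

lemma visits_in_K:
  assumes "visits k w" "w \<in> nodes S t" "t \<le> Tmax P"
  shows "x k t \<in> K w"
  using assms
proof (induction t arbitrary: w)
  case 0
  then show ?case using forward[of k] by (auto simp: alive_visit_def forward_pass_def K_Nil)
next
  case (Suc t)
  from Suc.prems(2) obtain z v where w: "w = z # v" "z \<in> S (Suc t)" "v \<in> nodes S t" by auto
  have len: "length v = t" using w(3) by (rule nodes_length)
  have v: "visits k v" using Suc.prems(1) w visits_Cons by blast
  have "x k (Suc t) \<in> feas P (Suc t) (x k t) z"
    using visits_arg_min[of k z v] Suc.prems w len by (simp add: is_arg_min_def)
  moreover have "x k t \<in> K v" using Suc.IH[OF v w(3)] Suc.prems by simp
  ultimately show ?case using feas_sub_K[of t v z] w Suc.prems by auto
qed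

section \<open>Gaps and lags at the nodes\<close>

definition gap :: "nat \<Rightarrow> nat \<Rightarrow> real" where
  "gap k t = Qr (Suc t) (x k t) - QA (k - 1) (Suc t) (x k t)"

text \<open>Here \<open>z\<close> is any realization of the next noise, not the sampled one. At
  iteration \<open>k\<close> the condition involves only the cuts up to \<open>k - 1\<close> and the
  trial point at \<open>w\<close>, all fixed before the next noise is drawn; this allows
  independence to be applied.\<close>

definition lagging :: "real \<Rightarrow> 's list \<Rightarrow> 's \<Rightarrow> nat \<Rightarrow> bool" where
  "lagging e w z k \<longleftrightarrow>
     VA (k - 1) (Suc (length w)) (x k (length w)) z < ereal (v1 (Suc (length w)) (x k (length w)) z - e)"

text \<open>If \<open>z\<close> is sampled and the process survives, the next trial point attains
  the approximate stage value, while it is merely feasible for the true one. The cost cancels, and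
  the deficit of the stage value is passed on to the gap at that trial point.\<close>

lemma lagging_gap:
  assumes t: "1 \<le> t" "t < Tmax P" and w: "w \<in> nodes S t" and z: "z \<in> S (Suc t)"
    and v: "visits k (z # w)" and lag: "lagging e w z k"
  shows "e < gap k (Suc t)"
proof -
  have len: "length w = t" using w by (rule nodes_length)
  have k: "visits k w" using v visits_Cons by blast
  have zw: "z # w \<in> nodes S (Suc t)" using w z by auto
  have yK: "x k t \<in> K w" using visits_in_K[OF k w] t by simp
  have xK: "x k (Suc t) \<in> K (z # w)" using visits_in_K[OF v zw] t by simp
  let ?f = "\<lambda>u. cost P (Suc t) u (x k t) z + ereal (QA (k - 1) (Suc (Suc t)) u)"
  have am: "is_arg_min ?f (\<lambda>u. u \<in> feas P (Suc t) (x k t) z) (x k (Suc t))"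
    using visits_arg_min[OF v] len t by simp
  then have f: "x k (Suc t) \<in> feas P (Suc t) (x k t) z" by (simp add: is_arg_min_def)
  have opt: "?f (x k (Suc t)) \<le> VA (k - 1) (Suc t) (x k t) z"
    unfolding stage_value_def using am by (intro INF_greatest) (auto simp: is_arg_min_def not_less)
  have c: "cost P (Suc t) (x k (Suc t)) (x k t) z = ereal (fr (Suc t) (x k (Suc t)) (x k t) z)"
    using cost_finite[OF t(2) w z yK f] by (simp add: fr_def ereal_real)
  from order_le_less_trans[OF opt lag[unfolded lagging_def len]]
  have "ereal (fr (Suc t) (x k (Suc t)) (x k t) z + QA (k - 1) (Suc (Suc t)) (x k (Suc t))) < ereal (v1 (Suc t) (x k t) z - e)"
    unfolding c plus_ereal.simps .
  moreover have "V1 (Suc t) (x k t) z \<le> cost P (Suc t) (x k (Suc t)) (x k t) z + Q (Suc (Suc t)) (x k (Suc t))"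
    unfolding stage_value_def by (rule INF_lower) (rule f)
  moreover have "Q (Suc (Suc t)) (x k (Suc t)) = ereal (Qr (Suc (Suc t)) (x k (Suc t)))"
    using Q_ereal[OF _ _ zw xK] t by simp
  ultimately show ?thesis
    by (simp add: V_ereal[OF t w z yK] c gap_def)
qed

text \<open>The terms with \<open>V0\<close> are exact, so the error of the new cut at its own trial
  point is an average of errors of the approximate stage values. These only improve from iteration
  \<open>k - 1\<close> to \<open>k\<close>, so absence of lag bounds each of them.\<close>

lemma cut_tight:
  assumes k: "visits k w" and t: "1 \<le> t" "t < Tmax P" and w: "w \<in> nodes S t" and e: "0 \<le> e"
    and nolag: "\<And>z. Suc t < Tmax P \<Longrightarrow> z \<in> S (Suc t) \<Longrightarrow> \<not> lagging e w z k"
  shows "Qr (Suc t) (x k t) - (\<theta> k (Suc t) + \<beta> k (Suc t) \<bullet> x k t) \<le> e"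
proof -
  have k1: "1 \<le> k" using k by (simp add: alive_visit_def)
  have len: "length w = t" using w by (rule nodes_length)
  have yK: "x k t \<in> K w" using visits_in_K[OF k w] t by simp
  have tt: "Suc t \<in> {2..Tmax P}" using t by auto
  have "Qr (Suc t) (x k t) - (\<theta> k (Suc t) + \<beta> k (Suc t) \<bullet> x k t) =
     (1 - q (Suc t)) * (\<Sum>z\<in>S (Suc t). p (Suc t) z * (v1 (Suc t) (x k t) z - real_of_ereal (VA k (Suc t) (x k t) z)))"
    unfolding cut_eq[OF k1 t] Qr_eq[OF t w yK] by (simp add: v0_def sum_subtractf algebra_simps)
  also have "\<dots> \<le> e"
  \<comment> \<open>With \<open>q = 1\<close> at the last stage the error has weight 0.\<close>
  proof (cases "Suc t = Tmax P")
    case True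
    then show ?thesis using stop_prob_Tmax e by simp
  next
    case False
    have "(\<Sum>z\<in>S (Suc t). p (Suc t) z * (v1 (Suc t) (x k t) z - real_of_ereal (VA k (Suc t) (x k t) z))) \<le>
      (\<Sum>z\<in>S (Suc t). p (Suc t) z * e)"
    proof (intro sum_mono mult_left_mono noise_prob_nonneg)
      fix z assume z: "z \<in> S (Suc t)"
      have "ereal (v1 (Suc t) (x k t) z - e) \<le> VA (k - 1) (Suc t) (x k t) z"
        using nolag[OF _ z] False t by (simp add: lagging_def len not_less)
      also have "\<dots> \<le> VA k (Suc t) (x k t) z"
        by (rule stage_value_mono) (simp add: approx_mono)
      finally show "v1 (Suc t) (x k t) z - real_of_ereal (VA k (Suc t) (x k t) z) \<le> e"
        using subgradients(1)[OF k1 t z] unfolding is_subgradient_def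
        by (cases "VA k (Suc t) (x k t) z") auto
    qed
    also have "\<dots> = e" using sum_noise_prob[of "Suc t"] t by (simp add: sum_distrib_right[symmetric])
    finally have "(1 - q (Suc t)) * (\<Sum>z\<in>S (Suc t). p (Suc t) z * (v1 (Suc t) (x k t) z - real_of_ereal (VA k (Suc t) (x k t) z)))
       \<le> (1 - q (Suc t)) * e"
      using stop_prob[OF tt] by (intro mult_left_mono) auto
    also have "\<dots> \<le> 1 * e" using stop_prob[OF tt] e by (intro mult_right_mono) auto
    finally show ?thesis by simp
  qed
  finally show ?thesis .
qed

text \<open>There is a shift of index to overcome: \<open>cut_tight\<close> concerns the cut
  computed at iteration \<open>k\<close>, whereas \<open>gap\<close> sees only cuts of iterations
  before \<open>k\<close>. The passage is \<open>cuts_become_tight\<close>, applied to the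
  iterations that visit \<open>w\<close>.\<close>

lemma gap_tendsto_of_nolag:
  assumes t: "1 \<le> t" "t < Tmax P" and w: "w \<in> nodes S t"
    and nolag: "\<And>z e. Suc t < Tmax P \<Longrightarrow> z \<in> S (Suc t) \<Longrightarrow> e > 0 \<Longrightarrow>
        \<forall>\<^sub>F k in sequentially. visits k w \<longrightarrow> \<not> lagging e w z k"
    and e: "e > 0"
  shows "\<forall>\<^sub>F k in sequentially. visits k w \<longrightarrow> gap k t < e"
proof -
  let ?I = "{k. visits k w}"
  have tt: "Suc t \<in> {2..Tmax P}" using t by auto
  have KD: "K w \<subseteq> D w" and cK: "compact (K w)" using t w K_sub_D K_compact by blast+
  obtain M where M: "\<And>v. v \<in> D w \<Longrightarrow> Q (Suc t) v \<le> ereal M"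
    using Q_upper[OF t(1) _ w] t by auto
  have Qfin: "Q (Suc t) v = ereal (Qr (Suc t) v)" if "v \<in> D w" for v
    using Q_finite_D[OF t(1) _ w that] t by (simp add: Qr_def ereal_real)
  obtain b where b: "\<And>v. v \<in> K w \<Longrightarrow> norm v \<le> b"
    using compact_imp_bounded[OF cK] unfolding bounded_iff by blast
  \<comment> \<open>The initial affine minorant is bounded below on the compact set
    \<open>K w\<close>.\<close>
  have lower: "\<theta>0 (Suc t) - norm (\<beta>0 (Suc t)) * b \<le> Qr (Suc t) v" if v: "v \<in> K w" for v
  proof -
    have "- (\<beta>0 (Suc t) \<bullet> v) \<le> norm (\<beta>0 (Suc t)) * norm v"
      using Cauchy_Schwarz_ineq2[of "\<beta>0 (Suc t)" v] by simp
    also have "\<dots> \<le> norm (\<beta>0 (Suc t)) * b" using b[OF v] by (intro mult_left_mono) auto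
    finally show ?thesis
      using affine_lower[OF tt, of v] Qfin[of v] v KD by auto
  qed
  have "\<forall>\<^sub>F k in sequentially. k \<in> ?I \<longrightarrow>
      (\<exists>j\<in>?I. j < k \<and> Qr (Suc t) (x k t) - (\<theta> j (Suc t) + \<beta> j (Suc t) \<bullet> x k t) < e)"
  proof (rule cuts_become_tight[where K = "K w" and D = "D w" and M = M
          and m = "\<theta>0 (Suc t) - norm (\<beta>0 (Suc t)) * b"])
    show "x k t \<in> K w" if "k \<in> ?I" for k using that visits_in_K[OF _ w] t by auto
    show "Qr (Suc t) v \<le> M" if "v \<in> D w" for v using M[OF that] Qfin[OF that] by simp
    show "\<exists>r>0. \<forall>v\<in>K w. v \<noteq> l \<longrightarrow> l + (r / norm (v - l)) *\<^sub>R (v - l) \<in> D w" if "l \<in> K w" for l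
      using ray[OF t(2) w that] .
    show "\<theta> k (Suc t) + \<beta> k (Suc t) \<bullet> v \<le> Qr (Suc t) v" if "k \<in> ?I" "v \<in> D w" for k v
    proof -
      have "\<theta> k (Suc t) + \<beta> k (Suc t) \<bullet> v \<le> QA k (Suc t) v" using t by (intro approx_ge_cut) auto
      also have "ereal \<dots> \<le> Q (Suc t) v" using t by (intro approx_le_Q) auto
      finally show ?thesis using Qfin[OF that(2)] by simp
    qed
    show "\<forall>\<^sub>F k in sequentially. k \<in> ?I \<longrightarrow> Qr (Suc t) (x k t) - (\<theta> k (Suc t) + \<beta> k (Suc t) \<bullet> x k t) < e'"
      if e': "0 < e'" for e'
    proof -
      have "\<forall>\<^sub>F k in sequentially. \<forall>z\<in>S (Suc t). Suc t < Tmax P \<longrightarrow> visits k w \<longrightarrow> \<not> lagging (e' / 2) w z k"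
        using finite_S[of "Suc t"] t nolag[of _ "e' / 2"] e' by (intro eventually_ball_finite) auto
      then show ?thesis
      proof eventually_elim
        case (elim k)
        then show ?case using cut_tight[of k w t "e' / 2"] t w e' by fastforce
      qed
    qed
  qed (use KD cK e lower in auto)
  then show ?thesis
  proof eventually_elim
    case (elim k)
    show ?case
    proof
      assume "visits k w"
      then obtain j where j: "j < k" "Qr (Suc t) (x k t) - (\<theta> j (Suc t) + \<beta> j (Suc t) \<bullet> x k t) < e"
        using elim by auto
      \<comment> \<open>As \<open>j < k\<close>, cut \<open>j\<close> is among those forming the
        approximation of iteration \<open>k - 1\<close>.\<close>
      moreover have "\<theta> j (Suc t) + \<beta> j (Suc t) \<bullet> x k t \<le> QA (k - 1) (Suc t) (x k t)"
        using t j by (intro approx_ge_cut) auto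
      ultimately show "gap k t < e" by (simp add: gap_def)
    qed
  qed
qed

end

section \<open>Random samples\<close>

text \<open>A conditional second Borel-Cantelli lemma. Starting at \<open>n0\<close>, each time
  \<open>B\<close> occurs without a previous hit, a fraction \<open>r\<close> of that event is hit
  and leaves the no-hit event. The losses add up to at most 1, so the events \<open>E n0 m\<close>
  have summable probabilities, and the first Borel-Cantelli lemma shows that almost surely only
  finitely many of them occur.\<close>

lemma (in prob_space) infinitely_often_hit:
  assumes alg: "\<And>n. sigma_algebra (space M) (F n)" and mono: "\<And>n. F n \<subseteq> F (Suc n)"
    and ev: "\<And>n. F n \<subseteq> events" and B: "\<And>n. B n \<in> F n" and C: "\<And>n. C n \<in> F (Suc n)"
    and ind: "\<And>n U. U \<in> F n \<Longrightarrow> prob (U \<inter> C n) = r * prob U" and r: "0 < r"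
  shows "AE \<omega> in M. (\<exists>\<^sub>F n in sequentially. \<omega> \<in> B n) \<longrightarrow> (\<exists>\<^sub>F n in sequentially. \<omega> \<in> B n \<inter> C n)"
proof -
  have monoF: "F m \<subseteq> F n" if "m \<le> n" for m n
    using lift_Suc_mono_le[of F, OF mono that] by simp
  \<comment> \<open>No hit during the times from \<open>n0\<close> to \<open>m - 1\<close>; this is
    known at time \<open>m\<close>, whereas \<open>C m\<close> is independent of what is known
    then.\<close>
  define A where "A = (\<lambda>n0 m. space M - (\<Union>k\<in>{n0..<m}. B k \<inter> C k))"
  have A: "A n0 m \<in> F m" for n0 m
  proof -
    interpret sigma_algebra "space M" "F m" by (rule alg)
    have "B k \<inter> C k \<in> F m" if "k \<in> {n0..<m}" for k
      using monoF[of k m] monoF[of "Suc k" m] B[of k] C[of k] that by auto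
    then have "(\<Union>k\<in>{n0..<m}. B k \<inter> C k) \<in> F m" by (intro finite_UN) auto
    then show ?thesis unfolding A_def by (rule compl_sets)
  qed
  define E where "E = (\<lambda>n0 m. if n0 \<le> m then A n0 m \<inter> B m else {})"
  have AB: "A n0 m \<inter> B m \<in> F m" for n0 m
  proof -
    interpret sigma_algebra "space M" "F m" by (rule alg)
    show ?thesis using A B by auto
  qed
  have E: "E n0 m \<in> events" for n0 m
    using AB[of n0 m] ev[of m] by (auto simp: E_def)
  have step: "r * prob (E n0 m) \<le> prob (A n0 m) - prob (A n0 (Suc m))" for n0 m
  proof (cases "n0 \<le> m")
    case True
    have sub: "A n0 m \<inter> B m \<inter> C m \<subseteq> A n0 m" by auto
    have ev1: "A n0 m \<in> events" "C m \<in> events" "A n0 m \<inter> B m \<in> events"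
      using A AB C ev by blast+
    have "{n0..<Suc m} = insert m {n0..<m}" using True by auto
    then have "A n0 (Suc m) = A n0 m - (A n0 m \<inter> B m \<inter> C m)"
      unfolding A_def by auto
    then have "prob (A n0 (Suc m)) = prob (A n0 m) - prob (A n0 m \<inter> B m \<inter> C m)"
      using ev1 sub by (simp add: finite_measure_Diff sets.Int)
    then show ?thesis using ind[OF AB[of n0 m]] True by (simp add: E_def)
  next
    case False
    have "A n0 (Suc m) \<subseteq> A n0 m" by (auto simp: A_def)
    then have "prob (A n0 (Suc m)) \<le> prob (A n0 m)"
      using A[of n0 m] ev by (intro finite_measure_mono) auto
    then show ?thesis using False by (simp add: E_def)
  qed
  have "summable (\<lambda>m. prob (E n0 m))" for n0
  proof (rule summableI_nonneg_bounded)
    fix n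
    have "r * (\<Sum>m<n. prob (E n0 m)) \<le> (\<Sum>m<n. prob (A n0 m) - prob (A n0 (Suc m)))"
      unfolding sum_distrib_left by (rule sum_mono) (rule step)
    also have "\<dots> = prob (A n0 0) - prob (A n0 n)" by (rule sum_lessThan_telescope')
    also have "\<dots> \<le> 1" using prob_le_1[of "A n0 0"] measure_nonneg[of M "A n0 n"] by linarith
    finally show "(\<Sum>m<n. prob (E n0 m)) \<le> 1 / r" using r by (simp add: field_simps)
  qed simp
  then have "AE \<omega> in M. \<forall>\<^sub>F m in sequentially. \<omega> \<in> space M - E n0 m" for n0
    by (intro borel_cantelli_AE1 E) (simp_all add: emeasure_eq_measure)
  then have "AE \<omega> in M. \<forall>n0. \<forall>\<^sub>F m in sequentially. \<omega> \<in> space M - E n0 m"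
    by (simp add: AE_all_countable)
  then show ?thesis
  proof eventually_elim
    case (elim \<omega>)
    show ?case
    proof (intro impI, rule ccontr)
      assume io: "\<exists>\<^sub>F n in sequentially. \<omega> \<in> B n" and "\<not> (\<exists>\<^sub>F n in sequentially. \<omega> \<in> B n \<inter> C n)"
      then obtain n0 where n0: "\<And>n. n0 \<le> n \<Longrightarrow> \<omega> \<notin> B n \<inter> C n"
        by (auto simp: not_frequently eventually_sequentially)
      have "\<forall>\<^sub>F m in sequentially. \<omega> \<notin> B m"
        using elim[rule_format, of n0] eventually_ge_at_top[of n0]
      proof eventually_elim
        case (elim m)
        then show ?case using n0 by (auto simp: E_def A_def)
      qed
      then show False using io by (simp add: frequently_def)
    qed
  qed
qed

text \<open>Such a set is a finite union of one-point boxes. It supplies measurability for sets of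
  samples or histories that are defined without regard to it.\<close>

lemma finite_in_sets_PiM:
  assumes I: "finite I" and A: "finite A" "A \<subseteq> extensional I"
    and sing: "\<And>i f. i \<in> I \<Longrightarrow> f \<in> A \<Longrightarrow> {f i} \<in> sets (M i)"
  shows "A \<in> sets (PiM I M)"
proof -
  have "{f} \<in> sets (PiM I M)" if f: "f \<in> A" for f
  proof -
    have "{f} = (\<Pi>\<^sub>E i\<in>I. {f i})"
      using f A(2) by (auto simp: PiE_singleton extensional_def subset_eq)
    also have "\<dots> \<in> sets (PiM I M)" using I sing[OF _ f] by (intro sets_PiM_I_finite) auto
    finally show ?thesis .
  qed
  then have "(\<Union>f\<in>A. {f}) \<in> sets (PiM I M)" using A by (intro sets.finite_UN) auto
  then show ?thesis by simp
qed

lemma (in prob_space) past_independent: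
  fixes X :: "nat \<Rightarrow> 'a \<Rightarrow> 'b" and E :: "'b measure"
  assumes X: "indep_vars (\<lambda>_. E) X {1..}" and A: "A \<in> sets E"
    and U: "U \<in> sets (vimage_algebra (space M) (\<lambda>\<omega>. \<lambda>i\<in>{1..n}. X i \<omega>) (\<Pi>\<^sub>M i\<in>{1..n}. E))"
  shows "prob (U \<inter> (X (Suc n) -` A \<inter> space M)) = prob (X (Suc n) -` A \<inter> space M) * prob U"
proof -
  have Xm: "X i \<in> M \<rightarrow>\<^sub>M E" if "1 \<le> i" for i
    using X that by (auto simp: indep_vars_def)
  have XE: "X i \<omega> \<in> space E" if "1 \<le> i" "\<omega> \<in> space M" for i \<omega>
    using measurable_space[OF Xm] that by auto
  obtain W where W: "W \<in> sets (\<Pi>\<^sub>M i\<in>{1..n}. E)" "U = (\<lambda>\<omega>. \<lambda>i\<in>{1..n}. X i \<omega>) -` W \<inter> space M"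
    using U by (subst (asm) sets_vimage_algebra2) (use XE in \<open>auto simp: space_PiM\<close>)
  have ind: "indep_var (\<Pi>\<^sub>M i\<in>{1..n}. E) (\<lambda>\<omega>. \<lambda>i\<in>{1..n}. X i \<omega>) (\<Pi>\<^sub>M i\<in>{Suc n}. E) (\<lambda>\<omega>. \<lambda>i\<in>{Suc n}. X i \<omega>)"
    by (rule indep_var_restrict[OF X]) auto
  define G where "G = {f \<in> space (\<Pi>\<^sub>M i\<in>{Suc n}. E). f (Suc n) \<in> A}"
  have G: "G \<in> sets (\<Pi>\<^sub>M i\<in>{Suc n}. E)" unfolding G_def using A by measurable
  have "(\<lambda>\<omega>. \<lambda>i\<in>{Suc n}. X i \<omega>) -` G \<inter> space M = X (Suc n) -` A \<inter> space M"
    using XE[of "Suc n"] by (auto simp: G_def space_PiM)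
  moreover have "prob ((\<lambda>\<omega>. (\<lambda>i\<in>{1..n}. X i \<omega>, \<lambda>i\<in>{Suc n}. X i \<omega>)) -` (W \<times> G) \<inter> space M) =
     prob U * prob ((\<lambda>\<omega>. \<lambda>i\<in>{Suc n}. X i \<omega>) -` G \<inter> space M)"
    unfolding W(2) by (rule indep_varD[OF ind W(1) G])
  moreover have "(\<lambda>\<omega>. (\<lambda>i\<in>{1..n}. X i \<omega>, \<lambda>i\<in>{Suc n}. X i \<omega>)) -` (W \<times> G) \<inter> space M =
     U \<inter> ((\<lambda>\<omega>. \<lambda>i\<in>{Suc n}. X i \<omega>) -` G \<inter> space M)"
    unfolding W(2) by auto
  ultimately show ?thesis by simp
qed

text \<open>The case where the algebra at time \<open>n\<close> is generated by the first
  \<open>n\<close> samples and the hit is decided by sample \<open>Suc n\<close>.\<close>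

lemma (in prob_space) past_determined_infinitely_often:
  fixes X :: "nat \<Rightarrow> 'a \<Rightarrow> 'b" and E :: "'b measure"
  assumes X: "indep_vars (\<lambda>_. E) X {1..}" and A: "A \<in> sets E"
    and prob: "\<And>n. prob (X (Suc n) -` A \<inter> space M) = r" and r: "0 < r"
    and H: "\<And>n. H n \<in> sets (\<Pi>\<^sub>M i\<in>{1..n}. E)"
  shows "AE \<omega> in M. (\<exists>\<^sub>F n in sequentially. (\<lambda>i\<in>{1..n}. X i \<omega>) \<in> H n) \<longrightarrow>
     (\<exists>\<^sub>F n in sequentially. (\<lambda>i\<in>{1..n}. X i \<omega>) \<in> H n \<and> X (Suc n) \<omega> \<in> A)"
proof -
  let ?V = "\<lambda>n. vimage_algebra (space M) (\<lambda>\<omega>. \<lambda>i\<in>{1..n}. X i \<omega>) (\<Pi>\<^sub>M i\<in>{1..n}. E)"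
  have Xm: "X i \<in> M \<rightarrow>\<^sub>M E" if "1 \<le> i" for i
    using X that by (auto simp: indep_vars_def)
  have XE: "X i \<omega> \<in> space E" if "1 \<le> i" "\<omega> \<in> space M" for i \<omega>
    using measurable_space[OF Xm] that by auto
  have XV: "X i \<in> ?V n \<rightarrow>\<^sub>M E" if "i \<in> {1..n}" for i n
  proof -
    have "(\<lambda>\<omega>. \<lambda>i\<in>{1..n}. X i \<omega>) \<in> ?V n \<rightarrow>\<^sub>M (\<Pi>\<^sub>M i\<in>{1..n}. E)"
      by (rule measurable_vimage_algebra1) (use XE in \<open>auto simp: space_PiM\<close>)
    from measurable_compose[OF this measurable_component_singleton[OF that]] that show ?thesis by simp
  qed
  have "AE \<omega> in M. (\<exists>\<^sub>F n in sequentially. \<omega> \<in> (\<lambda>\<omega>. \<lambda>i\<in>{1..n}. X i \<omega>) -` H n \<inter> space M) \<longrightarrow>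
     (\<exists>\<^sub>F n in sequentially. \<omega> \<in> (\<lambda>\<omega>. \<lambda>i\<in>{1..n}. X i \<omega>) -` H n \<inter> space M \<inter> (X (Suc n) -` A \<inter> space M))"
  proof (rule infinitely_often_hit[where F = "\<lambda>n. sets (?V n)"])
    show "sigma_algebra (space M) (sets (?V n))" for n
      using sets.sigma_algebra_axioms[of "?V n"] by simp
    show "sets (?V n) \<subseteq> sets (?V (Suc n))" for n
      by (intro sets_image_in_sets measurable_restrict XV) auto
    show "sets (?V n) \<subseteq> events" for n
      by (intro sets_image_in_sets measurable_restrict Xm) auto
    show "(\<lambda>\<omega>. \<lambda>i\<in>{1..n}. X i \<omega>) -` H n \<inter> space M \<in> sets (?V n)" for n
      by (rule in_vimage_algebra[OF H])
    show "X (Suc n) -` A \<inter> space M \<in> sets (?V (Suc n))" for n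
      using measurable_sets[OF XV[of "Suc n" "Suc n"] A] by simp
    show "prob (U \<inter> (X (Suc n) -` A \<inter> space M)) = r * prob U" if "U \<in> sets (?V n)" for n U
      using past_independent[OF X A that] prob by simp
  qed (rule r)
  then show ?thesis
    using AE_space by eventually_elim (auto elim!: frequently_elim1)
qed

section \<open>Lower bounds and limit at the first stage\<close>

context sddp_trajectory
begin

text \<open>Optimality of the trial point for the approximation of iteration \<open>k - 1\<close>
  bounds the optimal value from below, its feasibility bounds it from above by the true cost-to-go,
  and the two bounds differ by \<open>gap k 1\<close>. The approximation of iteration
  \<open>k\<close> lies in between by monotonicity and validity of the cuts.\<close>

lemma first_stage_limit:
  assumes vis: "\<And>k. 1 \<le> k \<Longrightarrow> visits k [noise1 P]"
    and gap: "\<And>e. e > 0 \<Longrightarrow> \<forall>\<^sub>F k in sequentially. visits k [noise1 P] \<longrightarrow> gap k 1 < e"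
  shows "(\<lambda>k. cost P 1 (x k 1) (x_init P) (noise1 P) + ereal (QA k 2 (x k 1))) \<longlonglongrightarrow> optimal_value P"
proof -
  have am: "is_arg_min (\<lambda>u. cost P 1 u (x_init P) (noise1 P) + ereal (QA (k - 1) 2 u))
             (\<lambda>u. u \<in> feas P 1 (x_init P) (noise1 P)) (x k 1)" if k: "1 \<le> k" for k
    using visits_arg_min[of k "noise1 P" "[]"] vis[OF k] forward[OF k] Tmax_ge2
    by (simp add: forward_pass_def numeral_2_eq_2)
  then have feas: "1 \<le> k \<Longrightarrow> x k 1 \<in> feas P 1 (x_init P) (noise1 P)" for k
    by (simp add: is_arg_min_def)
  let ?f = "\<lambda>k. fr 1 (x k 1) (x_init P) (noise1 P)"
  have QA_Q: "QA j 2 (x k 1) \<le> Qr 2 (x k 1)" if "1 \<le> k" for j k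
    using approx_le_Q[of 1 j "x k 1"] first_stage_finite(3)[OF feas[OF that]] Tmax_ge2
    by (simp add: numeral_2_eq_2)
  have lo: "ereal (?f k + QA (k - 1) 2 (x k 1)) \<le> optimal_value P" if k: "1 \<le> k" for k
  proof -
    have "ereal (?f k + QA (k - 1) 2 (x k 1)) \<le> cost P 1 u (x_init P) (noise1 P) + Q 2 u"
      if u: "u \<in> feas P 1 (x_init P) (noise1 P)" for u
    proof -
      have "ereal (?f k + QA (k - 1) 2 (x k 1)) = cost P 1 (x k 1) (x_init P) (noise1 P) + ereal (QA (k - 1) 2 (x k 1))"
        using first_stage_finite(2)[OF feas[OF k]] by simp
      also have "\<dots> \<le> cost P 1 u (x_init P) (noise1 P) + ereal (QA (k - 1) 2 u)"
        using am[OF k] u by (simp add: is_arg_min_def not_less)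
      also have "\<dots> \<le> cost P 1 u (x_init P) (noise1 P) + Q 2 u"
        using approx_le_Q[of 1 "k - 1" u] Tmax_ge2 by (intro add_left_mono) (simp add: numeral_2_eq_2)
      finally show ?thesis .
    qed
    then show ?thesis unfolding optimal_value_eq by (rule INF_greatest)
  qed
  have hi: "optimal_value P \<le> ereal (?f k + Qr 2 (x k 1))" if k: "1 \<le> k" for k
  proof -
    have "optimal_value P \<le> cost P 1 (x k 1) (x_init P) (noise1 P) + Q 2 (x k 1)"
      unfolding optimal_value_eq by (rule INF_lower) (rule feas[OF k])
    then show ?thesis using first_stage_finite(2,3)[OF feas[OF k]] by simp
  qed
  obtain v where v: "optimal_value P = ereal v"
    using lo[of 1] hi[of 1] by (cases "optimal_value P") auto
  have "(\<lambda>k. ?f k + QA k 2 (x k 1)) \<longlonglongrightarrow> v"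
  proof (rule LIMSEQ_I)
    fix e :: real assume "e > 0"
    from gap[OF this] have "\<forall>\<^sub>F k in sequentially. norm (?f k + QA k 2 (x k 1) - v) < e"
      using eventually_ge_at_top[of 1]
    proof eventually_elim
      case (elim k)
      then have "Qr 2 (x k 1) - QA (k - 1) 2 (x k 1) < e"
        using vis[of k] by (simp add: gap_def numeral_2_eq_2)
      moreover have "QA (k - 1) 2 (x k 1) \<le> QA k 2 (x k 1)" by (rule approx_mono) simp
      ultimately show ?case
        using lo[OF elim(2)] hi[OF elim(2)] QA_Q[OF elim(2), of k] unfolding v by (simp add: abs_less_iff)
    qed
    then show "\<exists>no. \<forall>n\<ge>no. norm (?f n + QA n 2 (x n 1) - v) < e"
      by (simp add: eventually_sequentially)
  qed
  then have "(\<lambda>k. ereal (?f k + QA k 2 (x k 1))) \<longlonglongrightarrow> optimal_value P"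
    unfolding v by (rule tendsto_ereal)
  then show ?thesis
    by (rule Lim_transform_eventually)
      (use eventually_ge_at_top[of 1] in eventually_elim, use first_stage_finite(2)[OF feas] in simp)
qed

lemma lower_bound_le_optimal_value: "lower_bound P \<theta> \<beta> k \<le> optimal_value P"
  unfolding lower_bound_def optimal_value_eq
  by (rule INF_mono) (use approx_le_Q[of 1 k] Tmax_ge2 in \<open>auto simp: numeral_2_eq_2 intro!: add_left_mono\<close>)

end

section \<open>Independent samples with finitely many outcomes\<close>

locale sddp_samples = stage_structure P K D \<theta>0 \<beta>0
  for P :: "('w, 's::euclidean_space, 'v::euclidean_space) stoch_prog" and K D \<theta>0 \<beta>0 +
  fixes N :: "'a measure"
    and s :: "nat \<Rightarrow> nat \<Rightarrow> 'a \<Rightarrow> 's" and d :: "nat \<Rightarrow> nat \<Rightarrow> 'a \<Rightarrow> real"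
    and \<theta> :: "nat \<Rightarrow> nat \<Rightarrow> 'a \<Rightarrow> real" and \<beta> :: "nat \<Rightarrow> nat \<Rightarrow> 'a \<Rightarrow> 'v"
    and \<beta>' \<gamma>' :: "nat \<Rightarrow> nat \<Rightarrow> 's \<Rightarrow> 'a \<Rightarrow> 'v"
    and x :: "nat \<Rightarrow> nat \<Rightarrow> 'a \<Rightarrow> 'v"
  assumes samples: "independent_samples P N s d"
    and nonant: "nonanticipative P N s d \<beta>' \<gamma>' x"
    and run_AE: "AE \<omega> in N. sddp_tsto_run P \<theta>0 \<beta>0 (\<lambda>k t. s k t \<omega>) (\<lambda>k t. d k t \<omega>)
           (\<lambda>k t. \<theta> k t \<omega>) (\<lambda>k t. \<beta> k t \<omega>) (\<lambda>k t z. \<beta>' k t z \<omega>) (\<lambda>k t z. \<gamma>' k t z \<omega>) (\<lambda>k t. x k t \<omega>)"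
begin

abbreviation "E \<equiv> (\<Pi>\<^sub>M t\<in>{1..Tmax P}. borel) :: (nat \<Rightarrow> 's \<times> real) measure"
abbreviation "smp k \<omega> \<equiv> (\<lambda>t\<in>{1..Tmax P}. (s k t \<omega>, d k t \<omega>))"
abbreviation "outcome \<omega> \<equiv> (\<lambda>t\<in>{1..Tmax P}. (noise P t \<omega>, alive P t \<omega>))"

abbreviation "visits \<omega> \<equiv> alive_visit (\<lambda>k t. s k t \<omega>) (\<lambda>k t. d k t \<omega>)"
abbreviation "lagging \<omega> \<equiv> sddp_trajectory.lagging P (\<lambda>k t. \<theta> k t \<omega>) (\<lambda>k t. \<beta> k t \<omega>) (\<lambda>k t. x k t \<omega>)"
abbreviation "gap \<omega> \<equiv> sddp_trajectory.gap P (\<lambda>k t. \<theta> k t \<omega>) (\<lambda>k t. \<beta> k t \<omega>) (\<lambda>k t. x k t \<omega>)"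
abbreviation "trajectory \<omega> \<equiv> sddp_trajectory P K D \<theta>0 \<beta>0 (\<lambda>k t. s k t \<omega>) (\<lambda>k t. d k t \<omega>)
           (\<lambda>k t. \<theta> k t \<omega>) (\<lambda>k t. \<beta> k t \<omega>) (\<lambda>k t z. \<beta>' k t z \<omega>) (\<lambda>k t z. \<gamma>' k t z \<omega>) (\<lambda>k t. x k t \<omega>)"

text \<open>A finite superset of the possible samples; it may contain impossible ones, such as a
  process that revives. Every subset of it is measurable.\<close>

definition outcomes :: "(nat \<Rightarrow> 's \<times> real) set" where
  "outcomes = {f \<in> (\<Pi>\<^sub>E t\<in>{1..Tmax P}. S t \<times> {0, 1}). snd (f 1) = 1}"

definition good :: "'a \<Rightarrow> bool" where
  "good \<omega> \<longleftrightarrow> \<omega> \<in> space N \<and> trajectory \<omega> \<and> (\<forall>k\<ge>1. smp k \<omega> \<in> outcomes)"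

lemma prob_space_N: "prob_space N"
  using samples by (simp add: independent_samples_def Let_def)

interpretation N: prob_space N by (rule prob_space_N)

lemma smp_indep: "N.indep_vars (\<lambda>_. E) smp {1..}"
  using samples by (simp add: independent_samples_def Let_def)

lemma smp_measurable: "1 \<le> k \<Longrightarrow> smp k \<in> N \<rightarrow>\<^sub>M E"
  using smp_indep by (auto simp: N.indep_vars_def)

lemma outcome_measurable: "outcome \<in> PS P \<rightarrow>\<^sub>M E"
proof (rule measurable_restrict)
  fix t assume t: "t \<in> {1..Tmax P}"
  note [measurable] = noise_measurable[OF t]
  have "alive P t = (\<lambda>\<omega>. if t < n_stages P \<omega> then 1 else 0)" using t by (auto simp: alive_def)
  then have [measurable]: "alive P t \<in> borel_measurable (PS P)" by simp
  show "(\<lambda>\<omega>. (noise P t \<omega>, alive P t \<omega>)) \<in> borel_measurable (PS P)" by measurable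
qed

lemma smp_prob:
  assumes "1 \<le> k" "A \<in> sets E"
  shows "N.prob (smp k -` A \<inter> space N) = prob (outcome -` A \<inter> space (PS P))"
proof -
  have "distr N E (smp k) = distr (PS P) E outcome"
    using samples assms(1) by (simp add: independent_samples_def Let_def)
  then show ?thesis
    using measure_distr[OF smp_measurable[OF assms(1)] assms(2)] measure_distr[OF outcome_measurable assms(2)]
    by simp
qed

lemma finite_outcomes: "finite outcomes"
proof -
  have "finite (\<Pi>\<^sub>E t\<in>{1..Tmax P}. S t \<times> {0, 1::real})"
    by (intro finite_PiE finite_cartesian_product finite_S) auto
  then show ?thesis unfolding outcomes_def by simp
qed

lemma outcomes_subset_in_sets:
  assumes "A \<subseteq> outcomes"
  shows "A \<in> sets E"
proof (rule finite_in_sets_PiM)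
  show "finite A" using assms finite_outcomes by (rule finite_subset)
  show "A \<subseteq> extensional {1..Tmax P}" using assms by (auto simp: outcomes_def PiE_def)
qed auto

lemma outcome_AE: "AE \<omega> in PS P. outcome \<omega> \<in> outcomes"
  using noise_AE n_stages_AE by eventually_elim (use Tmax_ge2 in \<open>auto simp: outcomes_def alive_def\<close>)

lemma smp_AE: "AE \<omega> in N. \<forall>k\<ge>1. smp k \<omega> \<in> outcomes"
proof -
  have "AE \<omega> in N. smp k \<omega> \<in> outcomes" if k: "1 \<le> k" for k
  proof -
    have O: "outcomes \<in> sets E" by (rule outcomes_subset_in_sets) simp
    have "prob (outcome -` outcomes \<inter> space (PS P)) = 1"
      by (subst prob_eq_1) (use measurable_sets[OF outcome_measurable O] outcome_AE AE_space in \<open>auto elim!: AE_mp\<close>)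
    then have "N.prob (smp k -` outcomes \<inter> space N) = 1" using smp_prob[OF k O] by simp
    then have "AE \<omega> in N. \<omega> \<in> smp k -` outcomes \<inter> space N"
      using measurable_sets[OF smp_measurable[OF k] O] N.prob_eq_1 by blast
    then show ?thesis by eventually_elim auto
  qed
  then show ?thesis by (simp add: AE_all_countable)
qed

lemma good_AE: "AE \<omega> in N. good \<omega>"
  using smp_AE run_AE AE_space
proof eventually_elim
  case (elim \<omega>)
  have "trajectory \<omega>"
    by (intro sddp_trajectory.intro stage_structure_axioms sddp_trajectory_axioms.intro) (rule elim)
  then show ?case using elim by (simp add: good_def)
qed

lemma visits_iff: "visits \<omega> k w \<longleftrightarrow> 1 \<le> k \<and> trail (\<lambda>t. s k t \<omega>) (length w) = w \<and> (\<forall>j\<in>{1..length w}. d k j \<omega> = 1)"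
  by (rule alive_visit_def)

definition visiting :: "'s list \<Rightarrow> (nat \<Rightarrow> 's \<times> real) set" where
  "visiting w = {f \<in> outcomes. trail (\<lambda>t. fst (f t)) (length w) = w \<and> (\<forall>j\<in>{1..length w}. snd (f j) = 1)}"

lemma smp_visiting:
  assumes "1 \<le> k" "length w \<le> Tmax P"
  shows "smp k \<omega> \<in> visiting w \<longleftrightarrow> smp k \<omega> \<in> outcomes \<and> visits \<omega> k w"
proof -
  have "trail (\<lambda>t. fst (smp k \<omega> t)) (length w) = trail (\<lambda>t. s k t \<omega>) (length w)"
    unfolding trail_eq_iff using assms by auto
  then show ?thesis using assms by (auto simp: visiting_def visits_iff)
qed

lemma prob_visiting:
  assumes t: "1 \<le> t" "t \<le> Tmax P" and w: "w \<in> nodes S t" and k: "1 \<le> k"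
  shows "N.prob (smp k -` visiting w \<inter> space N) = \<mu> w * \<rho> t"
proof -
  have len: "length w = t" using w by (rule nodes_length)
  have V: "visiting w \<in> sets E" by (rule outcomes_subset_in_sets) (auto simp: visiting_def)
  have ev: "{\<omega>\<in>space (PS P). tr \<omega> t = w \<and> t < n_stages P \<omega>} \<in> events"
  proof -
    have "{\<omega>\<in>space (PS P). tr \<omega> t = w} \<in> events"
      using noise_alg_event[of t w] indep_setD_ev1[OF noise_alive_indep] t by auto
    then show ?thesis by (auto intro!: sets.sets_Collect_conj)
  qed
  have "N.prob (smp k -` visiting w \<inter> space N) = prob (outcome -` visiting w \<inter> space (PS P))"
    by (rule smp_prob[OF k V])
  also have "\<dots> = \<P>(\<omega> in PS P. tr \<omega> t = w \<and> t < n_stages P \<omega>)"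
  proof (rule finite_measure_eq_AE)
    show "AE \<omega> in PS P. \<omega> \<in> outcome -` visiting w \<inter> space (PS P) \<longleftrightarrow>
        \<omega> \<in> {\<omega>\<in>space (PS P). tr \<omega> t = w \<and> t < n_stages P \<omega>}"
      using outcome_AE
    proof eventually_elim
      case (elim \<omega>)
      have tr: "trail (\<lambda>j. fst (outcome \<omega> j)) t = tr \<omega> t"
        unfolding trail_eq_iff using t by auto
      have "(\<forall>j\<in>{1..t}. snd (outcome \<omega> j) = 1) \<longleftrightarrow> t < n_stages P \<omega>"
      proof
        assume "\<forall>j\<in>{1..t}. snd (outcome \<omega> j) = 1"
        then have "snd (outcome \<omega> t) = 1" using t by auto
        then show "t < n_stages P \<omega>" using t by (auto simp: alive_def split: if_splits)
      qed (use t in \<open>auto simp: alive_def\<close>)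
      then have "outcome \<omega> \<in> visiting w \<longleftrightarrow> tr \<omega> t = w \<and> t < n_stages P \<omega>"
        using elim tr by (simp add: visiting_def len)
      then show ?case by auto
    qed
  qed (use measurable_sets[OF outcome_measurable V] ev in auto)
  also have "\<dots> = \<mu> w * \<rho> t" by (rule prob_trail_alive[OF t(2) w])
  finally show ?thesis .
qed

text \<open>The choices of an iteration are functions of the samples only, so whether iteration \<open>n + 1\<close>, once it
  visits a node, lags there depends on the first \<open>n\<close> samples alone.\<close>

definition lag_histories :: "real \<Rightarrow> 's list \<Rightarrow> 's \<Rightarrow> nat \<Rightarrow> (nat \<Rightarrow> nat \<Rightarrow> 's \<times> real) set" where
  "lag_histories e w z n = {\<lambda>i\<in>{1..n}. smp i \<omega> | \<omega>. good \<omega> \<and> visits \<omega> (Suc n) w \<and> lagging \<omega> e w z (Suc n)}"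

text \<open>The set is a projection of a condition on whole trajectories, so its measurability is
  not evident from the definition; it is finite because each of the \<open>n\<close> samples has
  finitely many outcomes.\<close>

lemma lag_histories_in_sets: "lag_histories e w z n \<in> sets (\<Pi>\<^sub>M i\<in>{1..n}. E)"
proof (rule finite_in_sets_PiM)
  have sub: "lag_histories e w z n \<subseteq> (\<Pi>\<^sub>E i\<in>{1..n}. outcomes)"
    by (auto simp: lag_histories_def good_def)
  then show "finite (lag_histories e w z n)"
    by (rule finite_subset) (auto intro!: finite_PiE finite_outcomes)
  show "lag_histories e w z n \<subseteq> extensional {1..n}" using sub by (auto simp: PiE_def)
  show "{f i} \<in> sets E" if "i \<in> {1..n}" "f \<in> lag_histories e w z n" for i f
    using PiE_mem[of f "{1..n}" "\<lambda>_. outcomes" i] sub that by (intro outcomes_subset_in_sets) auto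
qed simp

lemma eq_of_past_eq:
  assumes \<omega>: "\<omega> \<in> space N" "\<omega>' \<in> space N"
  shows "1 \<le> k \<Longrightarrow> t \<in> {1..Tmax P} \<Longrightarrow>
      (\<And>i j. (i, j) \<in> {1..k - 1} \<times> {1..Tmax P} \<union> {k} \<times> {1..t} \<Longrightarrow> s i j \<omega> = s i j \<omega>' \<and> d i j \<omega> = d i j \<omega>') \<Longrightarrow>
      x k t \<omega> = x k t \<omega>'"
    and "1 \<le> k \<Longrightarrow> t \<in> {2..Tmax P} \<Longrightarrow> z \<in> S t \<Longrightarrow>
      (\<And>i j. (i, j) \<in> {1..k} \<times> {1..Tmax P} \<Longrightarrow> s i j \<omega> = s i j \<omega>' \<and> d i j \<omega> = d i j \<omega>') \<Longrightarrow>
      \<beta>' k t z \<omega> = \<beta>' k t z \<omega>' \<and> \<gamma>' k t z \<omega> = \<gamma>' k t z \<omega>'"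
proof -
  let ?Z = "\<lambda>(i, j) \<omega>. (s i j \<omega>, d i j \<omega>)"
  have fib: "f \<omega> = f \<omega>'" if "f \<in> borel_measurable (sigma_gen_by N I ?Z)"
    "\<And>i j. (i, j) \<in> I \<Longrightarrow> s i j \<omega> = s i j \<omega>' \<and> d i j \<omega> = d i j \<omega>'" for f :: "'a \<Rightarrow> 'v" and I
    by (rule sigma_gen_by_constant_on_fibres[OF that(1) \<omega>]) (use that(2) in auto)
  show "x k t \<omega> = x k t \<omega>'" if "1 \<le> k" "t \<in> {1..Tmax P}"
      "(\<And>i j. (i, j) \<in> {1..k - 1} \<times> {1..Tmax P} \<union> {k} \<times> {1..t} \<Longrightarrow> s i j \<omega> = s i j \<omega>' \<and> d i j \<omega> = d i j \<omega>')"
  proof -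
    have "x k t \<in> borel_measurable (sigma_gen_by N ({1..k - 1} \<times> {1..Tmax P} \<union> {k} \<times> {1..t}) ?Z)"
      using nonant that(1,2) by (auto simp: nonanticipative_def Let_def)
    then show ?thesis by (rule fib) (rule that(3))
  qed
  show "\<beta>' k t z \<omega> = \<beta>' k t z \<omega>' \<and> \<gamma>' k t z \<omega> = \<gamma>' k t z \<omega>'" if "1 \<le> k" "t \<in> {2..Tmax P}" "z \<in> S t"
      "(\<And>i j. (i, j) \<in> {1..k} \<times> {1..Tmax P} \<Longrightarrow> s i j \<omega> = s i j \<omega>' \<and> d i j \<omega> = d i j \<omega>')"
  proof -
    have "\<beta>' k t z \<in> borel_measurable (sigma_gen_by N ({1..k} \<times> {1..Tmax P}) ?Z)"
      "\<gamma>' k t z \<in> borel_measurable (sigma_gen_by N ({1..k} \<times> {1..Tmax P}) ?Z)"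
      using nonant that(1-3) by (auto simp: nonanticipative_def Let_def)
    then show ?thesis using fib[of "\<beta>' k t z"] fib[of "\<gamma>' k t z"] that(4) by blast
  qed
qed

text \<open>From right to left, the history comes from another trajectory that also visits
  \<open>w\<close> at iteration \<open>Suc n\<close>. The visit fixes the samples of that iteration
  up to the stage of \<open>w\<close>, so both trajectories have the same cuts up to
  \<open>n\<close> and the same trial point at \<open>w\<close>, and hence lag alike.\<close>

lemma lagging_iff_history:
  assumes \<omega>: "good \<omega>" and vis: "visits \<omega> (Suc n) w" and t: "1 \<le> length w" "Suc (length w) \<le> Tmax P"
  shows "lagging \<omega> e w z (Suc n) \<longleftrightarrow> (\<lambda>i\<in>{1..n}. smp i \<omega>) \<in> lag_histories e w z n"
proof
  assume "lagging \<omega> e w z (Suc n)"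
  then show "(\<lambda>i\<in>{1..n}. smp i \<omega>) \<in> lag_histories e w z n"
    using \<omega> vis unfolding lag_histories_def by blast
next
  assume "(\<lambda>i\<in>{1..n}. smp i \<omega>) \<in> lag_histories e w z n"
  then obtain \<omega>' where \<omega>': "good \<omega>'" "visits \<omega>' (Suc n) w" "lagging \<omega>' e w z (Suc n)"
    and h: "(\<lambda>i\<in>{1..n}. smp i \<omega>) = (\<lambda>i\<in>{1..n}. smp i \<omega>')"
    unfolding lag_histories_def by blast
  have past: "s i j \<omega> = s i j \<omega>' \<and> d i j \<omega> = d i j \<omega>'" if "i \<in> {1..n}" "j \<in> {1..Tmax P}" for i j
    using fun_cong[OF fun_cong[OF h], of i j] that by simp
  have "trail (\<lambda>t. s (Suc n) t \<omega>) (length w) = trail (\<lambda>t. s (Suc n) t \<omega>') (length w)"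
    using vis \<omega>'(2) by (simp add: visits_iff)
  then have now: "s (Suc n) j \<omega> = s (Suc n) j \<omega>' \<and> d (Suc n) j \<omega> = d (Suc n) j \<omega>'" if "j \<in> {1..length w}" for j
    using vis \<omega>'(2) that by (auto simp: visits_iff trail_eq_iff)
  have sp: "\<omega> \<in> space N" "\<omega>' \<in> space N" using \<omega> \<omega>' by (auto simp: good_def)
  interpret T: sddp_trajectory P K D \<theta>0 \<beta>0 "\<lambda>k t. s k t \<omega>" "\<lambda>k t. d k t \<omega>" "\<lambda>k t. \<theta> k t \<omega>" "\<lambda>k t. \<beta> k t \<omega>"
    "\<lambda>k t z. \<beta>' k t z \<omega>" "\<lambda>k t z. \<gamma>' k t z \<omega>" "\<lambda>k t. x k t \<omega>"
    using \<omega> by (simp add: good_def)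
  interpret T': sddp_trajectory P K D \<theta>0 \<beta>0 "\<lambda>k t. s k t \<omega>'" "\<lambda>k t. d k t \<omega>'" "\<lambda>k t. \<theta> k t \<omega>'" "\<lambda>k t. \<beta> k t \<omega>'"
    "\<lambda>k t z. \<beta>' k t z \<omega>'" "\<lambda>k t z. \<gamma>' k t z \<omega>'" "\<lambda>k t. x k t \<omega>'"
    using \<omega>' by (simp add: good_def)
  have x: "x (Suc n) (length w) \<omega> = x (Suc n) (length w) \<omega>'"
    by (rule eq_of_past_eq(1)[OF sp]) (use past now t in auto)
  have cuts: "\<theta> j t \<omega> = \<theta> j t \<omega>' \<and> \<beta> j t \<omega> = \<beta> j t \<omega>'" if "j \<le> n" "t \<in> {2..Tmax P}" for j t
  proof (rule cuts_determined[OF T.run T'.run _ _ _ that(2,1)])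
    fix j t assume j: "1 \<le> j" "j \<le> n"
    show "x j t \<omega> = x j t \<omega>'" if "t \<in> {1..Tmax P}"
      by (rule eq_of_past_eq(1)[OF sp j(1) that]) (use past j that in auto)
    show "\<beta>' j t z \<omega> = \<beta>' j t z \<omega>'" "\<gamma>' j t z \<omega> = \<gamma>' j t z \<omega>'" if "t \<in> {2..Tmax P}" "z \<in> S t" for z
      using eq_of_past_eq(2)[OF sp j(1) that] past j by auto
  qed
  have "approx P (\<lambda>k t. \<theta> k t \<omega>) (\<lambda>k t. \<beta> k t \<omega>) n (Suc (Suc (length w))) =
      approx P (\<lambda>k t. \<theta> k t \<omega>') (\<lambda>k t. \<beta> k t \<omega>') n (Suc (Suc (length w)))"
    by (rule approx_cong) (rule cuts, auto)
  then show "lagging \<omega> e w z (Suc n)"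
    using \<omega>'(3) x by (simp add: T.lagging_def T'.lagging_def)
qed

text \<open>Applied with \<open>lag_histories\<close> as the event known from the past and a visit
  to \<open>z # w\<close> as the hit. The visit to \<open>w\<close> itself is not known from the
  past, but it is contained in the hit, whose probability is positive, the same at all iterations,
  and independent of the history.\<close>

lemma lagging_infinitely_often:
  assumes t: "1 \<le> t" "Suc t < Tmax P" and w: "w \<in> nodes S t" and z: "z \<in> S (Suc t)"
  shows "AE \<omega> in N. (\<exists>\<^sub>F k in sequentially. visits \<omega> k w \<and> lagging \<omega> e w z k) \<longrightarrow>
     (\<exists>\<^sub>F k in sequentially. visits \<omega> k (z # w) \<and> lagging \<omega> e w z k)"
proof -
  have zw: "z # w \<in> nodes S (Suc t)" using w z by auto
  have len: "length w = t" using w by (rule nodes_length)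
  have V: "visiting (z # w) \<in> sets E" by (rule outcomes_subset_in_sets) (auto simp: visiting_def)
  have pos: "0 < \<mu> (z # w) * \<rho> (Suc t)"
    using node_prob_pos[OF _ zw] \<rho>_pos[OF t(2)] t by simp
  have "AE \<omega> in N. (\<exists>\<^sub>F n in sequentially. (\<lambda>i\<in>{1..n}. smp i \<omega>) \<in> lag_histories e w z n) \<longrightarrow>
     (\<exists>\<^sub>F n in sequentially. (\<lambda>i\<in>{1..n}. smp i \<omega>) \<in> lag_histories e w z n \<and> smp (Suc n) \<omega> \<in> visiting (z # w))"
    by (rule N.past_determined_infinitely_often[OF smp_indep V _ pos lag_histories_in_sets])
      (use prob_visiting[OF _ _ zw] t in auto)
  then show ?thesis
    using good_AE
  proof eventually_elim
    case (elim \<omega>)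
    have shift: "(\<exists>\<^sub>F k in sequentially. R k) \<longleftrightarrow> (\<exists>\<^sub>F n in sequentially. R (Suc n))" for R
      using eventually_sequentially_Suc[of "\<lambda>k. \<not> R k"] by (simp add: frequently_def)
    show ?case
    proof
      assume "\<exists>\<^sub>F k in sequentially. visits \<omega> k w \<and> lagging \<omega> e w z k"
      then have "\<exists>\<^sub>F n in sequentially. visits \<omega> (Suc n) w \<and> lagging \<omega> e w z (Suc n)"
        by (subst (asm) shift)
      then have "\<exists>\<^sub>F n in sequentially. (\<lambda>i\<in>{1..n}. smp i \<omega>) \<in> lag_histories e w z n"
        by (rule frequently_elim1) (use lagging_iff_history[OF elim(2)] len t in auto)
      with elim(1) have "\<exists>\<^sub>F n in sequentially. (\<lambda>i\<in>{1..n}. smp i \<omega>) \<in> lag_histories e w z n \<and> smp (Suc n) \<omega> \<in> visiting (z # w)"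
        by blast
      then have "\<exists>\<^sub>F n in sequentially. visits \<omega> (Suc n) (z # w) \<and> lagging \<omega> e w z (Suc n)"
      proof (rule frequently_elim1)
        fix n assume n: "(\<lambda>i\<in>{1..n}. smp i \<omega>) \<in> lag_histories e w z n \<and> smp (Suc n) \<omega> \<in> visiting (z # w)"
        then have v: "visits \<omega> (Suc n) (z # w)" using smp_visiting[of "Suc n" "z # w" \<omega>] len t by auto
        then have "visits \<omega> (Suc n) w" by (auto simp: visits_iff)
        then show "visits \<omega> (Suc n) (z # w) \<and> lagging \<omega> e w z (Suc n)"
          using n v lagging_iff_history[OF elim(2), of n w] len t by auto
      qed
      then show "\<exists>\<^sub>F k in sequentially. visits \<omega> k (z # w) \<and> lagging \<omega> e w z k"
        by (subst shift)
    qed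
  qed
qed

lemma gap_tendsto:
  assumes "1 \<le> t" "t < Tmax P"
  shows "AE \<omega> in N. \<forall>w\<in>nodes S t. \<forall>e>0. \<forall>\<^sub>F k in sequentially. visits \<omega> k w \<longrightarrow> gap \<omega> k t < e"
proof -
  have "t \<le> Tmax P - 1" using assms by simp
  then show ?thesis
    using assms(1)
  proof (induction t rule: inc_induct)
    case base
    show ?case
      using good_AE
    proof eventually_elim
      case (elim \<omega>)
      interpret T: sddp_trajectory P K D \<theta>0 \<beta>0 "\<lambda>k t. s k t \<omega>" "\<lambda>k t. d k t \<omega>" "\<lambda>k t. \<theta> k t \<omega>" "\<lambda>k t. \<beta> k t \<omega>"
        "\<lambda>k t z. \<beta>' k t z \<omega>" "\<lambda>k t z. \<gamma>' k t z \<omega>" "\<lambda>k t. x k t \<omega>"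
        using elim by (simp add: good_def)
      \<comment> \<open>For decisions of stage \<open>Tmax P - 1\<close> the absence of lag is
        required for no \<open>z\<close>.\<close>
      show ?case
        using T.gap_tendsto_of_nolag[of "Tmax P - 1"] Tmax_ge2 by auto
    qed
  next
    case (step t)
    \<comment> \<open>Countably many thresholds suffice, since a lag by \<open>e\<close> is a lag by
      every smaller amount; this yields one null set for all \<open>e\<close>.\<close>
    have "AE \<omega> in N. \<forall>n. \<forall>w\<in>nodes S t. \<forall>z\<in>S (Suc t).
      (\<exists>\<^sub>F k in sequentially. visits \<omega> k w \<and> lagging \<omega> (1 / real (Suc n)) w z k) \<longrightarrow>
      (\<exists>\<^sub>F k in sequentially. visits \<omega> k (z # w) \<and> lagging \<omega> (1 / real (Suc n)) w z k)"
    proof -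
      have fin: "finite (nodes S t)" "finite (S (Suc t))"
        using step.hyps by (auto intro!: finite_nodes_S finite_S)
      show ?thesis
        unfolding AE_all_countable AE_finite_all[OF fin(1)] AE_finite_all[OF fin(2)]
        using lagging_infinitely_often step by (intro allI ballI) auto
    qed
    moreover have "AE \<omega> in N. \<forall>w\<in>nodes S (Suc t). \<forall>e>0. \<forall>\<^sub>F k in sequentially. visits \<omega> k w \<longrightarrow> gap \<omega> k (Suc t) < e"
      using step by auto
    ultimately show ?case
      using good_AE
    proof eventually_elim
      case (elim \<omega>)
      interpret T: sddp_trajectory P K D \<theta>0 \<beta>0 "\<lambda>k t. s k t \<omega>" "\<lambda>k t. d k t \<omega>" "\<lambda>k t. \<theta> k t \<omega>" "\<lambda>k t. \<beta> k t \<omega>"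
        "\<lambda>k t z. \<beta>' k t z \<omega>" "\<lambda>k t z. \<gamma>' k t z \<omega>" "\<lambda>k t. x k t \<omega>"
        using elim by (simp add: good_def)
      have tT: "t < Tmax P" using step.hyps by simp
      show ?case
      proof (intro ballI allI impI)
        fix w and e :: real assume w: "w \<in> nodes S t" and e: "0 < e"
        show "\<forall>\<^sub>F k in sequentially. visits \<omega> k w \<longrightarrow> gap \<omega> k t < e"
        proof (rule T.gap_tendsto_of_nolag[OF step.prems tT w _ e])
          fix z and e :: real assume z: "z \<in> S (Suc t)" and e: "0 < e"
          obtain n where n: "1 / real (Suc n) < e" using reals_Archimedean[OF e] by (auto simp: inverse_eq_divide)
          let ?e = "1 / real (Suc n)"
          have zw: "z # w \<in> nodes S (Suc t)" using w z by auto
          have "\<forall>\<^sub>F k in sequentially. visits \<omega> k (z # w) \<longrightarrow> gap \<omega> k (Suc t) < ?e"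
            using bspec[OF elim(2) zw] by simp
          then have "\<forall>\<^sub>F k in sequentially. \<not> (visits \<omega> k (z # w) \<and> lagging \<omega> ?e w z k)"
            by eventually_elim (use T.lagging_gap[OF step.prems tT w z] in fastforce)
          then have "\<not> (\<exists>\<^sub>F k in sequentially. visits \<omega> k (z # w) \<and> lagging \<omega> ?e w z k)"
            by (simp add: frequently_def)
          then have "\<not> (\<exists>\<^sub>F k in sequentially. visits \<omega> k w \<and> lagging \<omega> ?e w z k)"
            using elim(1) w z by blast
          then have "\<forall>\<^sub>F k in sequentially. \<not> (visits \<omega> k w \<and> lagging \<omega> ?e w z k)"
            by (simp add: frequently_def)
          then show "\<forall>\<^sub>F k in sequentially. visits \<omega> k w \<longrightarrow> \<not> lagging \<omega> e w z k"
          proof eventually_elim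
            case (elim k)
            have "lagging \<omega> ?e w z k" if "lagging \<omega> e w z k"
              using that n unfolding T.lagging_def by (rule_tac order_less_trans) (auto intro: order_less_trans)
            then show ?case using elim by blast
          qed
        qed
      qed
    qed
  qed
qed

theorem convergence:
  "\<forall>t\<in>{2..Tmax P + 1}. \<forall>k. AE \<omega> in N. \<forall>y. ereal (approx P (\<lambda>k t. \<theta> k t \<omega>) (\<lambda>k t. \<beta> k t \<omega>) k t y) \<le> cost_to_go P t y"
  "\<forall>k\<ge>1. AE \<omega> in N. lower_bound P (\<lambda>k t. \<theta> k t \<omega>) (\<lambda>k t. \<beta> k t \<omega>) k \<le> optimal_value P"
  "AE \<omega> in N. (\<lambda>k. cost P 1 (x k 1 \<omega>) (x_init P) (noise1 P)
              + ereal (approx P (\<lambda>k t. \<theta> k t \<omega>) (\<lambda>k t. \<beta> k t \<omega>) k 2 (x k 1 \<omega>))) \<longlonglongrightarrow> optimal_value P"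
proof -
  have traj: "AE \<omega> in N. trajectory \<omega>" using good_AE by eventually_elim (simp add: good_def)
  show "\<forall>t\<in>{2..Tmax P + 1}. \<forall>k. AE \<omega> in N. \<forall>y. ereal (approx P (\<lambda>k t. \<theta> k t \<omega>) (\<lambda>k t. \<beta> k t \<omega>) k t y) \<le> cost_to_go P t y"
  proof (intro ballI allI)
    fix t k assume t: "t \<in> {2..Tmax P + 1}"
    obtain t' where t': "t = Suc t'" using t by (cases t) auto
    show "AE \<omega> in N. \<forall>y. ereal (approx P (\<lambda>k t. \<theta> k t \<omega>) (\<lambda>k t. \<beta> k t \<omega>) k t y) \<le> cost_to_go P t y"
      using traj
    proof eventually_elim
      case (elim \<omega>)
      then show ?case using sddp_trajectory.approx_le_Q[OF elim, of t'] t t' by auto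
    qed
  qed
  show "\<forall>k\<ge>1. AE \<omega> in N. lower_bound P (\<lambda>k t. \<theta> k t \<omega>) (\<lambda>k t. \<beta> k t \<omega>) k \<le> optimal_value P"
  proof (intro allI impI)
    fix k :: nat
    show "AE \<omega> in N. lower_bound P (\<lambda>k t. \<theta> k t \<omega>) (\<lambda>k t. \<beta> k t \<omega>) k \<le> optimal_value P"
      using traj by eventually_elim (rule sddp_trajectory.lower_bound_le_optimal_value)
  qed
  have "AE \<omega> in N. \<forall>w\<in>nodes S 1. \<forall>e>0. \<forall>\<^sub>F k in sequentially. visits \<omega> k w \<longrightarrow> gap \<omega> k 1 < e"
    using gap_tendsto[of 1] Tmax_ge2 by simp
  then show "AE \<omega> in N. (\<lambda>k. cost P 1 (x k 1 \<omega>) (x_init P) (noise1 P)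
              + ereal (approx P (\<lambda>k t. \<theta> k t \<omega>) (\<lambda>k t. \<beta> k t \<omega>) k 2 (x k 1 \<omega>))) \<longlonglongrightarrow> optimal_value P"
    using good_AE
  proof eventually_elim
    case (elim \<omega>)
    interpret T: sddp_trajectory P K D \<theta>0 \<beta>0 "\<lambda>k t. s k t \<omega>" "\<lambda>k t. d k t \<omega>" "\<lambda>k t. \<theta> k t \<omega>" "\<lambda>k t. \<beta> k t \<omega>"
      "\<lambda>k t z. \<beta>' k t z \<omega>" "\<lambda>k t z. \<gamma>' k t z \<omega>" "\<lambda>k t. x k t \<omega>"
      using elim by (simp add: good_def)
    show ?case
    proof (rule T.first_stage_limit)
      fix k :: nat assume k: "1 \<le> k"
      have "smp k \<omega> \<in> outcomes" using elim(2) k by (simp add: good_def)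
      then have "smp k \<omega> 1 \<in> S 1 \<times> {0, 1}" "snd (smp k \<omega> 1) = 1"
        using Tmax_ge2 by (auto simp: outcomes_def PiE_def Pi_def)
      \<comment> \<open>The first noise is deterministic and the process survives stage 1, so the
        only node of that stage is visited at every iteration.\<close>
      then show "visits \<omega> k [noise1 P]"
        using k Tmax_ge2 S_1 by (auto simp: visits_iff)
    next
      fix e :: real assume "0 < e"
      then show "\<forall>\<^sub>F k in sequentially. visits \<omega> k [noise1 P] \<longrightarrow> gap \<omega> k 1 < e"
        using elim(1) S_1 by auto
    qed
  qed
qed

end

section \<open>Linear and nonlinear problems\<close>

text \<open>Around a point of \<open>W\<close>, a small cube is the convex hull of its finitely many
  vertices. Points of \<open>T\<close> chosen above the vertices span a subset of \<open>T\<close>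
  that projects onto the cube, and by convexity \<open>f\<close> is bounded there by its maximum
  over the chosen points. Compactness of \<open>D\<close> makes the bound uniform.\<close>

lemma bounded_selection:
  fixes T :: "('u::euclidean_space \<times> 'v::euclidean_space) set" and f :: "'u \<times> 'v \<Rightarrow> real"
  assumes D: "compact D" "D \<subseteq> W" and W: "open W" and T: "convex T"
    and sel: "\<And>y. y \<in> W \<Longrightarrow> \<exists>x. (x, y) \<in> T" and f: "convex_on T f"
  shows "\<exists>M. \<forall>y\<in>D. \<exists>x. (x, y) \<in> T \<and> f (x, y) \<le> M"
proof -
  have local: "\<exists>\<delta>>0. \<exists>M. \<forall>p\<in>ball y \<delta>. \<exists>x. (x, p) \<in> T \<and> f (x, p) \<le> M" if y: "y \<in> W" for y
  proof -
    obtain r where r: "r > 0" "cball y r \<subseteq> W"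
      using W y open_contains_cball by blast
    \<comment> \<open>Half-side of a cube that fits into the ball of radius \<open>r\<close>, by
      comparison with the sum norm.\<close>
    define \<delta> where "\<delta> = r / real (DIM('v))"
    have \<delta>: "\<delta> > 0" using r by (simp add: \<delta>_def)
    let ?cube = "cbox (y - sum ((*\<^sub>R) \<delta>) Basis) (y + sum ((*\<^sub>R) \<delta>) Basis)"
    obtain F where F: "finite F" "?cube = convex hull F"
      using cube_convex_hull[OF \<delta>, of y] by blast
    have comp: "sum ((*\<^sub>R) \<delta>) Basis \<bullet> i = \<delta>" if "i \<in> Basis" for i :: 'v
      using that by (simp add: inner_sum_left inner_Basis if_distrib sum.delta cong: if_cong)
    have cube: "?cube \<subseteq> W"
    proof
      fix v assume "v \<in> ?cube"
      then have "\<bar>(v - y) \<bullet> i\<bar> \<le> \<delta>" if "i \<in> Basis" for i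
        using that comp[OF that] by (auto simp: mem_box inner_diff_left inner_add_left abs_le_iff algebra_simps)
      then have "norm (v - y) \<le> (\<Sum>i\<in>(Basis::'v set). \<delta>)"
        by (intro order_trans[OF norm_le_l1] sum_mono) auto
      then have "v \<in> cball y r" by (simp add: \<delta>_def dist_norm norm_minus_commute)
      then show "v \<in> W" using r by blast
    qed
    have ball: "ball y \<delta> \<subseteq> ?cube"
    proof
      fix v assume "v \<in> ball y \<delta>"
      then have "\<bar>(v - y) \<bullet> i\<bar> \<le> \<delta>" if "i \<in> Basis" for i
        using Basis_le_norm[OF that, of "v - y"] by (simp add: dist_norm norm_minus_commute)
      then show "v \<in> ?cube"
        using comp by (auto simp: mem_box inner_diff_left inner_add_left abs_le_iff algebra_simps)
    qed
    have "\<forall>v\<in>F. \<exists>x. (x, v) \<in> T"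
      using sel cube hull_subset[of F convex] unfolding F(2) by blast
    then obtain h where h: "\<And>v. v \<in> F \<Longrightarrow> (h v, v) \<in> T" by metis
    define G where "G = (\<lambda>v. (h v, v)) ` F"
    have GT: "convex hull G \<subseteq> T" using h T by (intro hull_minimal) (auto simp: G_def)
    define M where "M = Max (f ` G)"
    have "\<forall>g\<in>G. f g \<le> M" unfolding M_def G_def using F by auto
    then have M: "\<forall>g\<in>convex hull G. f g \<le> M"
      by (intro convex_on_convex_hull_bound convex_on_subset[OF f GT]) auto
    have "snd ` G = F" by (force simp: G_def)
    then have hull: "?cube = snd ` (convex hull G)"
      unfolding F(2) by (simp add: convex_hull_linear_image linear_snd)
    have "\<forall>p\<in>ball y \<delta>. \<exists>x. (x, p) \<in> T \<and> f (x, p) \<le> M"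
    proof
      fix p assume "p \<in> ball y \<delta>"
      then have "p \<in> snd ` (convex hull G)" using ball hull by blast
      then obtain x where "(x, p) \<in> convex hull G" by auto
      then show "\<exists>x. (x, p) \<in> T \<and> f (x, p) \<le> M" using GT M by blast
    qed
    then show ?thesis using \<delta> by blast
  qed
  then obtain \<delta> M where \<delta>M: "\<And>y. y \<in> W \<Longrightarrow> \<delta> y > 0"
    "\<And>y p. y \<in> W \<Longrightarrow> p \<in> ball y (\<delta> y) \<Longrightarrow> \<exists>x. (x, p) \<in> T \<and> f (x, p) \<le> M y"
    by metis
  have "D \<subseteq> (\<Union>y\<in>D. ball y (\<delta> y))" using \<delta>M(1) D(2) by force
  then obtain C where C: "C \<subseteq> D" "finite C" "D \<subseteq> (\<Union>y\<in>C. ball y (\<delta> y))"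
    using compactE_image[OF D(1), of D "\<lambda>y. ball y (\<delta> y)"] by (metis open_ball)
  have "\<exists>x. (x, p) \<in> T \<and> f (x, p) \<le> Max (M ` C)" if p: "p \<in> D" for p
  proof -
    obtain y where y: "y \<in> C" "p \<in> ball y (\<delta> y)" using C p by blast
    then obtain x where "(x, p) \<in> T" "f (x, p) \<le> M y" using \<delta>M(2) C D by blast
    moreover have "M y \<le> Max (M ` C)" using C y by simp
    ultimately show ?thesis by (meson order_trans)
  qed
  then show ?thesis by blast
qed

lemma convex_on_sublevel:
  assumes "convex_on S f"
  shows "convex {x\<in>S. f x \<le> c}"
proof (rule convexI)
  fix x y u v assume *: "x \<in> {x\<in>S. f x \<le> c}" "y \<in> {x\<in>S. f x \<le> c}" "0 \<le> u" "0 \<le> v" "u + v = (1::real)"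
  then have "f (u *\<^sub>R x + v *\<^sub>R y) \<le> u * f x + v * f y"
    using assms by (simp add: convex_on_def)
  also have "\<dots> \<le> u * c + v * c" using * by (intro add_mono mult_left_mono) auto
  also have "\<dots> = c" using * by (simp add: distrib_right[symmetric])
  finally show "u *\<^sub>R x + v *\<^sub>R y \<in> {x\<in>S. f x \<le> c}"
    using * convex_on_imp_convex[OF assms] by (simp add: convexD)
qed

section \<open>Polytopes and linear problems\<close>

lemma polyhedron_snd_vimage:
  fixes S :: "'v::euclidean_space set"
  assumes "polyhedron S"
  shows "polyhedron {q :: 'u::euclidean_space \<times> 'v. snd q \<in> S}"
proof -
  obtain F where F: "finite F" "S = \<Inter>F" "\<forall>h\<in>F. \<exists>a b. a \<noteq> 0 \<and> h = {x. a \<bullet> x \<le> b}"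
    using assms(1) unfolding polyhedron_def by (elim exE conjE)
  have "polyhedron (\<Inter>h\<in>F. {q :: 'u \<times> 'v. snd q \<in> h})"
  proof (rule polyhedron_Inter)
    fix H assume "H \<in> (\<lambda>h. {q :: 'u \<times> 'v. snd q \<in> h}) ` F"
    then obtain h where h: "h \<in> F" "H = {q. snd q \<in> h}" by (elim imageE)
    from bspec[OF F(3) h(1)] obtain a b where "h = {x. a \<bullet> x \<le> b}" by (elim exE conjE)
    with h have "H = {q. snd q \<in> {x. a \<bullet> x \<le> b}}" by simp
    then have "H = {q. (0, a) \<bullet> q \<le> b}" by (auto simp: inner_prod_def)
    then show "polyhedron H" by (simp add: polyhedron_halfspace_le)
  qed (use F in simp)
  also have "(\<Inter>h\<in>F. {q :: 'u \<times> 'v. snd q \<in> h}) = {q. snd q \<in> S}" using F by auto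
  finally show ?thesis .
qed

text \<open>For each of the finitely many half-spaces, either \<open>l\<close> lies on the bounding
  hyperplane, and a ray towards a point of the half-space never leaves it, or \<open>l\<close> has
  positive distance from the hyperplane, and any step up to that distance is safe. For a general
  convex set such a length need not exist at a boundary point.\<close>

lemma polyhedron_ray:
  fixes S :: "'v::euclidean_space set"
  assumes "polyhedron S" and l: "l \<in> S"
  shows "\<exists>r>0. \<forall>v\<in>S. v \<noteq> l \<longrightarrow> l + (r / norm (v - l)) *\<^sub>R (v - l) \<in> S"
proof -
  obtain F where F: "finite F" "S = \<Inter>F" "\<forall>h\<in>F. \<exists>a b. a \<noteq> 0 \<and> h = {x. a \<bullet> x \<le> b}"
    using assms(1) unfolding polyhedron_def by (elim exE conjE)
  \<comment> \<open>Stated for all smaller lengths so that the minimum over the half-spaces can be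
    taken.\<close>
  have "\<exists>r>0. \<forall>r'. 0 < r' \<longrightarrow> r' \<le> r \<longrightarrow> (\<forall>v\<in>h. v \<noteq> l \<longrightarrow> l + (r' / norm (v - l)) *\<^sub>R (v - l) \<in> h)" if h: "h \<in> F" for h
  proof -
    from bspec[OF F(3) h] obtain a b where ab: "a \<noteq> 0" "h = {x. a \<bullet> x \<le> b}" by (elim exE conjE)
    have lb: "a \<bullet> l \<le> b" using l h F(2) ab by auto
    show ?thesis
    proof (cases "a \<bullet> l = b")
      case True
      have "a \<bullet> (l + (r' / norm (v - l)) *\<^sub>R (v - l)) \<le> b" if "0 < r'" "a \<bullet> v \<le> b" for r' v
      proof -
        have "(r' / norm (v - l)) * (a \<bullet> (v - l)) \<le> 0"
          using that True by (intro mult_nonneg_nonpos) (auto simp: inner_diff_right)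
        then show ?thesis using True by (simp add: inner_add_right)
      qed
      then show ?thesis unfolding ab mem_Collect_eq by (intro exI[of _ 1] conjI allI impI ballI) simp_all
    next
      case False
      define r where "r = (b - a \<bullet> l) / norm a"
      have r: "r > 0" using False lb ab by (simp add: r_def)
      have "a \<bullet> (l + (r' / norm (v - l)) *\<^sub>R (v - l)) \<le> b" if "0 < r'" "r' \<le> r" "v \<noteq> l" for r' v
      proof -
        have "(r' / norm (v - l)) * (a \<bullet> (v - l)) \<le> (r' / norm (v - l)) * (norm a * norm (v - l))"
          using that by (intro mult_left_mono norm_cauchy_schwarz) auto
        also have "\<dots> = r' * norm a" using that by simp
        also have "\<dots> \<le> r * norm a" using that by (intro mult_right_mono) auto
        also have "\<dots> = b - a \<bullet> l" using ab by (simp add: r_def)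
        finally show ?thesis by (simp add: inner_add_right)
      qed
      then show ?thesis unfolding ab using r by (intro exI[of _ r] conjI allI impI ballI) simp_all
    qed
  qed
  then have "\<forall>h\<in>F. \<exists>r. 0 < r \<and> (\<forall>r'. 0 < r' \<longrightarrow> r' \<le> r \<longrightarrow> (\<forall>v\<in>h. v \<noteq> l \<longrightarrow> l + (r' / norm (v - l)) *\<^sub>R (v - l) \<in> h))"
    by (rule ballI)
  from bchoice[OF this] obtain r where
    "\<forall>h\<in>F. 0 < r h \<and> (\<forall>r'. 0 < r' \<longrightarrow> r' \<le> r h \<longrightarrow> (\<forall>v\<in>h. v \<noteq> l \<longrightarrow> l + (r' / norm (v - l)) *\<^sub>R (v - l) \<in> h))" ..
  then have r: "\<And>h. h \<in> F \<Longrightarrow> r h > 0"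
    "\<And>h r' v. h \<in> F \<Longrightarrow> 0 < r' \<Longrightarrow> r' \<le> r h \<Longrightarrow> v \<in> h \<Longrightarrow> v \<noteq> l \<Longrightarrow> l + (r' / norm (v - l)) *\<^sub>R (v - l) \<in> h"
    by simp_all
  define r0 where "r0 = Min (insert 1 (r ` F))"
  have "r0 > 0" unfolding r0_def using F(1) r(1) by auto
  moreover have "r0 \<le> r h" if "h \<in> F" for h unfolding r0_def using F(1) that by auto
  moreover have "l + (r0 / norm (v - l)) *\<^sub>R (v - l) \<in> S" if "v \<in> S" "v \<noteq> l" for v
    unfolding F(2) using that F(2) calculation by (intro InterI r(2)) blast+
  ultimately show ?thesis by blast
qed

text \<open>A nonnegative kernel vector is a recession direction of the feasible set, and a bounded
  set has none but 0.\<close>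

lemma nonneg_kernel_trivial:
  fixes A :: "real^'n^'m"
  assumes bdd: "bounded {x. A *v x = a \<and> (\<forall>i. 0 \<le> x $ i)}" and x0: "A *v x0 = a" "\<forall>i. 0 \<le> x0 $ i"
    and x: "A *v x = 0" "\<forall>i. 0 \<le> x $ i"
  shows "x = 0"
proof (rule ccontr)
  assume "x \<noteq> 0"
  obtain M where M: "\<And>y. A *v y = a \<Longrightarrow> (\<forall>i. 0 \<le> y $ i) \<Longrightarrow> norm y \<le> M"
    using bdd unfolding bounded_iff by blast
  \<comment> \<open>Chosen so that \<open>c *\<^sub>R x\<close> has norm
    \<open>M + norm x0 + 1\<close>, which puts \<open>x0 + c *\<^sub>R x\<close> outside the ball of
    radius \<open>M\<close>.\<close>
  define c where "c = (M + norm x0 + 1) / norm x"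
  have M0: "0 \<le> M" using order_trans[OF norm_ge_zero M[OF x0]] .
  have c: "0 \<le> c" using M0 by (simp add: c_def)
  have "norm (x0 + c *\<^sub>R x) \<le> M"
    by (rule M) (use x0 x c in \<open>auto simp: matrix_vector_right_distrib matrix_vector_mult_scaleR\<close>)
  moreover have "norm (c *\<^sub>R x) = M + norm x0 + 1"
    using \<open>x \<noteq> 0\<close> M0 by (simp add: c_def)
  moreover have "norm (c *\<^sub>R x) \<le> norm (x0 + c *\<^sub>R x) + norm x0"
    using norm_triangle_ineq4[of "x0 + c *\<^sub>R x" x0] by simp
  ultimately show False by simp
qed

text \<open>The constant is the minimum of \<open>norm (A *v x)\<close> over the nonnegative unit
  vectors: attained by compactness, positive by \<open>ker\<close>, and extended to all nonnegative
  vectors by homogeneity.\<close>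

lemma nonneg_kernel_bound:
  fixes A :: "real^'n^'m"
  assumes ker: "\<And>x. A *v x = 0 \<Longrightarrow> (\<forall>i. 0 \<le> x $ i) \<Longrightarrow> x = 0"
  shows "\<exists>c>0. \<forall>x. (\<forall>i. 0 \<le> x $ i) \<longrightarrow> c * norm x \<le> norm (A *v x)"
proof -
  let ?C = "sphere 0 1 \<inter> (\<Inter>i. {x :: real^'n. 0 \<le> x $ i})"
  have cl: "closed (\<Inter>i. {x :: real^'n. 0 \<le> x $ i})"
    by (intro closed_INT ballI closed_Collect_le continuous_intros)
  have C: "compact ?C" using cl by (intro compact_Int_closed) auto
  have "axis undefined 1 \<in> ?C" by (auto simp: axis_def norm_axis_1[unfolded axis_def])
  then have ne: "?C \<noteq> {}" by blast
  have "continuous_on ?C (\<lambda>x. norm (A *v x))"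
    by (intro continuous_on_norm matrix_vector_mult_linear_continuous_on)
  from continuous_attains_inf[OF C ne this] obtain m
    where m: "m \<in> ?C" "\<forall>x\<in>?C. norm (A *v m) \<le> norm (A *v x)"
    by (elim bexE)
  have "A *v m \<noteq> 0" using ker[of m] m(1) by auto
  then have pos: "0 < norm (A *v m)" by simp
  have "norm (A *v m) * norm x \<le> norm (A *v x)" if x: "\<forall>i. 0 \<le> x $ i" for x
  proof (cases "x = 0")
    case False
    have "(1 / norm x) *\<^sub>R x \<in> ?C" using False x by auto
    from bspec[OF m(2) this] have "norm (A *v m) \<le> norm (A *v x) / norm x"
      by (simp add: matrix_vector_mult_scaleR)
    then show ?thesis using False by (simp add: field_simps)
  qed simp
  then show ?thesis using pos by blast
qed

text \<open>The set is the projection of the polyhedron \<open>T\<close> of pairs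
  \<open>(x, y)\<close>. Boundedness of each fibre does not by itself bound the union; but the
  recession directions of a fibre do not depend on \<open>y\<close>, so one bounded fibre makes the
  nonnegative kernel of \<open>A\<close> trivial, and the resulting estimate is uniform in
  \<open>y\<close>.\<close>

lemma polytope_next_stage:
  fixes A B :: "real^'n^'m" and K :: "(real^'n) set"
  assumes K: "polytope K" "K \<noteq> {}"
    and feas: "\<And>y. y \<in> K \<Longrightarrow> {x. A *v x + B *v y = b \<and> (\<forall>i. 0 \<le> x $ i)} \<noteq> {}"
      "\<And>y. y \<in> K \<Longrightarrow> bounded {x. A *v x + B *v y = b \<and> (\<forall>i. 0 \<le> x $ i)}"
  shows "polytope (\<Union>y\<in>K. {x. A *v x + B *v y = b \<and> (\<forall>i. 0 \<le> x $ i)})"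
proof -
  define T where "T = {q :: (real^'n) \<times> (real^'n). snd q \<in> K} \<inter>
     ((\<Inter>i. {q. (A $ i, B $ i) \<bullet> q = b $ i}) \<inter> (\<Inter>i. {q. (axis i 1, 0) \<bullet> q \<ge> 0}))"
  have T: "T = {(x, y). y \<in> K \<and> A *v x + B *v y = b \<and> (\<forall>i. 0 \<le> x $ i)}"
    by (auto simp: T_def inner_prod_def vec_eq_iff matrix_vector_mul_component inner_axis inner_commute)
  have "polyhedron T"
    unfolding T_def using K(1)
    by (intro polyhedron_Int polyhedron_snd_vimage polyhedron_Inter)
      (auto simp: polytope_imp_polyhedron polyhedron_hyperplane polyhedron_halfspace_ge)
  obtain y0 where y0: "y0 \<in> K" using K by blast
  obtain x0 where x0: "A *v x0 + B *v y0 = b" "\<forall>i. 0 \<le> x0 $ i" using feas(1)[OF y0] by blast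
  have "bounded {x. A *v x = b - B *v y0 \<and> (\<forall>i. 0 \<le> x $ i)}"
    using feas(2)[OF y0] by (simp add: eq_diff_eq)
  then have "x = 0" if "A *v x = 0" "\<forall>i. 0 \<le> x $ i" for x
    by (rule nonneg_kernel_trivial) (use x0 that in \<open>auto simp: eq_diff_eq\<close>)
  then obtain c where c: "c > 0" "\<And>x. (\<forall>i. 0 \<le> x $ i) \<Longrightarrow> c * norm x \<le> norm (A *v x)"
    using nonneg_kernel_bound[of A] by blast
  have cK: "compact K" using K(1) by (rule polytope_imp_compact)
  have "compact ((\<lambda>y. b - B *v y) ` K)"
    by (intro compact_continuous_image cK continuous_on_diff continuous_on_const
        matrix_vector_mult_linear_continuous_on)
  then have "bounded ((\<lambda>y. b - B *v y) ` K)" by (rule compact_imp_bounded)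
  then obtain M where M: "\<And>y. y \<in> K \<Longrightarrow> norm (b - B *v y) \<le> M"
    unfolding bounded_iff by blast
  have "norm x \<le> M / c" if "(x, y) \<in> T" for x y
  proof -
    have "c * norm x \<le> norm (A *v x)" using that c(2) by (auto simp: T)
    also have "A *v x = b - B *v y" using that by (auto simp: T eq_diff_eq)
    also have "norm \<dots> \<le> M" using that M by (auto simp: T)
    finally show ?thesis using c(1) by (simp add: field_simps)
  qed
  then have "T \<subseteq> cball 0 (M / c) \<times> K" by (auto simp: T)
  then have "bounded T"
    using bounded_subset[OF bounded_Times[OF bounded_cball compact_imp_bounded[OF cK]]] by blast
  then have "polytope T" using \<open>polyhedron T\<close> by (simp add: polytope_eq_bounded_polyhedron)
  then have "polytope (fst ` T)" by (intro polytope_linear_image linear_fst)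
  also have "fst ` T = (\<Union>y\<in>K. {x. A *v x + B *v y = b \<and> (\<forall>i. 0 \<le> x $ i)})"
    by (force simp: T)
  finally show ?thesis .
qed

text \<open>Plays the role of both \<open>K\<close> and \<open>D\<close> for linear
  problems.\<close>

primrec reachable :: "('w, 's, 'v) stoch_prog \<Rightarrow> 's list \<Rightarrow> 'v set" where
  "reachable P [] = {x_init P}"
| "reachable P (z # w) = (\<Union>y\<in>reachable P w. feas P (Suc (length w)) y z)"

context random_horizon
begin

text \<open>Translates reachability at a node into the sequences of decisions and realizations by
  which \<open>linear_problems\<close> states that the next feasible set is nonempty and
  bounded.\<close>

lemma reachable_trajectory:
  assumes "w \<in> nodes S t" "1 \<le> t" "t \<le> Tmax P" "y \<in> reachable P w"
  shows "\<exists>x z. x t = y \<and> (\<forall>\<tau>\<in>{2..t}. z \<tau> \<in> S \<tau>) \<and> x 1 \<in> feas P 1 (x_init P) (noise1 P) \<and>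
    (\<forall>\<tau>\<in>{2..t}. x \<tau> \<in> feas P \<tau> (x (\<tau> - 1)) (z \<tau>))"
  using assms(2,1,3,4)
proof (induction t arbitrary: w y rule: dec_induct)
  case base
  then have "w = [noise1 P]" using S_1 by auto
  then have "y \<in> feas P 1 (x_init P) (noise1 P)" using base by auto
  then show ?case by (intro exI[of _ "\<lambda>_. y"]) auto
next
  case (step t)
  then obtain z v where w: "w = z # v" "z \<in> S (Suc t)" "v \<in> nodes S t" by auto
  then obtain y' where y': "y' \<in> reachable P v" "y \<in> feas P (Suc t) y' z"
    using step.prems nodes_length[OF w(3)] by auto
  obtain x zz where x: "x t = y'" "\<forall>\<tau>\<in>{2..t}. zz \<tau> \<in> S \<tau>" "x 1 \<in> feas P 1 (x_init P) (noise1 P)"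
    "\<forall>\<tau>\<in>{2..t}. x \<tau> \<in> feas P \<tau> (x (\<tau> - 1)) (zz \<tau>)"
    using step.IH[OF w(3) _ y'(1)] step.prems by auto
  have "(x(Suc t := y)) \<tau> \<in> feas P \<tau> ((x(Suc t := y)) (\<tau> - 1)) ((zz(Suc t := z)) \<tau>)" if "\<tau> \<in> {2..Suc t}" for \<tau>
  proof (cases "\<tau> = Suc t")
    case True
    then show ?thesis using y' x(1) by simp
  next
    case False
    then have "\<tau> \<in> {2..t}" "\<tau> - 1 \<noteq> Suc t" using that by auto
    then show ?thesis using x(4) False by simp
  qed
  then show ?case
    using x w step.hyps by (intro exI[of _ "x(Suc t := y)"] exI[of _ "zz(Suc t := z)"]) auto
qed

end

text \<open>Reachable sets are nonempty polytopes by induction over the stages. Compactness bounds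
  the linear cost, and \<open>polyhedron_ray\<close> allows the prolongation to stay inside the same
  set.\<close>

lemma stage_structure_linear:
  fixes P :: "('w, 's::euclidean_space, real^'n) stoch_prog"
  assumes setting: "probabilistic_setting P" and lin: "linear_problems P A B b c"
    and lower: "\<forall>t\<in>{2..Tmax P}. \<forall>y. ereal (\<theta>0 t + \<beta>0 t \<bullet> y) \<le> cost_to_go P t y"
  shows "stage_structure P (reachable P) (reachable P) \<theta>0 \<beta>0"
proof -
  interpret random_horizon P by standard (rule setting)
  have cost: "cost P t x y z = ereal (c t z \<bullet> x)"
    and feas: "feas P t y z = {x. A t z *v x + B t z *v y = b t z \<and> (\<forall>i. 0 \<le> x $ i)}"
    if "t \<in> {1..Tmax P}" "z \<in> S t" for t x y z
    using lin that by (auto simp: linear_problems_def)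
  have next_ok: "feas P t (x (t - 1)) (z t) \<noteq> {} \<and> bounded (feas P t (x (t - 1)) (z t))"
    if "t \<in> {2..Tmax P}" "(\<forall>\<tau>\<in>{2..t}. z \<tau> \<in> S \<tau>) \<and> x 1 \<in> feas P 1 (x_init P) (noise1 P) \<and>
        (\<forall>\<tau>\<in>{2..t - 1}. x \<tau> \<in> feas P \<tau> (x (\<tau> - 1)) (z \<tau>))" for t x z
    using lin[unfolded linear_problems_def, THEN conjunct2, THEN conjunct2, THEN conjunct2, THEN bspec, OF that(1),
        THEN spec, THEN spec, THEN mp, OF that(2)] .
  have ok: "feas P (Suc t) y z \<noteq> {} \<and> bounded (feas P (Suc t) y z)"
    if t: "t < Tmax P" and w: "w \<in> nodes S t" and z: "z \<in> S (Suc t)" and y: "y \<in> reachable P w" for t w z y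
  proof (cases "t = 0")
    case True
    then show ?thesis using lin w y z S_1 by (auto simp: linear_problems_def)
  next
    case False
    then obtain x zz where x: "x t = y" "\<forall>\<tau>\<in>{2..t}. zz \<tau> \<in> S \<tau>" "x 1 \<in> feas P 1 (x_init P) (noise1 P)"
      "\<forall>\<tau>\<in>{2..t}. x \<tau> \<in> feas P \<tau> (x (\<tau> - 1)) (zz \<tau>)"
      using reachable_trajectory[OF w _ _ y] t by auto
    define z' where "z' = zz(Suc t := z)"
    have "Suc t \<in> {2..Tmax P}" using t False by auto
    moreover have "(\<forall>\<tau>\<in>{2..Suc t}. z' \<tau> \<in> S \<tau>) \<and> x 1 \<in> feas P 1 (x_init P) (noise1 P) \<and>
        (\<forall>\<tau>\<in>{2..Suc t - 1}. x \<tau> \<in> feas P \<tau> (x (\<tau> - 1)) (z' \<tau>))"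
      using x z by (auto simp: z'_def le_Suc_eq)
    ultimately have "feas P (Suc t) (x (Suc t - 1)) (z' (Suc t)) \<noteq> {} \<and> bounded (feas P (Suc t) (x (Suc t - 1)) (z' (Suc t)))"
      by (rule next_ok)
    then show ?thesis by (simp add: x(1) z'_def)
  qed
  have poly: "polytope (reachable P w) \<and> reachable P w \<noteq> {}" if "w \<in> nodes S t" "t \<le> Tmax P" for t w
    using that
  proof (induction t arbitrary: w)
    case 0
    then show ?case by (simp add: polytope_sing)
  next
    case (Suc t)
    then obtain z v where w: "w = z # v" "z \<in> S (Suc t)" "v \<in> nodes S t" by auto
    have t: "t < Tmax P" using Suc.prems by simp
    have IH: "polytope (reachable P v)" "reachable P v \<noteq> {}" using Suc.IH[OF w(3)] t by auto
    have f: "feas P (Suc t) y z = {x. A (Suc t) z *v x + B (Suc t) z *v y = b (Suc t) z \<and> (\<forall>i. 0 \<le> x $ i)}" for y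
      using feas[of "Suc t" z y] w t by simp
    have eq: "reachable P w = (\<Union>y\<in>reachable P v. {x. A (Suc t) z *v x + B (Suc t) z *v y = b (Suc t) z \<and> (\<forall>i. 0 \<le> x $ i)})"
      using nodes_length[OF w(3)] by (simp add: w f)
    have "polytope (reachable P w)"
      unfolding eq by (rule polytope_next_stage[OF IH]) (use ok[OF t w(3,2)] in \<open>simp_all add: f\<close>)
    moreover have "reachable P w \<noteq> {}"
      using ok[OF t w(3,2)] IH nodes_length[OF w(3)] by (auto simp: w)
    ultimately show ?case by simp
  qed
  show ?thesis
  proof (intro stage_structure.intro random_horizon_axioms stage_structure_axioms.intro)
    fix t w z assume t: "t < Tmax P" and w: "w \<in> nodes S t" and z: "z \<in> S (Suc t)"
    have zw: "z # w \<in> nodes S (Suc t)" using w z by auto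
    have "compact (reachable P (z # w))" using poly[OF zw] t by (intro polytope_imp_compact) auto
    then have "bounded (reachable P (z # w))" by (rule compact_imp_bounded)
    then obtain M where M: "\<And>x. x \<in> reachable P (z # w) \<Longrightarrow> norm x \<le> M"
      unfolding bounded_iff by blast
    show "\<exists>M. \<forall>y\<in>reachable P w. \<exists>x\<in>feas P (Suc t) y z. x \<in> reachable P (z # w) \<and> cost P (Suc t) x y z \<le> ereal M"
    proof (intro exI[of _ "norm (c (Suc t) z) * M"] ballI)
      fix y assume y: "y \<in> reachable P w"
      then obtain x where x: "x \<in> feas P (Suc t) y z" using ok[OF t w z y] by blast
      then have xr: "x \<in> reachable P (z # w)" using y nodes_length[OF w] by auto
      have "c (Suc t) z \<bullet> x \<le> norm (c (Suc t) z) * norm x" by (rule norm_cauchy_schwarz)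
      also have "\<dots> \<le> norm (c (Suc t) z) * M" using M[OF xr] by (intro mult_left_mono) auto
      finally show "\<exists>x\<in>feas P (Suc t) y z. x \<in> reachable P (z # w) \<and> cost P (Suc t) x y z \<le> ereal (norm (c (Suc t) z) * M)"
        using x xr cost[of "Suc t" z x y] t z by auto
    qed
  next
    fix t w l assume "t < Tmax P" "w \<in> nodes S t" "l \<in> reachable P w"
    then show "\<exists>r>0. \<forall>v\<in>reachable P w. v \<noteq> l \<longrightarrow> l + (r / norm (v - l)) *\<^sub>R (v - l) \<in> reachable P w"
      using poly[of w t] by (intro polyhedron_ray polytope_imp_polyhedron) auto
  next
    fix t w assume t: "t < Tmax P" and w: "w \<in> nodes S t"
    show "compact (reachable P w)" using poly[OF w] t by (intro polytope_imp_compact) simp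
    fix z y assume z: "z \<in> S (Suc t)" and y: "y \<in> reachable P w"
    show "feas P (Suc t) y z \<noteq> {}" using ok[OF t w z y] by simp
    show "feas P (Suc t) y z \<subseteq> reachable P (z # w)" using y nodes_length[OF w] by auto
    show "\<bar>cost P (Suc t) x y z\<bar> \<noteq> \<infinity>" for x using cost[of "Suc t" z x y] t z by simp
  qed (use lower in auto)
qed

section \<open>Nonlinear problems\<close>

lemma convex_lsc_finite_onD:
  assumes "convex_lsc_finite_on S h"
  shows "q \<in> S \<Longrightarrow> \<bar>h q\<bar> \<noteq> \<infinity>" "convex_on S (\<lambda>q. real_of_ereal (h q))"
  using assms by (simp_all add: convex_lsc_finite_on_def)

text \<open>The set for upper bounds is the enlargement by half the given radius: it is compact and
  contained in the open neighbourhood of full radius, over which the feasible sets are nonempty, as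
  \<open>bounded_selection\<close> demands.\<close>

lemma stage_structure_nonlinear:
  fixes P :: "('w, 's::euclidean_space, real^'n) stoch_prog"
  assumes setting: "probabilistic_setting P" and nonlin: "nonlinear_problems P X m g A B b"
    and lower: "\<forall>t\<in>{2..Tmax P}. \<forall>y. ereal (\<theta>0 t + \<beta>0 t \<bullet> y) \<le> cost_to_go P t y"
  shows "\<exists>D. stage_structure P (\<lambda>w. X (length w)) D \<theta>0 \<beta>0"
proof -
  interpret random_horizon P by standard (rule setting)
  have feas: "feas P t y z = {x. x \<in> X t \<and> (\<forall>i\<in>{1..m}. g t i x y z \<le> 0) \<and> A t z *v x + B t z *v y = b t z}"
    if "t \<in> {1..Tmax P}" "z \<in> S t" for t y z
    using nonlin that by (auto simp: nonlinear_problems_def)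
  have X0: "X 0 = {x_init P}" using nonlin by (simp add: nonlinear_problems_def)
  define G where "G = (\<lambda>t \<epsilon>. \<epsilon> > 0 \<and> (X t \<noteq> {} \<and> convex (X t) \<and> compact (X t)) \<and>
        (\<forall>z\<in>S t. convex_lsc_finite_on (X t \<times> enlarge \<epsilon> (X (t - 1))) (\<lambda>(x, y). cost P t x y z)) \<and>
        (\<forall>z\<in>S t. \<forall>i\<in>{1..m}. convex_lsc_finite_on (X t \<times> enlarge \<epsilon> (X (t - 1))) (\<lambda>(x, y). g t i x y z)) \<and>
        (\<forall>z\<in>S t. \<forall>y\<in>enlarge \<epsilon> (X (t - 1)). feas P t y z \<noteq> {}))"
  have "\<forall>t\<in>{1..Tmax P}. \<exists>\<epsilon>. G t \<epsilon>"
  proof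
    fix t assume "t \<in> {1..Tmax P}"
    with nonlin show "\<exists>\<epsilon>. G t \<epsilon>"
      unfolding nonlinear_problems_def G_def
      by (elim conjE) (drule (1) bspec, elim exE conjE, intro exI conjI, assumption+)
  qed
  then obtain \<epsilon> where G: "\<And>t. t \<in> {1..Tmax P} \<Longrightarrow> G t (\<epsilon> t)"
    by metis
  have \<epsilon>: "0 < \<epsilon> t" and X: "X t \<noteq> {} \<and> convex (X t) \<and> compact (X t)" if "t \<in> {1..Tmax P}" for t
    using G[OF that] by (simp_all add: G_def)
  have f: "convex_lsc_finite_on (X t \<times> enlarge (\<epsilon> t) (X (t - 1))) (\<lambda>(x, y). cost P t x y z)"
    and g: "i \<in> {1..m} \<Longrightarrow> convex_lsc_finite_on (X t \<times> enlarge (\<epsilon> t) (X (t - 1))) (\<lambda>(x, y). g t i x y z)"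
    and ne: "y \<in> enlarge (\<epsilon> t) (X (t - 1)) \<Longrightarrow> feas P t y z \<noteq> {}"
    if "t \<in> {1..Tmax P}" "z \<in> S t" for t z i y
    using G[OF that(1)] that(2) unfolding G_def by blast+
  have Xc: "compact (X t)" if "t \<le> Tmax P" for t
    using X[of t] X0 that by (cases "t = 0") auto
  have sub: "Y \<subseteq> enlarge e Y" if "0 \<le> e" for e and Y :: "(real^'n) set"
    using that by (force simp: enlarge_def)
  have bound: "\<exists>M. \<forall>y\<in>enlarge (\<epsilon> (Suc t) / 2) (X t). \<exists>x\<in>feas P (Suc t) y z. cost P (Suc t) x y z \<le> ereal M"
    if t: "t < Tmax P" and z: "z \<in> S (Suc t)" for t z
  proof -
    have tt: "Suc t \<in> {1..Tmax P}" using t by simp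
    let ?e = "\<epsilon> (Suc t)" and ?E = "enlarge (\<epsilon> (Suc t)) (X t)" and ?X = "X (Suc t)"
    have e: "?e > 0" using \<epsilon>[OF tt] .
    define W where "W = (\<Union>a\<in>X t. ball a ?e)"
    \<comment> \<open>The graph of the feasible-set map over the enlarged set. It is convex because
      the constraints are jointly convex in both decisions.\<close>
    define T where "T = {(x, y). y \<in> ?E \<and> x \<in> feas P (Suc t) y z}"
    note f' = f[OF tt z, unfolded diff_Suc_1 case_prod_unfold]
    have cf: "\<bar>cost P (Suc t) (fst q) (snd q) z\<bar> \<noteq> \<infinity>" if "q \<in> ?X \<times> ?E" for q
      using convex_lsc_finite_onD(1)[OF f' that] .
    have ccf: "convex_on (?X \<times> ?E) (\<lambda>q. real_of_ereal (cost P (Suc t) (fst q) (snd q) z))"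
      using convex_lsc_finite_onD(2)[OF f'] .
    have cg: "\<bar>g (Suc t) i (fst q) (snd q) z\<bar> \<noteq> \<infinity>" if "i \<in> {1..m}" "q \<in> ?X \<times> ?E" for i q
      using convex_lsc_finite_onD(1)[OF g[OF tt z that(1), unfolded diff_Suc_1 case_prod_unfold] that(2)] .
    have ccg: "convex_on (?X \<times> ?E) (\<lambda>q. real_of_ereal (g (Suc t) i (fst q) (snd q) z))" if "i \<in> {1..m}" for i
      using convex_lsc_finite_onD(2)[OF g[OF tt z that, unfolded diff_Suc_1 case_prod_unfold]] .
    have TX: "T \<subseteq> ?X \<times> ?E" unfolding T_def feas[OF tt z] by auto
    have T: "T = (?X \<times> ?E) \<inter> (\<Inter>i\<in>{1..m}. {q\<in>?X \<times> ?E. real_of_ereal (g (Suc t) i (fst q) (snd q) z) \<le> 0})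
        \<inter> {q. A (Suc t) z *v fst q + B (Suc t) z *v snd q = b (Suc t) z}"
    proof -
      have "real_of_ereal (g (Suc t) i x y z) \<le> 0 \<longleftrightarrow> g (Suc t) i x y z \<le> 0" if "i \<in> {1..m}" "x \<in> ?X" "y \<in> ?E" for i x y
        using cg[OF that(1), of "(x, y)"] that(2,3) by (cases "g (Suc t) i x y z") auto
      then show ?thesis unfolding T_def feas[OF tt z] by auto
    qed
    have "convex T"
      unfolding T
    proof (intro convex_Int convex_INT)
      show "convex (?X \<times> ?E)" using ccf by (rule convex_on_imp_convex)
      show "convex {q\<in>?X \<times> ?E. real_of_ereal (g (Suc t) i (fst q) (snd q) z) \<le> 0}" if "i \<in> {1..m}" for i
        using ccg[OF that] by (rule convex_on_sublevel)
      have "linear (\<lambda>q. A (Suc t) z *v fst q + B (Suc t) z *v snd q)"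
        by (rule linearI) (simp_all add: matrix_vector_right_distrib matrix_vector_mult_scaleR algebra_simps)
      from convex_linear_vimage[OF this convex_singleton[of "b (Suc t) z"]]
      show "convex {q. A (Suc t) z *v fst q + B (Suc t) z *v snd q = b (Suc t) z}"
        by (simp add: vimage_def)
    qed
    moreover have "compact (enlarge (?e / 2) (X t))"
    proof -
      have "enlarge (?e / 2) (X t) = {x + y | x y. x \<in> X t \<and> y \<in> cball 0 (?e / 2)}"
        by (auto simp: enlarge_def)
      then show ?thesis using Xc[of t] t by (simp only: compact_sums compact_cball less_imp_le)
    qed
    moreover have "enlarge (?e / 2) (X t) \<subseteq> W"
    proof
      fix y assume "y \<in> enlarge (?e / 2) (X t)"
      then obtain a d where "y = a + d" "a \<in> X t" "norm d \<le> ?e / 2" by (auto simp: enlarge_def)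
      then show "y \<in> W" using e unfolding W_def by (intro UN_I[of a]) (auto simp: dist_norm)
    qed
    moreover have "open W" by (auto simp: W_def)
    moreover have "\<exists>x. (x, y) \<in> T" if yW: "y \<in> W" for y
    proof -
      obtain a where a: "a \<in> X t" "dist a y < ?e" using yW by (auto simp: W_def)
      then have "y \<in> ?E"
        unfolding enlarge_def by (intro CollectI exI[of _ a] exI[of _ "y - a"]) (auto simp: dist_norm norm_minus_commute)
      then show ?thesis using ne[OF tt z] by (auto simp: T_def)
    qed
    moreover have "convex_on T (\<lambda>q. real_of_ereal (cost P (Suc t) (fst q) (snd q) z))"
      using ccf TX calculation(1) by (rule convex_on_subset)
    ultimately have "\<exists>M. \<forall>y\<in>enlarge (?e / 2) (X t). \<exists>x. (x, y) \<in> T \<and> real_of_ereal (cost P (Suc t) x y z) \<le> M"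
      using bounded_selection[of "enlarge (?e / 2) (X t)" W T "\<lambda>q. real_of_ereal (cost P (Suc t) (fst q) (snd q) z)"]
      by simp
    then obtain M where M: "\<forall>y\<in>enlarge (?e / 2) (X t). \<exists>x. (x, y) \<in> T \<and> real_of_ereal (cost P (Suc t) x y z) \<le> M" ..
    show ?thesis
    proof (intro exI[of _ M] ballI)
      fix y assume "y \<in> enlarge (?e / 2) (X t)"
      with M obtain x where x: "(x, y) \<in> T" "real_of_ereal (cost P (Suc t) x y z) \<le> M" by blast
      then have "cost P (Suc t) x y z \<le> ereal M"
        using cf[of "(x, y)"] TX by (cases "cost P (Suc t) x y z") auto
      then show "\<exists>x\<in>feas P (Suc t) y z. cost P (Suc t) x y z \<le> ereal M"
        using x by (auto simp: T_def)
    qed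
  qed
  have "stage_structure P (\<lambda>w. X (length w)) (\<lambda>w. enlarge (\<epsilon> (Suc (length w)) / 2) (X (length w))) \<theta>0 \<beta>0"
  proof (intro stage_structure.intro random_horizon_axioms stage_structure_axioms.intro)
    show "X (length []) = {x_init P}" using X0 by simp
  next
    fix t w assume t: "t < Tmax P" and "w \<in> nodes S t"
    then have len: "length w = t" by (simp add: nodes_length)
    have tt: "Suc t \<in> {1..Tmax P}" using t by simp
    show "compact (X (length w))" using Xc t len by simp
    show "X (length w) \<subseteq> enlarge (\<epsilon> (Suc (length w)) / 2) (X (length w))"
      using \<epsilon>[OF tt] len by (intro sub) simp
    {
      fix z assume z: "z \<in> S (Suc t)"
      have fX: "feas P (Suc t) y z \<subseteq> X (Suc t)" for y using feas[OF tt z] by auto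
      show "\<exists>M. \<forall>y\<in>enlarge (\<epsilon> (Suc (length w)) / 2) (X (length w)). \<exists>x\<in>feas P (Suc t) y z.
          x \<in> X (length (z # w)) \<and> cost P (Suc t) x y z \<le> ereal M"
        using bound[OF t z] fX len by simp blast
      fix y assume y: "y \<in> X (length w)"
      then have yE: "y \<in> enlarge (\<epsilon> (Suc t)) (X t)" using sub[of "\<epsilon> (Suc t)" "X t"] \<epsilon>[OF tt] len by auto
      then show "feas P (Suc t) y z \<noteq> {}" using ne[OF tt z] by simp
      show "feas P (Suc t) y z \<subseteq> X (length (z # w))" using fX len by simp
      fix x assume "x \<in> feas P (Suc t) y z"
      then have "(x, y) \<in> X (Suc t) \<times> enlarge (\<epsilon> (Suc t)) (X t)" using fX yE by auto
      then show "\<bar>cost P (Suc t) x y z\<bar> \<noteq> \<infinity>"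
        using convex_lsc_finite_onD(1)[OF f[OF tt z, unfolded diff_Suc_1 case_prod_unfold], of "(x, y)"] by simp
    }
    fix l assume l: "l \<in> X (length w)"
    \<comment> \<open>The prolonged point has distance exactly half the radius from
      \<open>l\<close>, whatever \<open>v\<close> is.\<close>
    have "l + (\<epsilon> (Suc t) / 2 / norm (v - l)) *\<^sub>R (v - l) \<in> enlarge (\<epsilon> (Suc t) / 2) (X t)" if "v \<noteq> l" for v
      unfolding enlarge_def mem_Collect_eq
      by (intro exI conjI, rule refl) (use l len that \<epsilon>[OF tt] in simp_all)
    then show "\<exists>r>0. \<forall>v\<in>X (length w). v \<noteq> l \<longrightarrow> l + (r / norm (v - l)) *\<^sub>R (v - l) \<in> enlarge (\<epsilon> (Suc (length w)) / 2) (X (length w))"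
      using \<epsilon>[OF tt] len by (intro exI[of _ "\<epsilon> (Suc t) / 2"]) auto
  qed (use lower in auto)
  then show ?thesis by blast
qed

theorem theorem4p1:
  fixes P :: "('w, 's::euclidean_space, real^'n) stoch_prog"
    and A B :: "nat \<Rightarrow> 's \<Rightarrow> real^'n^'m" and b :: "nat \<Rightarrow> 's \<Rightarrow> real^'m" and c :: "nat \<Rightarrow> 's \<Rightarrow> real^'n"
    and \<X> :: "nat \<Rightarrow> (real^'n) set" and m :: nat
    and g :: "nat \<Rightarrow> nat \<Rightarrow> real^'n \<Rightarrow> real^'n \<Rightarrow> 's \<Rightarrow> ereal"
    and \<theta>0 :: "nat \<Rightarrow> real" and \<beta>0 :: "nat \<Rightarrow> real^'n"
    and N :: "'a measure"
    and s :: "nat \<Rightarrow> nat \<Rightarrow> 'a \<Rightarrow> 's" and d :: "nat \<Rightarrow> nat \<Rightarrow> 'a \<Rightarrow> real"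
    and \<theta> :: "nat \<Rightarrow> nat \<Rightarrow> 'a \<Rightarrow> real" and \<beta> :: "nat \<Rightarrow> nat \<Rightarrow> 'a \<Rightarrow> real^'n"
    and \<beta>' \<gamma>' :: "nat \<Rightarrow> nat \<Rightarrow> 's \<Rightarrow> 'a \<Rightarrow> real^'n"
    and x :: "nat \<Rightarrow> nat \<Rightarrow> 'a \<Rightarrow> real^'n"
  assumes "probabilistic_setting P"
    and "linear_problems P A B b c \<or> nonlinear_problems P \<X> m g A B b"
    and "\<forall>t\<in>{2..Tmax P}. \<forall>y. ereal (\<theta>0 t + \<beta>0 t \<bullet> y) \<le> cost_to_go P t y"
    and "independent_samples P N s d"
    and "nonanticipative P N s d \<beta>' \<gamma>' x"
    and "AE \<omega> in N. sddp_tsto_run P \<theta>0 \<beta>0 (\<lambda>k t. s k t \<omega>) (\<lambda>k t. d k t \<omega>)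
           (\<lambda>k t. \<theta> k t \<omega>) (\<lambda>k t. \<beta> k t \<omega>) (\<lambda>k t z. \<beta>' k t z \<omega>) (\<lambda>k t z. \<gamma>' k t z \<omega>) (\<lambda>k t. x k t \<omega>)"
  shows "(\<forall>t\<in>{2..Tmax P + 1}. \<forall>k. AE \<omega> in N. \<forall>y.
            ereal (approx P (\<lambda>k t. \<theta> k t \<omega>) (\<lambda>k t. \<beta> k t \<omega>) k t y) \<le> cost_to_go P t y) \<and>
         (\<forall>k\<ge>1. AE \<omega> in N. lower_bound P (\<lambda>k t. \<theta> k t \<omega>) (\<lambda>k t. \<beta> k t \<omega>) k \<le> optimal_value P) \<and>
         (AE \<omega> in N. (\<lambda>k. cost P 1 (x k 1 \<omega>) (x_init P) (noise1 P)
              + ereal (approx P (\<lambda>k t. \<theta> k t \<omega>) (\<lambda>k t. \<beta> k t \<omega>) k 2 (x k 1 \<omega>)))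
            \<longlonglongrightarrow> optimal_value P)"
proof -
  have "\<exists>K D. stage_structure P K D \<theta>0 \<beta>0"
    using assms(2)
  proof
    assume "linear_problems P A B b c"
    from stage_structure_linear[OF assms(1) this assms(3)] show ?thesis by blast
  next
    assume "nonlinear_problems P \<X> m g A B b"
    from stage_structure_nonlinear[OF assms(1) this assms(3)] show ?thesis by blast
  qed
  then obtain K D where "stage_structure P K D \<theta>0 \<beta>0" by blast
  then have "sddp_samples P K D \<theta>0 \<beta>0 N s d \<theta> \<beta> \<beta>' \<gamma>' x"
    by (intro sddp_samples.intro sddp_samples_axioms.intro assms)
  from sddp_samples.convergence[OF this] show ?thesis by (intro conjI)
qed

end
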